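(* Let $s>5/2$, let $H^sG:=H^s\mathrm{Diff}(S^1)\circledS H^{s-1}(S^1)$, and let $\Gamma$ be the 2DP Christoffel map defined in the context. Then $\Gamma$ defines a smooth spray on $H^sG$, i.e., the map $$(\varphi,f)\mapsto\Gamma_{(\varphi,f)}\colon H^sG\to\mathcal{L}^2_{\mathrm{sym}}\bigl(H^s(S^1)\times H^{s-1}(S^1);\,H^s(S^1)\times H^{s-1}(S^1)\bigr)$$ is smooth.
   Context: $S^1\simeq\mathbb{R}/\mathbb{Z}$. $H^s\mathrm{Diff}(S^1)$ is the space of orientation-preserving diffeomorphisms of $S^1$ of Sobolev class $H^s$; for $s>5/2$ it is a Hilbert manifold and a topological group. $H^sG$ is the set $H^s\mathrm{Diff}(S^1)\times H^{s-1}(S^1)$ with group product $(\varphi,f)(\psi,g)=(\varphi\circ\psi,\,g+f\circ\psi)$; it is a topological group and a smooth manifold modeled on $H^s(S^1)\times H^{s-1}(S^1)$. The map $\varphi\mapsto(\varphi(0),\varphi(x)-x-\varphi(0))$ identifies $H^s\mathrm{Diff}(S^1)$ with $S^1\times\{h\in H^s(S^1): h(0)=0,\ h_x>-1\}$, giving a natural smooth identification $TH^sG\simeq H^sG\times(H^s(S^1)\times H^{s-1}(S^1))$. Let $A=1-\partial_x^2$ (an isomorphism $H^r(S^1)\to H^{r-2}(S^1)$). The 2DP Christoffel map at $(\mathrm{id},0)$ is the bilinear operator on $H^s(S^1)\times H^{s-1}(S^1)$ $$\Gamma_{(\mathrm{id},0)}((u,\rho),(v,\tau))=\Bigl(\Gamma^0_{\mathrm{id}}(u,v)-\tfrac12A^{-1}(u_x\tau+v_x\rho)+A^{-1}\partial_x(\rho\tau),\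 -(u_x\tau+v_x\rho)\Bigr),\qquad \Gamma^0_{\mathrm{id}}(u,v)=-\tfrac32A^{-1}\partial_x(uv),$$ extended to $H^sG$ by right-invariance: $\Gamma_{(\varphi,f)}(X,Y)=\Gamma_{(\mathrm{id},0)}(X\circ\varphi^{-1},Y\circ\varphi^{-1})\circ\varphi$ for $X,Y\in H^s(S^1)\times H^{s-1}(S^1)$, composition acting on each component. For Banach spaces $E,F$, $\mathcal{L}^2_{\mathrm{sym}}(E;F)$ denotes the Banach space of (bounded) symmetric bilinear maps from $E$ to $F$. *)

theory Defs
  imports "HOL-Analysis.Analysis" "HOL-Library.Function_Algebras"
begin

section \<open>Pointwise vector space structure on functions\<close>

instantiation "fun" :: (type, real_vector) real_vector
begin

definition scaleR_fun :: "real \<Rightarrow> ('a \<Rightarrow> 'b) \<Rightarrow> 'a \<Rightarrow> 'b" where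
  "scaleR_fun c f = (\<lambda>x. c *\<^sub>R f x)"

instance
  by standard (simp_all add: scaleR_fun_def fun_eq_iff scaleR_right_distrib scaleR_left_distrib)

end

section \<open>Normed spaces with an explicit carrier\<close>

text \<open>The Sobolev spaces depend on a real parameter, so they cannot be types of a normed-space
  type class. A normed space is represented by a linear subspace of an ambient real vector space
  and a norm, of which only the values on that subspace are relevant.\<close>

datatype 'a nspace = NSpace (pts: "'a set") (nrm: "'a \<Rightarrow> real")

definition nprod :: "'a nspace \<Rightarrow> 'b nspace \<Rightarrow> ('a \<times> 'b) nspace" where
  "nprod E F = NSpace (pts E \<times> pts F) (\<lambda>(x, y). sqrt ((nrm E x)\<^sup>2 + (nrm F y)\<^sup>2))"

definition real_nspace :: "real nspace" where
  "real_nspace = NSpace UNIV abs"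

definition bounded_linear_nspace ::
    "'a::real_vector nspace \<Rightarrow> 'b::real_vector nspace \<Rightarrow> ('a \<Rightarrow> 'b) \<Rightarrow> bool" where
  "bounded_linear_nspace E F L \<longleftrightarrow>
     (\<forall>x\<in>pts E. L x \<in> pts F) \<and>
     (\<forall>x\<in>pts E. \<forall>y\<in>pts E. L (x + y) = L x + L y) \<and>
     (\<forall>x\<in>pts E. \<forall>c. L (c *\<^sub>R x) = c *\<^sub>R L x) \<and>
     (\<exists>C. \<forall>x\<in>pts E. nrm F (L x) \<le> C * nrm E x)"

text \<open>The bounded \<open>k\<close>-linear maps from \<open>E\<close> to \<open>F\<close>, as functions on argument lists of length
  \<open>k\<close>, with the operator norm. Values at all other lists are normalised to \<open>0\<close>, so that
  equality of functions is equality of multilinear maps.\<close>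

definition arg_lists :: "'a nspace \<Rightarrow> nat \<Rightarrow> 'a list set" where
  "arg_lists E k = {vs. length vs = k \<and> set vs \<subseteq> pts E}"

definition multilinear_nspace ::
    "'a::real_vector nspace \<Rightarrow> 'b::real_vector nspace \<Rightarrow> nat \<Rightarrow> ('a list \<Rightarrow> 'b) nspace" where
  "multilinear_nspace E F k = NSpace
     {M. (\<forall>vs. vs \<notin> arg_lists E k \<longrightarrow> M vs = 0) \<and>
         (\<forall>vs\<in>arg_lists E k. M vs \<in> pts F) \<and>
         (\<forall>vs\<in>arg_lists E k. \<forall>i<k. \<forall>x\<in>pts E. \<forall>y\<in>pts E.
            M (vs[i := x + y]) = M (vs[i := x]) + M (vs[i := y])) \<and>
         (\<forall>vs\<in>arg_lists E k. \<forall>i<k. \<forall>x\<in>pts E. \<forall>c.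
            M (vs[i := c *\<^sub>R x]) = c *\<^sub>R M (vs[i := x])) \<and>
         (\<exists>C. \<forall>vs\<in>arg_lists E k. nrm F (M vs) \<le> C * (\<Prod>v\<leftarrow>vs. nrm E v))}
     (\<lambda>M. Inf {C. 0 \<le> C \<and> (\<forall>vs\<in>arg_lists E k. nrm F (M vs) \<le> C * (\<Prod>v\<leftarrow>vs. nrm E v))})"

text \<open>The bounded symmetric bilinear maps from \<open>E\<close> to \<open>F\<close> with the operator norm, again
  normalised to \<open>0\<close> outside the carrier.\<close>

definition L2sym ::
    "'a::real_vector nspace \<Rightarrow> 'b::real_vector nspace \<Rightarrow> ('a \<Rightarrow> 'a \<Rightarrow> 'b) nspace" where
  "L2sym E F = NSpace
     {B. (\<forall>x y. \<not> (x \<in> pts E \<and> y \<in> pts E) \<longrightarrow> B x y = 0) \<and>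
         (\<forall>x\<in>pts E. \<forall>y\<in>pts E. B x y \<in> pts F) \<and>
         (\<forall>x\<in>pts E. \<forall>y\<in>pts E. B x y = B y x) \<and>
         (\<forall>x\<in>pts E. \<forall>y\<in>pts E. \<forall>z\<in>pts E. B (x + y) z = B x z + B y z) \<and>
         (\<forall>x\<in>pts E. \<forall>z\<in>pts E. \<forall>c. B (c *\<^sub>R x) z = c *\<^sub>R B x z) \<and>
         (\<exists>C. \<forall>x\<in>pts E. \<forall>y\<in>pts E. nrm F (B x y) \<le> C * nrm E x * nrm E y)}
     (\<lambda>B. Inf {C. 0 \<le> C \<and>
         (\<forall>x\<in>pts E. \<forall>y\<in>pts E. nrm F (B x y) \<le> C * nrm E x * nrm E y)})"

section \<open>Frechet derivatives and smoothness\<close>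

definition has_fderiv ::
    "'a::real_vector nspace \<Rightarrow> 'b::real_vector nspace \<Rightarrow> 'a set \<Rightarrow> ('a \<Rightarrow> 'b) \<Rightarrow> ('a \<Rightarrow> 'b) \<Rightarrow> 'a \<Rightarrow> bool"
  where
  "has_fderiv E F U f f' x \<longleftrightarrow> bounded_linear_nspace E F f' \<and>
     (\<forall>\<epsilon>>0. \<exists>\<delta>>0. \<forall>h\<in>pts E. nrm E h < \<delta> \<longrightarrow> x + h \<in> U \<longrightarrow>
        nrm F (f (x + h) - f x - f' h) \<le> \<epsilon> * nrm E h)"

text \<open>\<open>f\<close> is infinitely often Frechet differentiable on the open subset \<open>U\<close> of \<open>E\<close>. The
  \<open>k\<close>-th derivative \<open>D k\<close> takes values in the space of \<open>k\<close>-linear maps, via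
  \<open>L(E; L\<^sup>k(E; F)) = L\<^sup>k\<^sup>+\<^sup>1(E; F)\<close>; this avoids an iteration through ever larger types.\<close>

definition smooth_nspace ::
    "'a::real_vector nspace \<Rightarrow> 'b::real_vector nspace \<Rightarrow> 'a set \<Rightarrow> ('a \<Rightarrow> 'b) \<Rightarrow> bool" where
  "smooth_nspace E F U f \<longleftrightarrow> (\<exists>D :: nat \<Rightarrow> 'a \<Rightarrow> 'a list \<Rightarrow> 'b.
     (\<forall>x\<in>U. D 0 x = (\<lambda>vs. if vs = [] then f x else 0)) \<and>
     (\<forall>k. \<forall>x\<in>U. D k x \<in> pts (multilinear_nspace E F k)) \<and>
     (\<forall>k. \<forall>x\<in>U. has_fderiv E (multilinear_nspace E F k) U (D k)
        (\<lambda>h vs. D (Suc k) x (h # vs)) x))"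

section \<open>Functions on the circle\<close>

quotient_type circle = real / "\<lambda>x y :: real. x - y \<in> \<int>"
  morphisms rep_circle proj
proof (rule equivpI)
  show "reflp (\<lambda>x y :: real. x - y \<in> \<int>)"
    by (simp add: reflp_def)
  show "symp (\<lambda>x y :: real. x - y \<in> \<int>)"
    by (metis (no_types, lifting) Ints_minus minus_diff_eq sympI)
  show "transp (\<lambda>x y :: real. x - y \<in> \<int>)"
    by (rule transpI) (metis Ints_add add_diff_cancel_right diff_add_cancel add_diff_eq)
qed

text \<open>The derivative does not depend on the representative, since \<open>u \<circ> proj\<close> is
  1-periodic.\<close>

definition Dx :: "(circle \<Rightarrow> real) \<Rightarrow> circle \<Rightarrow> real" where
  "Dx u p = deriv (\<lambda>x. u (proj x)) (rep_circle p)"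

definition fourier :: "(circle \<Rightarrow> real) \<Rightarrow> int \<Rightarrow> complex" where
  "fourier u k = integral {0..1}
     (\<lambda>x. complex_of_real (u (proj x)) * cis (- (2 * pi * of_int k * x)))"

text \<open>The Sobolev space \<open>H\<^sup>r\<close> of the circle for \<open>r > 1/2\<close>, each class being represented by its
  unique continuous member. The weight is a power of the symbol of \<open>1 - \<partial>\<^sub>x\<^sup>2\<close> with respect to
  the period 1.\<close>

definition sobolev :: "real \<Rightarrow> (circle \<Rightarrow> real) nspace" where
  "sobolev r = NSpace
     {u. continuous_on UNIV (\<lambda>x. u (proj x)) \<and>
         (\<lambda>k. (1 + (2 * pi * of_int k)\<^sup>2) powr r * (cmod (fourier u k))\<^sup>2) summable_on UNIV}
     (\<lambda>u. sqrt (\<Sum>\<^sub>\<infinity>k. (1 + (2 * pi * of_int k)\<^sup>2) powr r * (cmod (fourier u k))\<^sup>2))"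

text \<open>\<open>A = 1 - \<partial>\<^sub>x\<^sup>2\<close> as an operator \<open>H\<^sup>s \<rightarrow> H\<^sup>s\<^sup>-\<^sup>2\<close>, and its inverse. For \<open>s > 5/2\<close> the elements
  of \<open>H\<^sup>s\<close> are twice continuously differentiable, so the derivatives are classical.\<close>

definition helmholtz :: "(circle \<Rightarrow> real) \<Rightarrow> circle \<Rightarrow> real" where
  "helmholtz u = u - Dx (Dx u)"

definition Ainv :: "real \<Rightarrow> (circle \<Rightarrow> real) \<Rightarrow> circle \<Rightarrow> real" where
  "Ainv s = inv_into (pts (sobolev s)) helmholtz"

section \<open>The group and its manifold structure\<close>

text \<open>Orientation-preserving diffeomorphisms of class \<open>H\<^sup>s\<close>: bijections that have a lift \<open>F\<close> to
  the real line with positive derivative and with \<open>F - id\<close> a periodic function of class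
  \<open>H\<^sup>s\<close>. For \<open>s > 5/2\<close> such a lift is continuously differentiable.\<close>

definition HsDiff :: "real \<Rightarrow> (circle \<Rightarrow> circle) set" where
  "HsDiff s = {\<phi>. bij \<phi> \<and> (\<exists>F. (\<forall>x. \<phi> (proj x) = proj (F x)) \<and>
     (\<forall>x. 0 < deriv F x) \<and>
     (\<exists>u\<in>pts (sobolev s). \<forall>x. F x = x + u (proj x)))}"

definition HsG :: "real \<Rightarrow> ((circle \<Rightarrow> circle) \<times> (circle \<Rightarrow> real)) set" where
  "HsG s = HsDiff s \<times> pts (sobolev (s - 1))"

definition tangent_space :: "real \<Rightarrow> ((circle \<Rightarrow> real) \<times> (circle \<Rightarrow> real)) nspace" where
  "tangent_space s = nprod (sobolev s) (sobolev (s - 1))"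

text \<open>The identification \<open>\<phi> \<mapsto> (\<phi>(0), \<phi>(x) - x - \<phi>(0))\<close>, followed by the charts of the circle
  that invert \<open>proj\<close> on the intervals \<open>(a, a + 1)\<close>, gives an atlas of the group with values in
  \<open>\<real> \<times> {h \<in> H\<^sup>s. h(0) = 0} \<times> H\<^sup>s\<^sup>-\<^sup>1\<close>. Below are this model space, the range of the chart that
  belongs to \<open>a\<close>, and the inverse of the chart.\<close>

definition based_sobolev :: "real \<Rightarrow> (circle \<Rightarrow> real) nspace" where
  "based_sobolev s = NSpace {h\<in>pts (sobolev s). h (proj 0) = 0} (nrm (sobolev s))"

definition model_space :: "real \<Rightarrow> (real \<times> (circle \<Rightarrow> real) \<times> (circle \<Rightarrow> real)) nspace" where
  "model_space s = nprod real_nspace (nprod (based_sobolev s) (sobolev (s - 1)))"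

definition chart_range ::
    "real \<Rightarrow> real \<Rightarrow> (real \<times> (circle \<Rightarrow> real) \<times> (circle \<Rightarrow> real)) set" where
  "chart_range s a =
     {(c, h, f) \<in> pts (model_space s). a < c \<and> c < a + 1 \<and> (\<forall>p. Dx h p > - 1)}"

definition chart_inv ::
    "real \<times> (circle \<Rightarrow> real) \<times> (circle \<Rightarrow> real) \<Rightarrow> (circle \<Rightarrow> circle) \<times> (circle \<Rightarrow> real)" where
  "chart_inv = (\<lambda>(c, h, f). ((\<lambda>p. proj (c + rep_circle p + h p)), f))"

definition smooth_on_HsG ::
    "real \<Rightarrow> 'b::real_vector nspace \<Rightarrow> ((circle \<Rightarrow> circle) \<times> (circle \<Rightarrow> real) \<Rightarrow> 'b) \<Rightarrow> bool" where
  "smooth_on_HsG s F \<Psi> \<longleftrightarrow> \<Psi> \<in> HsG s \<rightarrow> pts F \<and>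
     (\<forall>a. smooth_nspace (model_space s) F (chart_range s a) (\<Psi> \<circ> chart_inv))"

section \<open>The Christoffel map of the 2DP equation\<close>

text \<open>Products of real-valued functions on the circle are pointwise.\<close>

definition Gamma0_id :: "real \<Rightarrow> (circle \<Rightarrow> real) \<Rightarrow> (circle \<Rightarrow> real) \<Rightarrow> circle \<Rightarrow> real" where
  "Gamma0_id s u v = - ((3/2) *\<^sub>R Ainv s (Dx (u * v)))"

definition Gamma_id ::
    "real \<Rightarrow> (circle \<Rightarrow> real) \<times> (circle \<Rightarrow> real) \<Rightarrow> (circle \<Rightarrow> real) \<times> (circle \<Rightarrow> real)
      \<Rightarrow> (circle \<Rightarrow> real) \<times> (circle \<Rightarrow> real)" where
  "Gamma_id s = (\<lambda>(u, \<rho>) (v, \<tau>).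
     (Gamma0_id s u v - (1/2) *\<^sub>R Ainv s (Dx u * \<tau> + Dx v * \<rho>) + Ainv s (Dx (\<rho> * \<tau>)),
      - (Dx u * \<tau> + Dx v * \<rho>)))"

definition comp2 ::
    "(circle \<Rightarrow> real) \<times> (circle \<Rightarrow> real) \<Rightarrow> (circle \<Rightarrow> circle) \<Rightarrow> (circle \<Rightarrow> real) \<times> (circle \<Rightarrow> real)" where
  "comp2 X \<phi> = (fst X \<circ> \<phi>, snd X \<circ> \<phi>)"

text \<open>The right-invariant extension, normalised to \<open>0\<close> outside the tangent space as required by
  \<^const>\<open>L2sym\<close>.\<close>

definition christoffel ::
    "real \<Rightarrow> (circle \<Rightarrow> circle) \<times> (circle \<Rightarrow> real)
      \<Rightarrow> (circle \<Rightarrow> real) \<times> (circle \<Rightarrow> real) \<Rightarrow> (circle \<Rightarrow> real) \<times> (circle \<Rightarrow> real)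
      \<Rightarrow> (circle \<Rightarrow> real) \<times> (circle \<Rightarrow> real)" where
  "christoffel s = (\<lambda>(\<phi>, f) X Y.
     if X \<in> pts (tangent_space s) \<and> Y \<in> pts (tangent_space s)
     then comp2 (Gamma_id s (comp2 X (inv \<phi>)) (comp2 Y (inv \<phi>))) \<phi>
     else 0)"

end

theory Submission
  imports Defs
begin

text \<open>Write \<open>\<phi> = id + w\<close>, and \<open>\<partial>\<^sub>\<phi> = \<phi>\<^sub>x\<^sup>-\<^sup>1 \<partial>\<^sub>x\<close> for the conjugate of \<open>\<partial>\<^sub>x\<close> by composition with \<open>\<phi>\<close>.
  Solving a linear ordinary differential equation gives
  \<open>(1 + \<partial>\<^sub>\<phi>)\<^sup>-\<^sup>1 g = exp (- w) (1 + \<partial>\<^sub>x)\<^sup>-\<^sup>1 (exp w \<phi>\<^sub>x g)\<close> and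
  \<open>(1 - \<partial>\<^sub>\<phi>)\<^sup>-\<^sup>1 g = exp w (1 - \<partial>\<^sub>x)\<^sup>-\<^sup>1 (exp (- w) \<phi>\<^sub>x g)\<close>. As \<open>A = (1 - \<partial>\<^sub>x) (1 + \<partial>\<^sub>x)\<close>, the
  right-invariant extension of \<open>A\<^sup>-\<^sup>1\<close> at \<open>\<phi>\<close> is built from multiplications by \<open>exp (\<plusminus> w)\<close> and \<open>\<phi>\<^sub>x\<close>
  and from fixed bounded operators, and in the second component of the Christoffel map only
  \<open>1 / \<phi>\<^sub>x\<close> appears. Smoothness is therefore reduced to that of the exponential and of the
  reciprocal in the Banach algebras \<open>H\<^sup>r\<close>, \<open>r > 1/2\<close>.
  Since \<open>A\<^sup>-\<^sup>1\<close> inverts \<open>A\<close> on \<open>H\<^sup>s\<close> only, the formula also needs that composition with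
  \<open>\<phi>\<^sup>-\<^sup>1\<close> preserves \<open>H\<^sup>s\<close>; for fractional \<open>s < 2\<close> this is an interpolation between \<open>L\<^sup>2\<close> and
  \<open>H\<^sup>2\<close>, and differentiation reduces larger \<open>s\<close> to that case.\<close>

section \<open>Seminormed spaces with explicit carrier\<close>

text \<open>The obstacle is that X o \<phi>^-1 is not differentiable in \<phi> as a map into
  \<open>H^s\<close>: each differentiation costs a derivative of X. Smoothness can therefore not be
  read off factor by factor from the right-invariant extension; the compositions have to cancel
  first. The formulas use w rather than \<phi> because the natural integrating factor exp \<phi> =
  exp x * exp w is not periodic: exp x is absorbed into the constant-coefficient operator 1 + d/dx,
  and exp w is an element of \<open>H^s\<close>. The factor \<phi>_x in front of g is matched by the
  sources. Conjugation turns each derivative into 1/\<phi>_x times a derivative, and every argument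
  of A^-1 in the Christoffel map contains exactly one derivative per term, so \<phi>_x cancels and
  what enters the resolvents is bilinear in X and Y with no dependence on the base point. What
  remains is a chain of bounded bilinear operations with smooth coefficients, for which a Leibniz
  rule on towers of derivatives suffices. The lowest space in the chain is \<open>H^(s-2)\<close>;
  the assumption s > 5/2 puts its order above 1/2, where products stay inside.\<close>

locale seminormed =
  fixes E :: "'a::real_vector nspace"
  assumes zero_mem: "0 \<in> pts E"
    and add_mem: "x \<in> pts E \<Longrightarrow> y \<in> pts E \<Longrightarrow> x + y \<in> pts E"
    and scale_mem: "x \<in> pts E \<Longrightarrow> c *\<^sub>R x \<in> pts E"
    and nrm_ge0: "x \<in> pts E \<Longrightarrow> 0 \<le> nrm E x"
    and nrm_add: "x \<in> pts E \<Longrightarrow> y \<in> pts E \<Longrightarrow> nrm E (x + y) \<le> nrm E x + nrm E y"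
    and nrm_scale: "x \<in> pts E \<Longrightarrow> nrm E (c *\<^sub>R x) = \<bar>c\<bar> * nrm E x"
begin

lemma minus_mem: "x \<in> pts E \<Longrightarrow> - x \<in> pts E"
  using scale_mem[of x "-1"] by simp

lemma diff_mem: "x \<in> pts E \<Longrightarrow> y \<in> pts E \<Longrightarrow> x - y \<in> pts E"
  using add_mem[of x "- y"] minus_mem[of y] by simp

lemma nrm_zero: "nrm E 0 = 0"
  using nrm_scale[OF zero_mem, of 0] by simp

lemma nrm_minus: "x \<in> pts E \<Longrightarrow> nrm E (- x) = nrm E x"
  using nrm_scale[of x "-1"] by simp

lemma nrm_diff: "x \<in> pts E \<Longrightarrow> y \<in> pts E \<Longrightarrow> nrm E (x - y) \<le> nrm E x + nrm E y"
  using nrm_add[of x "- y"] minus_mem[of y] nrm_minus[of y] by simp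

lemma sum_mem: "(\<And>i. i \<in> I \<Longrightarrow> f i \<in> pts E) \<Longrightarrow> sum f I \<in> pts E"
  by (induction I rule: infinite_finite_induct) (auto intro: zero_mem add_mem)

lemma nrm_sum: "(\<And>i. i \<in> I \<Longrightarrow> f i \<in> pts E) \<Longrightarrow> nrm E (sum f I) \<le> (\<Sum>i\<in>I. nrm E (f i))"
proof (induction I rule: infinite_finite_induct)
  case (insert i I)
  then have "nrm E (f i + sum f I) \<le> nrm E (f i) + nrm E (sum f I)"
    by (intro nrm_add sum_mem) auto
  with insert show ?case by auto
qed (auto simp: nrm_zero)

lemma prod_nrm_ge0: "vs \<in> arg_lists E k \<Longrightarrow> 0 \<le> (\<Prod>v\<leftarrow>vs. nrm E v)"
  by (auto simp: arg_lists_def subset_iff intro!: prod_list_nonneg nrm_ge0)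

end

text \<open>The inequality for \<open>c\<close> implies its reverse when it is applied to
  \<open>inverse c\<close> and the scaled vector, so it already gives homogeneity.\<close>

lemma seminormedI:
  assumes "0 \<in> pts E"
    and "\<And>x y. x \<in> pts E \<Longrightarrow> y \<in> pts E \<Longrightarrow> x + y \<in> pts E"
    and scale: "\<And>x c. x \<in> pts E \<Longrightarrow> c *\<^sub>R x \<in> pts E"
    and ge0: "\<And>x. x \<in> pts E \<Longrightarrow> 0 \<le> nrm E x"
    and "\<And>x y. x \<in> pts E \<Longrightarrow> y \<in> pts E \<Longrightarrow> nrm E (x + y) \<le> nrm E x + nrm E y"
    and le: "\<And>x c. x \<in> pts E \<Longrightarrow> nrm E (c *\<^sub>R x) \<le> \<bar>c\<bar> * nrm E x"
  shows "seminormed E"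
proof
  show "nrm E (c *\<^sub>R x) = \<bar>c\<bar> * nrm E x" if x: "x \<in> pts E" for c x
  proof (cases "c = 0")
    case True
    then show ?thesis using le[OF x, of c] ge0[OF scale[OF x, of c]] by simp
  next
    case False
    have "nrm E (inverse c *\<^sub>R c *\<^sub>R x) \<le> \<bar>inverse c\<bar> * nrm E (c *\<^sub>R x)"
      by (rule le[OF scale[OF x]])
    then have "\<bar>c\<bar> * nrm E x \<le> nrm E (c *\<^sub>R x)" using False by (simp add: field_simps abs_inverse)
    with le[OF x, of c] show ?thesis by simp
  qed
qed (use assms in auto)

lemma seminormed_nprod:
  assumes "seminormed E" "seminormed F"
  shows "seminormed (nprod E F)"
proof -
  interpret E: seminormed E by fact
  interpret F: seminormed F by fact
  show ?thesis
  proof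
    fix x y assume xy: "x \<in> pts (nprod E F)" "y \<in> pts (nprod E F)"
    obtain x1 x2 y1 y2 where [simp]: "x = (x1, x2)" "y = (y1, y2)" by fastforce
    have m: "x1 \<in> pts E" "y1 \<in> pts E" "x2 \<in> pts F" "y2 \<in> pts F"
      using xy by (auto simp: nprod_def)
    have "sqrt ((nrm E (x1 + y1))\<^sup>2 + (nrm F (x2 + y2))\<^sup>2)
        \<le> sqrt ((nrm E x1 + nrm E y1)\<^sup>2 + (nrm F x2 + nrm F y2)\<^sup>2)"
      using m by (intro real_sqrt_le_mono add_mono power_mono E.nrm_add F.nrm_add E.nrm_ge0
          F.nrm_ge0 E.add_mem F.add_mem)
    also have "\<dots> \<le> sqrt ((nrm E x1)\<^sup>2 + (nrm F x2)\<^sup>2) + sqrt ((nrm E y1)\<^sup>2 + (nrm F y2)\<^sup>2)"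
      by (rule real_sqrt_sum_squares_triangle_ineq)
    finally show "nrm (nprod E F) (x + y) \<le> nrm (nprod E F) x + nrm (nprod E F) y"
      by (simp add: nprod_def)
  next
    fix x c assume x: "x \<in> pts (nprod E F)"
    obtain x1 x2 where [simp]: "x = (x1, x2)" by fastforce
    have m: "x1 \<in> pts E" "x2 \<in> pts F"
      using x by (auto simp: nprod_def)
    have "sqrt ((nrm E (c *\<^sub>R x1))\<^sup>2 + (nrm F (c *\<^sub>R x2))\<^sup>2)
       = sqrt (c\<^sup>2 * ((nrm E x1)\<^sup>2 + (nrm F x2)\<^sup>2))"
      using m by (simp add: E.nrm_scale F.nrm_scale power_mult_distrib algebra_simps)
    then show "nrm (nprod E F) (c *\<^sub>R x) = \<bar>c\<bar> * nrm (nprod E F) x"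
      by (simp add: nprod_def real_sqrt_mult)
  qed (auto simp: nprod_def zero_prod_def intro: E.zero_mem F.zero_mem E.add_mem F.add_mem
        E.scale_mem F.scale_mem)
qed

lemma nprod_fst_le: "nrm E (fst p) \<le> nrm (nprod E F) p"
  by (cases p) (simp add: nprod_def real_le_rsqrt)

lemma nprod_snd_le: "nrm F (snd p) \<le> nrm (nprod E F) p"
  by (cases p) (simp add: nprod_def real_le_rsqrt)

text \<open>The operator norms of \<^const>\<open>multilinear_nspace\<close> and \<^const>\<open>L2sym\<close> are infima of this form.\<close>

lemma Inf_bounds:
  fixes a p :: "'i \<Rightarrow> real"
  assumes "\<exists>C. \<forall>i\<in>I. a i \<le> C * p i" and p: "\<And>i. i \<in> I \<Longrightarrow> 0 \<le> p i"
  defines "m \<equiv> Inf {C. 0 \<le> C \<and> (\<forall>i\<in>I. a i \<le> C * p i)}"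
  shows "0 \<le> m" and "i \<in> I \<Longrightarrow> a i \<le> m * p i"
    and "0 \<le> C \<Longrightarrow> (\<And>i. i \<in> I \<Longrightarrow> a i \<le> C * p i) \<Longrightarrow> m \<le> C"
proof -
  let ?S = "{C. 0 \<le> C \<and> (\<forall>i\<in>I. a i \<le> C * p i)}"
  obtain C where C: "\<forall>i\<in>I. a i \<le> C * p i" using assms(1) by blast
  \<comment> \<open>The hypothesis gives a constant of any sign, whereas the infimum ranges over
    nonnegative ones.\<close>
  have "max 0 C \<in> ?S"
  proof -
    have "a i \<le> max 0 C * p i" if "i \<in> I" for i
      using C p[OF that] that by (smt (verit) mult_right_mono)
    then show ?thesis by auto
  qed
  then have ne: "?S \<noteq> {}" by blast
  have bd: "bdd_below ?S" by (rule bdd_belowI[of _ 0]) auto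
  show "0 \<le> m" unfolding m_def using ne by (intro cInf_greatest) auto
  show "m \<le> C" if "0 \<le> C" "\<And>i. i \<in> I \<Longrightarrow> a i \<le> C * p i" for C
    unfolding m_def using that by (intro cInf_lower bd) auto
  show "a i \<le> m * p i" if i: "i \<in> I"
  proof (cases "p i = 0")
    case True
    \<comment> \<open>Division by \<open>p i\<close> is impossible here, but any admissible constant
      already gives \<open>a i \<le> 0\<close>.\<close>
    then show ?thesis using C i by auto
  next
    case False
    then have pos: "0 < p i" using p[OF i] by simp
    have "a i / p i \<le> m"
      unfolding m_def using pos i by (intro cInf_greatest ne) (auto simp: pos_divide_le_eq)
    then show ?thesis using pos by (simp add: pos_divide_le_eq)
  qed
qed

lemma L2sym_pts_iff:
  "B \<in> pts (L2sym E F) \<longleftrightarrow>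
     (\<forall>x y. \<not> (x \<in> pts E \<and> y \<in> pts E) \<longrightarrow> B x y = 0) \<and>
     (\<forall>x\<in>pts E. \<forall>y\<in>pts E. B x y \<in> pts F) \<and>
     (\<forall>x\<in>pts E. \<forall>y\<in>pts E. B x y = B y x) \<and>
     (\<forall>x\<in>pts E. \<forall>y\<in>pts E. \<forall>z\<in>pts E. B (x + y) z = B x z + B y z) \<and>
     (\<forall>x\<in>pts E. \<forall>z\<in>pts E. \<forall>c. B (c *\<^sub>R x) z = c *\<^sub>R B x z) \<and>
     (\<exists>C. \<forall>x\<in>pts E. \<forall>y\<in>pts E. nrm F (B x y) \<le> C * nrm E x * nrm E y)"
  by (simp add: L2sym_def)

lemma multilinear_pts_iff:
  "M \<in> pts (multilinear_nspace E F k) \<longleftrightarrow>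
     (\<forall>vs. vs \<notin> arg_lists E k \<longrightarrow> M vs = 0) \<and>
     (\<forall>vs\<in>arg_lists E k. M vs \<in> pts F) \<and>
     (\<forall>vs\<in>arg_lists E k. \<forall>i<k. \<forall>x\<in>pts E. \<forall>y\<in>pts E.
        M (vs[i := x + y]) = M (vs[i := x]) + M (vs[i := y])) \<and>
     (\<forall>vs\<in>arg_lists E k. \<forall>i<k. \<forall>x\<in>pts E. \<forall>c.
        M (vs[i := c *\<^sub>R x]) = c *\<^sub>R M (vs[i := x])) \<and>
     (\<exists>C. \<forall>vs\<in>arg_lists E k. nrm F (M vs) \<le> C * (\<Prod>v\<leftarrow>vs. nrm E v))"
  by (simp add: multilinear_nspace_def)

lemma multilinear_nrm:
  assumes "seminormed E" "M \<in> pts (multilinear_nspace E F k)"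
  shows "0 \<le> nrm (multilinear_nspace E F k) M"
    and "vs \<in> arg_lists E k \<Longrightarrow>
      nrm F (M vs) \<le> nrm (multilinear_nspace E F k) M * (\<Prod>v\<leftarrow>vs. nrm E v)"
    and "0 \<le> C \<Longrightarrow> (\<And>vs. vs \<in> arg_lists E k \<Longrightarrow> nrm F (M vs) \<le> C * (\<Prod>v\<leftarrow>vs. nrm E v)) \<Longrightarrow>
      nrm (multilinear_nspace E F k) M \<le> C"
  using Inf_bounds[of "arg_lists E k" "\<lambda>vs. nrm F (M vs)" "\<lambda>vs. (\<Prod>v\<leftarrow>vs. nrm E v)"] assms
  by (simp_all add: multilinear_nspace_def seminormed.prod_nrm_ge0)

lemma L2sym_nrm:
  assumes E: "seminormed E" and B: "B \<in> pts (L2sym E F)"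
  shows "0 \<le> nrm (L2sym E F) B"
    and "x \<in> pts E \<Longrightarrow> y \<in> pts E \<Longrightarrow> nrm F (B x y) \<le> nrm (L2sym E F) B * nrm E x * nrm E y"
    and "0 \<le> C \<Longrightarrow> (\<And>x y. x \<in> pts E \<Longrightarrow> y \<in> pts E \<Longrightarrow> nrm F (B x y) \<le> C * nrm E x * nrm E y) \<Longrightarrow>
      nrm (L2sym E F) B \<le> C"
proof -
  note I = Inf_bounds[of "pts E \<times> pts E" "\<lambda>(x, y). nrm F (B x y)" "\<lambda>(x, y). nrm E x * nrm E y"]
  have ex: "\<exists>C. \<forall>i\<in>pts E \<times> pts E. (case i of (x, y) \<Rightarrow> nrm F (B x y)) \<le>
        C * (case i of (x, y) \<Rightarrow> nrm E x * nrm E y)"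
    using B by (simp add: L2sym_def mult.assoc)
  have p: "\<And>i. i \<in> pts E \<times> pts E \<Longrightarrow> 0 \<le> (case i of (x, y) \<Rightarrow> nrm E x * nrm E y)"
    using E by (auto simp: seminormed.nrm_ge0)
  have eq: "nrm (L2sym E F) B = Inf {C. 0 \<le> C \<and> (\<forall>i\<in>pts E \<times> pts E.
     (case i of (x, y) \<Rightarrow> nrm F (B x y)) \<le> C * (case i of (x, y) \<Rightarrow> nrm E x * nrm E y))}"
    by (simp add: L2sym_def mult.assoc)
  show "0 \<le> nrm (L2sym E F) B"
    unfolding eq by (rule I(1)[OF ex p])
  show "nrm F (B x y) \<le> nrm (L2sym E F) B * nrm E x * nrm E y" if "x \<in> pts E" "y \<in> pts E"
    using I(2)[OF ex p, of "(x, y)"] that unfolding eq by (simp add: mult.assoc)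
  show "nrm (L2sym E F) B \<le> C"
    if "0 \<le> C" "\<And>x y. x \<in> pts E \<Longrightarrow> y \<in> pts E \<Longrightarrow> nrm F (B x y) \<le> C * nrm E x * nrm E y"
    unfolding eq by (rule I(3)[OF ex p]) (use that in \<open>auto simp: mult.assoc\<close>)
qed

lemma arg_lists_update:
  "vs \<in> arg_lists E k \<Longrightarrow> x \<in> pts E \<Longrightarrow> vs[i := x] \<in> arg_lists E k"
  unfolding arg_lists_def using set_update_subset_insert[of vs i x] by auto

lemma seminormed_multilinear:
  assumes E: "seminormed E" and F: "seminormed F"
  shows "seminormed (multilinear_nspace E F k)"
proof -
  interpret E: seminormed E by fact
  interpret F: seminormed F by fact
  let ?L = "multilinear_nspace E F k"
  have add: "M + N \<in> pts ?L" if M: "M \<in> pts ?L" and N: "N \<in> pts ?L" for M N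
  proof -
    have "\<exists>C. \<forall>vs\<in>arg_lists E k. nrm F ((M + N) vs) \<le> C * (\<Prod>v\<leftarrow>vs. nrm E v)"
    proof (intro exI ballI)
      fix vs assume vs: "vs \<in> arg_lists E k"
      have "nrm F (M vs + N vs) \<le> nrm F (M vs) + nrm F (N vs)"
        using M N vs by (intro F.nrm_add) (auto simp: multilinear_pts_iff)
      then show "nrm F ((M + N) vs) \<le> (nrm ?L M + nrm ?L N) * (\<Prod>v\<leftarrow>vs. nrm E v)"
        using multilinear_nrm(2)[OF E M vs] multilinear_nrm(2)[OF E N vs]
        by (simp add: algebra_simps)
    qed
    with M N show ?thesis
      unfolding multilinear_pts_iff by (auto simp: F.add_mem algebra_simps)
  qed
  have scale: "c *\<^sub>R M \<in> pts ?L" if M: "M \<in> pts ?L" for c M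
  proof -
    have "\<exists>C. \<forall>vs\<in>arg_lists E k. nrm F ((c *\<^sub>R M) vs) \<le> C * (\<Prod>v\<leftarrow>vs. nrm E v)"
    proof (intro exI ballI)
      fix vs assume vs: "vs \<in> arg_lists E k"
      have "nrm F (c *\<^sub>R M vs) = \<bar>c\<bar> * nrm F (M vs)"
        using M vs by (intro F.nrm_scale) (auto simp: multilinear_pts_iff)
      then show "nrm F ((c *\<^sub>R M) vs) \<le> (\<bar>c\<bar> * nrm ?L M) * (\<Prod>v\<leftarrow>vs. nrm E v)"
        using mult_left_mono[OF multilinear_nrm(2)[OF E M vs], of "\<bar>c\<bar>"]
        by (simp add: scaleR_fun_def mult.assoc)
    qed
    with M show ?thesis
      unfolding multilinear_pts_iff
      by (auto simp: F.scale_mem scaleR_fun_def scaleR_add_right)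
  qed
  have scale_le: "nrm ?L (c *\<^sub>R M) \<le> \<bar>c\<bar> * nrm ?L M" if M: "M \<in> pts ?L" for c M
  proof (rule multilinear_nrm(3)[OF E scale[OF M]])
    show "0 \<le> \<bar>c\<bar> * nrm ?L M" using multilinear_nrm(1)[OF E M] by simp
    fix vs assume vs: "vs \<in> arg_lists E k"
    have "nrm F (c *\<^sub>R M vs) = \<bar>c\<bar> * nrm F (M vs)"
      using M vs by (intro F.nrm_scale) (auto simp: multilinear_pts_iff)
    then show "nrm F ((c *\<^sub>R M) vs) \<le> (\<bar>c\<bar> * nrm ?L M) * (\<Prod>v\<leftarrow>vs. nrm E v)"
      using mult_left_mono[OF multilinear_nrm(2)[OF E M vs], of "\<bar>c\<bar>"]
      by (simp add: scaleR_fun_def mult.assoc)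
  qed
  show ?thesis
  proof (rule seminormedI)
    show "0 \<in> pts ?L"
      by (auto simp: multilinear_pts_iff F.zero_mem F.nrm_zero intro!: exI[of _ 0])
    show "M + N \<in> pts ?L" "nrm ?L (M + N) \<le> nrm ?L M + nrm ?L N"
      if M: "M \<in> pts ?L" and N: "N \<in> pts ?L" for M N
    proof -
      show mn: "M + N \<in> pts ?L" by (rule add[OF that])
      show "nrm ?L (M + N) \<le> nrm ?L M + nrm ?L N"
      proof (rule multilinear_nrm(3)[OF E mn])
        show "0 \<le> nrm ?L M + nrm ?L N"
          using multilinear_nrm(1)[OF E M] multilinear_nrm(1)[OF E N] by simp
        fix vs assume vs: "vs \<in> arg_lists E k"
        have "nrm F (M vs + N vs) \<le> nrm F (M vs) + nrm F (N vs)"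
          using M N vs by (intro F.nrm_add) (auto simp: multilinear_pts_iff)
        then show "nrm F ((M + N) vs) \<le> (nrm ?L M + nrm ?L N) * (\<Prod>v\<leftarrow>vs. nrm E v)"
          using multilinear_nrm(2)[OF E M vs] multilinear_nrm(2)[OF E N vs]
          by (simp add: algebra_simps)
      qed
    qed
    show "c *\<^sub>R M \<in> pts ?L" if "M \<in> pts ?L" for c M using scale[OF that] .
    show "0 \<le> nrm ?L M" if "M \<in> pts ?L" for M using multilinear_nrm(1)[OF E that] .
    show "nrm ?L (c *\<^sub>R M) \<le> \<bar>c\<bar> * nrm ?L M" if "M \<in> pts ?L" for c M using scale_le[OF that] .
  qed
qed

lemma seminormed_L2sym:
  assumes E: "seminormed E" and F: "seminormed F"
  shows "seminormed (L2sym E F)"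
proof -
  interpret E: seminormed E by fact
  interpret F: seminormed F by fact
  let ?L = "L2sym E F"
  have mem: "B x y \<in> pts F" if "B \<in> pts ?L" "x \<in> pts E" "y \<in> pts E" for B x y
    using that by (auto simp: L2sym_pts_iff)
  have addb: "nrm F ((M + N) x y) \<le> (nrm ?L M + nrm ?L N) * nrm E x * nrm E y"
    if "M \<in> pts ?L" "N \<in> pts ?L" "x \<in> pts E" "y \<in> pts E" for M N x y
    using F.nrm_add[OF mem[OF that(1,3,4)] mem[OF that(2,3,4)]]
      L2sym_nrm(2)[OF E that(1,3,4)] L2sym_nrm(2)[OF E that(2,3,4)]
    by (simp add: algebra_simps)
  have scaleb: "nrm F ((c *\<^sub>R M) x y) \<le> (\<bar>c\<bar> * nrm ?L M) * nrm E x * nrm E y"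
    if "M \<in> pts ?L" "x \<in> pts E" "y \<in> pts E" for M c x y
    using F.nrm_scale[OF mem[OF that], of c] mult_left_mono[OF L2sym_nrm(2)[OF E that], of "\<bar>c\<bar>"]
    by (simp add: scaleR_fun_def mult.assoc)
  have add: "M + N \<in> pts ?L" if M: "M \<in> pts ?L" and N: "N \<in> pts ?L" for M N
  proof -
    have "\<exists>C. \<forall>x\<in>pts E. \<forall>y\<in>pts E. nrm F ((M + N) x y) \<le> C * nrm E x * nrm E y"
      using addb[OF M N] by blast
    moreover have "(M + N) x y = (M + N) y x" if "x \<in> pts E" "y \<in> pts E" for x y
      using M N that unfolding L2sym_pts_iff by (metis plus_fun_apply)
    ultimately show ?thesis using M N
      unfolding L2sym_pts_iff by (simp add: F.add_mem scaleR_add_right add_ac)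
  qed
  have scale: "c *\<^sub>R M \<in> pts ?L" if M: "M \<in> pts ?L" for c M
  proof -
    have "\<exists>C. \<forall>x\<in>pts E. \<forall>y\<in>pts E. nrm F ((c *\<^sub>R M) x y) \<le> C * nrm E x * nrm E y"
      using scaleb[OF M] by blast
    moreover have "(c *\<^sub>R M) x y = (c *\<^sub>R M) y x" if "x \<in> pts E" "y \<in> pts E" for x y
      using M that unfolding L2sym_pts_iff by (metis scaleR_fun_def)
    ultimately show ?thesis using M
      unfolding L2sym_pts_iff by (simp add: F.scale_mem scaleR_fun_def scaleR_add_right)
  qed
  have scale_le: "nrm ?L (c *\<^sub>R M) \<le> \<bar>c\<bar> * nrm ?L M" if M: "M \<in> pts ?L" for c M
    using L2sym_nrm(1)[OF E M] scaleb[OF M] by (intro L2sym_nrm(3)[OF E scale[OF M]]) auto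
  show ?thesis
  proof (rule seminormedI)
    show "0 \<in> pts ?L"
      by (auto simp: L2sym_pts_iff F.zero_mem F.nrm_zero intro!: exI[of _ 0])
    show "M + N \<in> pts ?L" "nrm ?L (M + N) \<le> nrm ?L M + nrm ?L N"
      if M: "M \<in> pts ?L" and N: "N \<in> pts ?L" for M N
      using L2sym_nrm(1)[OF E M] L2sym_nrm(1)[OF E N] addb[OF M N]
      by (auto intro!: add[OF that] L2sym_nrm(3)[OF E add[OF that]])
    show "c *\<^sub>R M \<in> pts ?L" if "M \<in> pts ?L" for c M using scale[OF that] .
    show "0 \<le> nrm ?L M" if "M \<in> pts ?L" for M using L2sym_nrm(1)[OF E that] .
    show "nrm ?L (c *\<^sub>R M) \<le> \<bar>c\<bar> * nrm ?L M" if "M \<in> pts ?L" for c M using scale_le[OF that] .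
  qed
qed

section \<open>Differential calculus\<close>

definition bounded_bilinear_nspace ::
    "'a::real_vector nspace \<Rightarrow> 'b::real_vector nspace \<Rightarrow> 'c::real_vector nspace \<Rightarrow> ('a \<Rightarrow> 'b \<Rightarrow> 'c) \<Rightarrow>
        bool" where
  "bounded_bilinear_nspace E F G B \<longleftrightarrow>
     (\<forall>x\<in>pts E. \<forall>y\<in>pts F. B x y \<in> pts G) \<and>
     (\<forall>x\<in>pts E. \<forall>x'\<in>pts E. \<forall>y\<in>pts F. B (x + x') y = B x y + B x' y) \<and>
     (\<forall>x\<in>pts E. \<forall>y\<in>pts F. \<forall>y'\<in>pts F. B x (y + y') = B x y + B x y') \<and>
     (\<forall>x\<in>pts E. \<forall>y\<in>pts F. \<forall>c. B (c *\<^sub>R x) y = c *\<^sub>R B x y) \<and>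
     (\<forall>x\<in>pts E. \<forall>y\<in>pts F. \<forall>c. B x (c *\<^sub>R y) = c *\<^sub>R B x y) \<and>
     (\<exists>C. \<forall>x\<in>pts E. \<forall>y\<in>pts F. nrm G (B x y) \<le> C * nrm E x * nrm F y)"

lemma bounded_bilinear_nspace_bound:
  assumes "bounded_bilinear_nspace E F G B" "seminormed E" "seminormed F"
  obtains C where "0 \<le> C" "\<And>x y. x \<in> pts E \<Longrightarrow> y \<in> pts F \<Longrightarrow> nrm G (B x y) \<le> C * nrm E x * nrm F y"
proof -
  obtain C where C: "\<forall>x\<in>pts E. \<forall>y\<in>pts F. nrm G (B x y) \<le> C * nrm E x * nrm F y"
    using assms by (auto simp: bounded_bilinear_nspace_def)
  have "nrm G (B x y) \<le> max 0 C * nrm E x * nrm F y" if "x \<in> pts E" "y \<in> pts F" for x y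
  proof -
    have "C * (nrm E x * nrm F y) \<le> max 0 C * (nrm E x * nrm F y)"
      using that assms(2,3) by (intro mult_right_mono) (auto simp: seminormed.nrm_ge0)
    with C that show ?thesis by (force simp: mult.assoc)
  qed
  then show thesis by (intro that[of "max 0 C"]) auto
qed

lemma bounded_linear_nspace_bound:
  assumes "bounded_linear_nspace E F L" "seminormed E"
  obtains C where "0 \<le> C" "\<And>x. x \<in> pts E \<Longrightarrow> nrm F (L x) \<le> C * nrm E x"
proof -
  obtain C where C: "\<forall>x\<in>pts E. nrm F (L x) \<le> C * nrm E x"
    using assms by (auto simp: bounded_linear_nspace_def)
  have "nrm F (L x) \<le> max 0 C * nrm E x" if "x \<in> pts E" for x
  proof -
    have "C * nrm E x \<le> max 0 C * nrm E x"
      using that assms(2) by (intro mult_right_mono) (auto simp: seminormed.nrm_ge0)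
    with C that show ?thesis by force
  qed
  then show thesis by (intro that[of "max 0 C"]) auto
qed

lemma bounded_linear_nspace_mem: "bounded_linear_nspace E F L \<Longrightarrow> x \<in> pts E \<Longrightarrow> L x \<in> pts F"
  by (simp add: bounded_linear_nspace_def)

lemma bounded_linear_nspace_diff:
  assumes "bounded_linear_nspace E F L" "seminormed E" "x \<in> pts E" "y \<in> pts E"
  shows "L (x - y) = L x - L y"
proof -
  have "L (x + (-1) *\<^sub>R y) = L x + L ((-1) *\<^sub>R y)" "L ((-1) *\<^sub>R y) = (-1) *\<^sub>R L y"
    using assms seminormed.scale_mem[OF assms(2,4), of "-1"]
    unfolding bounded_linear_nspace_def by blast+
  then show ?thesis by simp
qed

lemma bounded_linear_nspace_zero:
  assumes "bounded_linear_nspace E F L" "seminormed E"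
  shows "L 0 = 0"
  using bounded_linear_nspace_diff[OF assms, of 0 0] seminormed.zero_mem[OF assms(2)] by simp

lemma bounded_linear_nspace_compose:
  assumes L: "bounded_linear_nspace E F L" and M: "bounded_linear_nspace F G M"
    and E: "seminormed E" and F: "seminormed F"
  shows "bounded_linear_nspace E G (\<lambda>x. M (L x))"
proof -
  obtain C where C: "0 \<le> C" "\<And>x. x \<in> pts E \<Longrightarrow> nrm F (L x) \<le> C * nrm E x"
    using bounded_linear_nspace_bound[OF L E] by blast
  obtain D where D: "0 \<le> D" "\<And>x. x \<in> pts F \<Longrightarrow> nrm G (M x) \<le> D * nrm F x"
    using bounded_linear_nspace_bound[OF M F] by blast
  have "nrm G (M (L x)) \<le> (D * C) * nrm E x" if "x \<in> pts E" for x
    using D(2)[of "L x"] mult_left_mono[OF C(2)[OF that] D(1)] L that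
    by (simp add: bounded_linear_nspace_def mult.assoc)
  then show ?thesis using L M unfolding bounded_linear_nspace_def by auto
qed

lemma bilinear_left: "bounded_bilinear_nspace E F G B \<Longrightarrow> seminormed E \<Longrightarrow> seminormed F \<Longrightarrow>
    y \<in> pts F \<Longrightarrow> bounded_linear_nspace E G (\<lambda>x. B x y)"
proof -
  assume B: "bounded_bilinear_nspace E F G B" "seminormed E" "seminormed F" and y: "y \<in> pts F"
  obtain C where C: "\<And>x y. x \<in> pts E \<Longrightarrow> y \<in> pts F \<Longrightarrow> nrm G (B x y) \<le> C * nrm E x * nrm F y"
    using bounded_bilinear_nspace_bound[OF B] by metis
  have "\<exists>C. \<forall>x\<in>pts E. nrm G (B x y) \<le> C * nrm E x"
    using C[OF _ y] by (intro exI[of _ "C * nrm F y"]) (auto simp: mult_ac)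
  with B(1) y show ?thesis
    unfolding bounded_bilinear_nspace_def bounded_linear_nspace_def by simp
qed

lemma bilinear_right: "bounded_bilinear_nspace E F G B \<Longrightarrow> seminormed E \<Longrightarrow> seminormed F \<Longrightarrow>
    x \<in> pts E \<Longrightarrow> bounded_linear_nspace F G (B x)"
proof -
  assume B: "bounded_bilinear_nspace E F G B" "seminormed E" "seminormed F" and x: "x \<in> pts E"
  obtain C where C: "\<And>x y. x \<in> pts E \<Longrightarrow> y \<in> pts F \<Longrightarrow> nrm G (B x y) \<le> C * nrm E x * nrm F y"
    using bounded_bilinear_nspace_bound[OF B] by metis
  have "\<exists>C. \<forall>y\<in>pts F. nrm G (B x y) \<le> C * nrm F y"
    using C[OF x] by (intro exI[of _ "C * nrm E x"]) (auto simp: mult_ac)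
  with B(1) x show ?thesis
    unfolding bounded_bilinear_nspace_def bounded_linear_nspace_def by simp
qed

lemma bounded_linear_nspace_add:
  assumes L: "bounded_linear_nspace E F L" and M: "bounded_linear_nspace E F M"
    and E: "seminormed E" and F: "seminormed F"
  shows "bounded_linear_nspace E F (\<lambda>x. L x + M x)"
proof -
  obtain C where C: "0 \<le> C" "\<And>x. x \<in> pts E \<Longrightarrow> nrm F (L x) \<le> C * nrm E x"
    using bounded_linear_nspace_bound[OF L E] by blast
  obtain D where D: "0 \<le> D" "\<And>x. x \<in> pts E \<Longrightarrow> nrm F (M x) \<le> D * nrm E x"
    using bounded_linear_nspace_bound[OF M E] by blast
  have "nrm F (L x + M x) \<le> (C + D) * nrm E x" if "x \<in> pts E" for x
    using seminormed.nrm_add[OF F, of "L x" "M x"] C(2)[OF that] D(2)[OF that] L M that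
    by (simp add: bounded_linear_nspace_def algebra_simps)
  then show ?thesis using L M seminormed.add_mem[OF F]
    unfolding bounded_linear_nspace_def by (auto simp: scaleR_add_right)
qed

lemma has_fderiv_cong:
  assumes "has_fderiv E F U f f' x" "x \<in> U" "\<And>y. y \<in> U \<Longrightarrow> f y = g y"
    "\<And>h. h \<in> pts E \<Longrightarrow> f' h = g' h" "seminormed E"
  shows "has_fderiv E F U g g' x"
  using assms seminormed.add_mem[OF assms(5)] seminormed.scale_mem[OF assms(5)]
  unfolding has_fderiv_def bounded_linear_nspace_def by simp

text \<open>Differentiability with tolerance 1 plus boundedness of the derivative: a Lipschitz bound
  at the single point \<open>x\<close>, which serves as continuity in the product rule.\<close>

lemma has_fderiv_bounded:
  assumes D: "has_fderiv E F U f f' x" and x: "x \<in> U" and f: "\<And>y. y \<in> U \<Longrightarrow> f y \<in> pts F"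
    and E: "seminormed E" and F: "seminormed F"
  obtains \<delta> C where "0 < \<delta>" "0 \<le> C" "\<And>h. h \<in> pts E \<Longrightarrow> nrm E h < \<delta> \<Longrightarrow> x + h \<in> U \<Longrightarrow>
    nrm F (f (x + h) - f x) \<le> C * nrm E h"
proof -
  have L: "bounded_linear_nspace E F f'" using D by (simp add: has_fderiv_def)
  obtain C where C: "0 \<le> C" "\<And>x. x \<in> pts E \<Longrightarrow> nrm F (f' x) \<le> C * nrm E x"
    using bounded_linear_nspace_bound[OF L E] by blast
  obtain \<delta> where d: "\<delta> > 0" "\<And>h. h \<in> pts E \<Longrightarrow> nrm E h < \<delta> \<Longrightarrow> x + h \<in> U \<Longrightarrow>
        nrm F (f (x + h) - f x - f' h) \<le> 1 * nrm E h"
    using D unfolding has_fderiv_def by (meson zero_less_one)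
  show thesis
  proof (rule that[OF d(1), of "1 + C"])
    fix h assume h: "h \<in> pts E" "nrm E h < \<delta>" "x + h \<in> U"
    have "nrm F ((f (x + h) - f x - f' h) + f' h) \<le> nrm F (f (x + h) - f x - f' h) + nrm F (f' h)"
      using h x f L by (intro seminormed.nrm_add[OF F] seminormed.diff_mem[OF F])
        (auto simp: bounded_linear_nspace_def)
    with d(2)[OF h] C(2)[OF h(1)]
    show "nrm F (f (x + h) - f x) \<le> (1 + C) * nrm E h" by (simp add: algebra_simps)
  qed (use C in auto)
qed

lemma has_fderiv_linear:
  assumes D: "has_fderiv E F U f f' x" and x: "x \<in> U" and f: "\<And>y. y \<in> U \<Longrightarrow> f y \<in> pts F"
    and L: "bounded_linear_nspace F G L" and E: "seminormed E" and F: "seminormed F"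
  shows "has_fderiv E G U (\<lambda>y. L (f y)) (\<lambda>h. L (f' h)) x"
proof -
  have f': "bounded_linear_nspace E F f'" using D by (simp add: has_fderiv_def)
  obtain C where C: "0 \<le> C" "\<And>x. x \<in> pts F \<Longrightarrow> nrm G (L x) \<le> C * nrm F x"
    using bounded_linear_nspace_bound[OF L F] by blast
  have "\<exists>\<delta>>0. \<forall>h\<in>pts E. nrm E h < \<delta> \<longrightarrow> x + h \<in> U \<longrightarrow>
        nrm G (L (f (x + h)) - L (f x) - L (f' h)) \<le> \<epsilon> * nrm E h" if "\<epsilon> > 0" for \<epsilon>
  proof -
    have "\<epsilon> / (C + 1) > 0" using that C by simp
    then obtain \<delta> where d: "\<delta> > 0" "\<And>h. h \<in> pts E \<Longrightarrow> nrm E h < \<delta> \<Longrightarrow> x + h \<in> U \<Longrightarrow>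
        nrm F (f (x + h) - f x - f' h) \<le> \<epsilon> / (C + 1) * nrm E h"
      using D unfolding has_fderiv_def by meson
    have "nrm G (L (f (x + h)) - L (f x) - L (f' h)) \<le> \<epsilon> * nrm E h"
      if h: "h \<in> pts E" "nrm E h < \<delta>" "x + h \<in> U" for h
    proof -
      have m: "f (x + h) \<in> pts F" "f x \<in> pts F" "f' h \<in> pts F" "f (x + h) - f x \<in> pts F"
        using h x f f' by (auto simp: bounded_linear_nspace_def intro: seminormed.diff_mem[OF F])
      have "L (f (x + h)) - L (f x) - L (f' h) = L (f (x + h) - f x - f' h)"
        using m by (simp add: bounded_linear_nspace_diff[OF L F])
      also have "nrm G \<dots> \<le> C * nrm F (f (x + h) - f x - f' h)"
        using m by (intro C seminormed.diff_mem[OF F])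
      also have "\<dots> \<le> C * (\<epsilon> / (C + 1) * nrm E h)" by (intro mult_left_mono d h C)
      also have "\<dots> \<le> \<epsilon> * nrm E h"
      proof -
        have "C * (\<epsilon> / (C + 1)) \<le> \<epsilon>" using C \<open>\<epsilon> > 0\<close> by (simp add: field_simps)
        then have "C * (\<epsilon> / (C + 1)) * nrm E h \<le> \<epsilon> * nrm E h"
          by (intro mult_right_mono seminormed.nrm_ge0[OF E] h)
        then show ?thesis by (simp add: mult.assoc)
      qed
      finally show ?thesis .
    qed
    with d(1) show ?thesis by blast
  qed
  with bounded_linear_nspace_compose[OF f' L E F] show ?thesis by (simp add: has_fderiv_def)
qed

lemma has_fderiv_add:
  assumes D: "has_fderiv E F U f f' x" "has_fderiv E F U g g' x" and x: "x \<in> U"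
    and f: "\<And>y. y \<in> U \<Longrightarrow> f y \<in> pts F" and g: "\<And>y. y \<in> U \<Longrightarrow> g y \<in> pts F"
    and E: "seminormed E" and F: "seminormed F"
  shows "has_fderiv E F U (\<lambda>y. f y + g y) (\<lambda>h. f' h + g' h) x"
proof -
  have f': "bounded_linear_nspace E F f'" "bounded_linear_nspace E F g'"
    using D by (auto simp: has_fderiv_def)
  have "\<exists>\<delta>>0. \<forall>h\<in>pts E. nrm E h < \<delta> \<longrightarrow> x + h \<in> U \<longrightarrow>
        nrm F (f (x + h) + g (x + h) - (f x + g x) - (f' h + g' h)) \<le> \<epsilon> * nrm E h" if "\<epsilon> > 0" for \<epsilon>
  proof -
    have "\<epsilon> / 2 > 0" using that by simp
    from \<open>\<epsilon> / 2 > 0\<close> obtain \<delta>1 where d1: "\<delta>1 > 0" "\<And>h. h \<in> pts E \<Longrightarrow> nrm E h < \<delta>1 \<Longrightarrow> x + h \<in> U \<Longrightarrow>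
        nrm F (f (x + h) - f x - f' h) \<le> \<epsilon> / 2 * nrm E h"
      using D(1) unfolding has_fderiv_def by meson
    from \<open>\<epsilon> / 2 > 0\<close> obtain \<delta>2 where d2: "\<delta>2 > 0" "\<And>h. h \<in> pts E \<Longrightarrow> nrm E h < \<delta>2 \<Longrightarrow> x + h \<in> U \<Longrightarrow>
        nrm F (g (x + h) - g x - g' h) \<le> \<epsilon> / 2 * nrm E h"
      using D(2) unfolding has_fderiv_def by meson
    note d = d1 d2
    have "nrm F (f (x + h) + g (x + h) - (f x + g x) - (f' h + g' h)) \<le> \<epsilon> * nrm E h"
      if h: "h \<in> pts E" "nrm E h < min \<delta>1 \<delta>2" "x + h \<in> U" for h
    proof -
      have "nrm F ((f (x + h) - f x - f' h) + (g (x + h) - g x - g' h))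
          \<le> nrm F (f (x + h) - f x - f' h) + nrm F (g (x + h) - g x - g' h)"
        using h x f g f' by (intro seminormed.nrm_add[OF F] seminormed.diff_mem[OF F])
          (auto simp: bounded_linear_nspace_def)
      with d(2)[of h] d(4)[of h] h show ?thesis by (simp add: algebra_simps)
    qed
    with d(1,3) show ?thesis by (intro exI[of _ "min \<delta>1 \<delta>2"]) auto
  qed
  with bounded_linear_nspace_add[OF f' E F] show ?thesis by (simp add: has_fderiv_def)
qed

lemma has_fderiv_const:
  assumes "seminormed E" "seminormed F"
  shows "has_fderiv E F U (\<lambda>y. c) (\<lambda>h. 0) x"
proof -
  have "bounded_linear_nspace E F (\<lambda>h. 0)"
    unfolding bounded_linear_nspace_def using assms
    by (simp add: seminormed.nrm_zero seminormed.zero_mem) (rule exI[of _ 0], simp)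
  then show ?thesis
    unfolding has_fderiv_def using seminormed.nrm_ge0[OF assms(1)] seminormed.nrm_zero[OF assms(2)]
    by (auto intro: exI[of _ 1])
qed

lemma has_fderiv_sum:
  assumes "finite I" "\<And>i. i \<in> I \<Longrightarrow> has_fderiv E F U (f i) (f' i) x" and x: "x \<in> U"
    and f: "\<And>i y. i \<in> I \<Longrightarrow> y \<in> U \<Longrightarrow> f i y \<in> pts F"
    and E: "seminormed E" and F: "seminormed F"
  shows "has_fderiv E F U (\<lambda>y. \<Sum>i\<in>I. f i y) (\<lambda>h. \<Sum>i\<in>I. f' i h) x"
  using assms(1,2) f
proof (induction I rule: finite_induct)
  case empty
  then show ?case using has_fderiv_const[OF E F] by simp
next
  case (insert i I)
  have "has_fderiv E F U (\<lambda>y. f i y + (\<Sum>i\<in>I. f i y)) (\<lambda>h. f' i h + (\<Sum>i\<in>I. f' i h)) x"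
    using insert by (intro has_fderiv_add x E F seminormed.sum_mem[OF F]) auto
  with insert show ?case by simp
qed

lemma bilinear_diff:
  assumes "bounded_bilinear_nspace E F G B" "seminormed E" "seminormed F"
  shows "x \<in> pts E \<Longrightarrow> x' \<in> pts E \<Longrightarrow> y \<in> pts F \<Longrightarrow> B (x - x') y = B x y - B x' y"
    "x \<in> pts E \<Longrightarrow> y \<in> pts F \<Longrightarrow> y' \<in> pts F \<Longrightarrow> B x (y - y') = B x y - B x y'"
  using bounded_linear_nspace_diff[OF bilinear_left[OF assms]]
    bounded_linear_nspace_diff[OF bilinear_right[OF assms]] assms by auto

text \<open>With R and S the first-order remainders of f and g, the error of the product rule is B R
  g(x+h) + B (f' h) (g(x+h) - g x) + B (f x) S. The outer terms are small because R and S are, the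
  middle one because it is quadratic in h.\<close>

lemma has_fderiv_bilinear:
  assumes Df: "has_fderiv E F U f f' x" and Dg: "has_fderiv E G U g g' x" and x: "x \<in> U"
    and f: "\<And>y. y \<in> U \<Longrightarrow> f y \<in> pts F" and g: "\<And>y. y \<in> U \<Longrightarrow> g y \<in> pts G"
    and B: "bounded_bilinear_nspace F G H B"
    and E: "seminormed E" and F: "seminormed F" and G: "seminormed G" and H: "seminormed H"
  shows "has_fderiv E H U (\<lambda>y. B (f y) (g y)) (\<lambda>h. B (f' h) (g x) + B (f x) (g' h)) x"
proof -
  have f': "bounded_linear_nspace E F f'" and g': "bounded_linear_nspace E G g'"
    using Df Dg by (auto simp: has_fderiv_def)
  have lin: "bounded_linear_nspace E H (\<lambda>h. B (f' h) (g x) + B (f x) (g' h))"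
    using bounded_linear_nspace_compose[OF f' bilinear_left[OF B F G g[OF x]] E F]
      bounded_linear_nspace_compose[OF g' bilinear_right[OF B F G f[OF x]] E G]
    by (intro bounded_linear_nspace_add E H)
  obtain K where K: "0 \<le> K" "\<And>x y. x \<in> pts F \<Longrightarrow> y \<in> pts G \<Longrightarrow> nrm H (B x y) \<le> K * nrm F x * nrm G y"
    using bounded_bilinear_nspace_bound[OF B F G] by blast
  obtain a where a: "0 \<le> a" "\<And>x. x \<in> pts E \<Longrightarrow> nrm F (f' x) \<le> a * nrm E x"
    using bounded_linear_nspace_bound[OF f' E] by blast
  obtain \<delta>0 b where b: "0 < \<delta>0" "0 \<le> b" "\<And>h. h \<in> pts E \<Longrightarrow> nrm E h < \<delta>0 \<Longrightarrow> x + h \<in> U \<Longrightarrow>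
    nrm G (g (x + h) - g x) \<le> b * nrm E h"
    using has_fderiv_bounded[OF Dg x g E G] by blast
  have Bm: "B u v \<in> pts H" if "u \<in> pts F" "v \<in> pts G" for u v
    using B that by (auto simp: bounded_bilinear_nspace_def)
  have "\<exists>\<delta>>0. \<forall>h\<in>pts E. nrm E h < \<delta> \<longrightarrow> x + h \<in> U \<longrightarrow>
        nrm H (B (f (x + h)) (g (x + h)) - B (f x) (g x) - (B (f' h) (g x) + B (f x) (g' h)))
        \<le> \<epsilon> * nrm E h" if e: "\<epsilon> > 0" for \<epsilon>
  proof -
    \<comment> \<open>\<open>M\<close> collects the coefficients of the two remainder terms, which
      get half of \<open>\<epsilon>\<close>; adding 1 in \<open>e1\<close> keeps the denominator
      positive.\<close>
    define M where "M = K * (nrm G (g x) + b) + K * nrm F (f x)"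
    have M0: "0 \<le> M" unfolding M_def using K(1) b(2) seminormed.nrm_ge0[OF F f[OF x]]
        seminormed.nrm_ge0[OF G g[OF x]] by simp
    define e1 where "e1 = \<epsilon> / (2 * (M + 1))"
    have e1: "e1 > 0" using M0 e by (simp add: e1_def)
    obtain \<delta>1 where d1: "\<delta>1 > 0" "\<And>h. h \<in> pts E \<Longrightarrow> nrm E h < \<delta>1 \<Longrightarrow> x + h \<in> U \<Longrightarrow>
        nrm F (f (x + h) - f x - f' h) \<le> e1 * nrm E h"
      using Df e1 unfolding has_fderiv_def by meson
    obtain \<delta>2 where d2: "\<delta>2 > 0" "\<And>h. h \<in> pts E \<Longrightarrow> nrm E h < \<delta>2 \<Longrightarrow> x + h \<in> U \<Longrightarrow>
        nrm G (g (x + h) - g x - g' h) \<le> e1 * nrm E h"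
      using Dg e1 unfolding has_fderiv_def by meson
    \<comment> \<open>The other half of \<open>\<epsilon>\<close> is for the quadratic term
      \<open>(K * a * b) * t\<close>, made small by shrinking the radius.\<close>
    define \<delta>3 where "\<delta>3 = \<epsilon> / (2 * (K * a * b + 1))"
    have p: "0 \<le> K * a * b" using K(1) a(1) b(2) by simp
    have d3: "\<delta>3 > 0" using p e by (simp add: \<delta>3_def)
    define \<delta> where "\<delta> = min (min \<delta>0 1) (min (min \<delta>1 \<delta>2) \<delta>3)"
    have "nrm H (B (f (x + h)) (g (x + h)) - B (f x) (g x) - (B (f' h) (g x) + B (f x) (g' h)))
        \<le> \<epsilon> * nrm E h" if h: "h \<in> pts E" "nrm E h < \<delta>" "x + h \<in> U" for h
    proof -
      have hd: "nrm E h < \<delta>0" "nrm E h < 1" "nrm E h < \<delta>1" "nrm E h < \<delta>2" "nrm E h < \<delta>3"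
        using h(2) by (auto simp: \<delta>_def)
      define t where "t = nrm E h"
      have t0: "0 \<le> t" unfolding t_def using seminormed.nrm_ge0[OF E h(1)] .
      have m: "f (x + h) \<in> pts F" "f x \<in> pts F" "f' h \<in> pts F" "g (x + h) \<in> pts G" "g x \<in> pts G"
        "g' h \<in> pts G" using f g f' g' x h by (auto simp: bounded_linear_nspace_def)
      note fd = seminormed.diff_mem[OF F] and gd = seminormed.diff_mem[OF G]
      let ?R = "f (x + h) - f x - f' h" and ?S = "g (x + h) - g x - g' h"
      have R: "?R \<in> pts F" "?S \<in> pts G" "g (x + h) - g x \<in> pts G"
        using m by (auto intro!: fd gd)
      have eq: "B (f (x + h)) (g (x + h)) - B (f x) (g x) - (B (f' h) (g x) + B (f x) (g' h))
         = (B ?R (g (x + h)) + B (f' h) (g (x + h) - g x)) + B (f x) ?S"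
      proof -
        have "B ?R (g (x + h)) = B (f (x + h)) (g (x + h)) - B (f x) (g (x + h)) - B (f' h) (g (x + h))"
          using m by (simp only: bilinear_diff[OF B F G] fd)
        moreover have "B (f' h) (g (x + h) - g x) = B (f' h) (g (x + h)) - B (f' h) (g x)"
          using m by (simp only: bilinear_diff[OF B F G])
        moreover have "B (f x) ?S = B (f x) (g (x + h)) - B (f x) (g x) - B (f x) (g' h)"
          using m by (simp only: bilinear_diff[OF B F G] gd)
        ultimately show ?thesis by (simp only: ) (simp add: algebra_simps)
      qed
      have gx: "nrm G (g (x + h)) \<le> nrm G (g x) + b"
      proof -
        have "nrm G (g x + (g (x + h) - g x)) \<le> nrm G (g x) + nrm G (g (x + h) - g x)"
          by (intro seminormed.nrm_add[OF G] m R)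
        also have "nrm G (g (x + h) - g x) \<le> b * nrm E h" using b(3) h hd by simp
        also have "\<dots> \<le> b * 1" using hd b(2) by (intro mult_left_mono) auto
        finally show ?thesis by simp
      qed
      have 1: "nrm H (B ?R (g (x + h))) \<le> K * (e1 * t) * (nrm G (g x) + b)"
        using K(2)[OF R(1) m(4)]
        by (rule order_trans) (intro mult_mono K(1) mult_nonneg_nonneg gx order.refl d1(2) h hd
            less_imp_le[OF e1] seminormed.nrm_ge0[OF F] seminormed.nrm_ge0[OF G] t0 m R | simp
                add: t_def)+
      have 2: "nrm H (B (f' h) (g (x + h) - g x)) \<le> K * (a * t) * (b * t)"
        using K(2)[OF m(3) R(3)]
        by (rule order_trans) (intro mult_mono K(1) mult_nonneg_nonneg gx order.refl a b h hd
            seminormed.nrm_ge0[OF F] seminormed.nrm_ge0[OF G] t0 m R | simp add: t_def)+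
      have 3: "nrm H (B (f x) ?S) \<le> K * nrm F (f x) * (e1 * t)"
        using K(2)[OF m(2) R(2)]
        by (rule order_trans) (intro mult_mono K(1) mult_nonneg_nonneg order.refl d2(2) h hd
            less_imp_le[OF e1] seminormed.nrm_ge0[OF F] seminormed.nrm_ge0[OF G] t0 m R | simp
                add: t_def)+
      have "nrm H ((B ?R (g (x + h)) + B (f' h) (g (x + h) - g x)) + B (f x) ?S)
         \<le> nrm H (B ?R (g (x + h)) + B (f' h) (g (x + h) - g x)) + nrm H (B (f x) ?S)"
        using m R by (intro seminormed.nrm_add[OF H] seminormed.add_mem[OF H] Bm)
      also have "nrm H (B ?R (g (x + h)) + B (f' h) (g (x + h) - g x)) \<le>
         nrm H (B ?R (g (x + h))) + nrm H (B (f' h) (g (x + h) - g x))"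
        using m R by (intro seminormed.nrm_add[OF H] Bm)
      finally have "nrm H (B (f (x + h)) (g (x + h)) - B (f x) (g x) - (B (f' h) (g x)
          + B (f x) (g' h)))
         \<le> K * (e1 * t) * (nrm G (g x) + b) + K * (a * t) * (b * t) + K * nrm F (f x) * (e1 * t)"
        using 1 2 3 unfolding eq by linarith
      also have "\<dots> = (M * e1 + (K * a * b) * t) * t" by (simp add: M_def algebra_simps)
      also have "\<dots> \<le> (\<epsilon> / 2 + \<epsilon> / 2) * t"
      proof (intro mult_right_mono add_mono t0)
        show "M * e1 \<le> \<epsilon> / 2" using M0 e by (simp add: e1_def field_simps)
        have "(K * a * b) * t \<le> (K * a * b) * \<delta>3"
          using p hd by (intro mult_left_mono) (auto simp: t_def)
        also have "\<dots> \<le> \<epsilon> / 2" using p e by (simp add: \<delta>3_def field_simps)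
        finally show "(K * a * b) * t \<le> \<epsilon> / 2" .
      qed
      finally show ?thesis by (simp add: t_def)
    qed
    moreover have "\<delta> > 0" using b(1) d1(1) d2(1) d3 by (simp add: \<delta>_def)
    ultimately show ?thesis by blast
  qed
  with lin show ?thesis by (simp add: has_fderiv_def)
qed

section \<open>Smooth maps\<close>

text \<open>The part of \<open>smooth_nspace\<close> that does not mention the function itself.
  Towers are transported level by level, and the function enters only through level 0.\<close>

definition derivative_tower ::
    "'a::real_vector nspace \<Rightarrow> 'b::real_vector nspace \<Rightarrow> 'a set \<Rightarrow> (nat \<Rightarrow> 'a \<Rightarrow> 'a list \<Rightarrow> 'b) \<Rightarrow> bool" where
  "derivative_tower E F U D \<longleftrightarrow> (\<forall>k. \<forall>x\<in>U. D k x \<in> pts (multilinear_nspace E F k)) \<and>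
     (\<forall>k. \<forall>x\<in>U. has_fderiv E (multilinear_nspace E F k) U (D k)
        (\<lambda>h vs. D (Suc k) x (h # vs)) x)"

lemma smooth_nspace_iff:
  "smooth_nspace E F U f \<longleftrightarrow>
    (\<exists>D. (\<forall>x\<in>U. D 0 x = (\<lambda>vs. if vs = [] then f x else 0)) \<and> derivative_tower E F U D)"
  by (auto simp: smooth_nspace_def derivative_tower_def)

lemma smooth_nspace_cong:
  assumes "smooth_nspace E F U f" "\<And>x. x \<in> U \<Longrightarrow> f x = g x"
  shows "smooth_nspace E F U g"
proof -
  obtain D where D: "\<forall>x\<in>U. D 0 x = (\<lambda>vs. if vs = [] then f x else 0)" "derivative_tower E F U D"
    using assms by (auto simp: smooth_nspace_iff)
  then show ?thesis unfolding smooth_nspace_iff using assms(2)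
      by (intro exI[of _ D]) (auto simp: fun_eq_iff)
qed

lemma arg_lists_Suc: "h # vs \<in> arg_lists E (Suc k) \<longleftrightarrow> h \<in> pts E \<and> vs \<in> arg_lists E k"
  by (auto simp: arg_lists_def)

lemma bounded_linear_multilinear_compose:
  assumes L: "bounded_linear_nspace F G L" and E: "seminormed E" and F: "seminormed F"
      and G: "seminormed G"
  shows "bounded_linear_nspace (multilinear_nspace E F k) (multilinear_nspace E G k) (\<lambda>M vs. L (M vs))"
proof -
  obtain C where C: "0 \<le> C" "\<And>x. x \<in> pts F \<Longrightarrow> nrm G (L x) \<le> C * nrm F x"
    using bounded_linear_nspace_bound[OF L F] by blast
  have L0: "L 0 = 0" by (rule bounded_linear_nspace_zero[OF L F])
  have bd: "nrm G (L (M vs)) \<le> (C * nrm (multilinear_nspace E F k) M) * (\<Prod>v\<leftarrow>vs. nrm E v)"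
    if "M \<in> pts (multilinear_nspace E F k)" "vs \<in> arg_lists E k" for M vs
    using C(2)[of "M vs"] that mult_left_mono[OF multilinear_nrm(2)[OF E that] C(1)]
    by (auto simp: multilinear_pts_iff mult.assoc)
  have mem: "(\<lambda>vs. L (M vs)) \<in> pts (multilinear_nspace E G k)"
    if M: "M \<in> pts (multilinear_nspace E F k)" for M
  proof -
    have "\<exists>C. \<forall>vs\<in>arg_lists E k. nrm G (L (M vs)) \<le> C * (\<Prod>v\<leftarrow>vs. nrm E v)"
      using bd[OF M] by blast
    then show ?thesis using M L L0 arg_lists_update[of _ E k]
      unfolding multilinear_pts_iff by (simp add: bounded_linear_nspace_def)
  qed
  have "L ((M + N) vs) = L (M vs) + L (N vs)"
    if "M \<in> pts (multilinear_nspace E F k)" "N \<in> pts (multilinear_nspace E F k)" for M N vs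
    using that L L0 by (cases "vs \<in> arg_lists E k") (auto simp: multilinear_pts_iff
        bounded_linear_nspace_def)
  moreover have "L ((c *\<^sub>R M) vs) = c *\<^sub>R L (M vs)"
    if "M \<in> pts (multilinear_nspace E F k)" for M c vs
    using that L L0 by (cases "vs \<in> arg_lists E k")
      (auto simp: multilinear_pts_iff bounded_linear_nspace_def scaleR_fun_def)
  moreover have "nrm (multilinear_nspace E G k) (\<lambda>vs. L (M vs)) \<le> C * nrm (multilinear_nspace E F k) M"
    if "M \<in> pts (multilinear_nspace E F k)" for M
    using bd[OF that] C(1) multilinear_nrm(1)[OF E that]
    by (intro multilinear_nrm(3)[OF E mem[OF that]]) auto
  moreover from this have "\<exists>C. \<forall>M\<in>pts (multilinear_nspace E F k).
      nrm (multilinear_nspace E G k) (\<lambda>vs. L (M vs)) \<le> C * nrm (multilinear_nspace E F k) M" by blast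
  ultimately show ?thesis
    unfolding bounded_linear_nspace_def using mem by (simp add: fun_eq_iff scaleR_fun_def)
qed

text \<open>Post-composition with \<open>L\<close> is itself bounded and linear on k-linear maps, so
  the first-order rule for linear maps applies at every level of the tower.\<close>

lemma smooth_nspace_linear:
  assumes f: "smooth_nspace E F U f" and L: "bounded_linear_nspace F G L"
    and E: "seminormed E" and F: "seminormed F" and G: "seminormed G"
  shows "smooth_nspace E G U (\<lambda>x. L (f x))"
proof -
  obtain D where D: "\<forall>x\<in>U. D 0 x = (\<lambda>vs. if vs = [] then f x else 0)" "derivative_tower E F U D"
    using f by (auto simp: smooth_nspace_iff)
  note lin = bounded_linear_multilinear_compose[OF L E F G]
  show ?thesis unfolding smooth_nspace_iff
  proof (intro exI conjI ballI)
    show "(\<lambda>vs. L (D 0 x vs)) = (\<lambda>vs. if vs = [] then L (f x) else 0)" if "x \<in> U" for x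
      using D(1) that bounded_linear_nspace_zero[OF L F] by auto
    show "derivative_tower E G U (\<lambda>k x vs. L (D k x vs))"
      unfolding derivative_tower_def
    proof (intro conjI allI ballI)
      fix k x assume x: "x \<in> U"
      have mem: "D k y \<in> pts (multilinear_nspace E F k)" if "y \<in> U" for y
        using D(2) that by (simp add: derivative_tower_def)
      show "(\<lambda>vs. L (D k x vs)) \<in> pts (multilinear_nspace E G k)"
        by (rule bounded_linear_nspace_mem[OF lin mem[OF x]])
      have "has_fderiv E (multilinear_nspace E F k) U (D k) (\<lambda>h vs. D (Suc k) x (h # vs)) x"
        using D(2) x by (simp add: derivative_tower_def)
      then show "has_fderiv E (multilinear_nspace E G k) U (\<lambda>x vs. L (D k x vs))
            (\<lambda>h vs. L (D (Suc k) x (h # vs))) x"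
        by (rule has_fderiv_linear[OF _ x mem lin E seminormed_multilinear[OF E F]])
    qed
  qed
qed

lemma smooth_nspace_add:
  assumes f: "smooth_nspace E F U f" and g: "smooth_nspace E F U g"
    and E: "seminormed E" and F: "seminormed F"
  shows "smooth_nspace E F U (\<lambda>x. f x + g x)"
proof -
  obtain D where D: "\<forall>x\<in>U. D 0 x = (\<lambda>vs. if vs = [] then f x else 0)" "derivative_tower E F U D"
    using f by (auto simp: smooth_nspace_iff)
  obtain D' where D': "\<forall>x\<in>U. D' 0 x = (\<lambda>vs. if vs = [] then g x else 0)" "derivative_tower E F U D'"
    using g by (auto simp: smooth_nspace_iff)
  show ?thesis unfolding smooth_nspace_iff
  proof (intro exI conjI ballI)
    show "D 0 x + D' 0 x = (\<lambda>vs. if vs = [] then f x + g x else 0)" if "x \<in> U" for x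
      using D(1) D'(1) that by auto
    have "has_fderiv E (multilinear_nspace E F k) U (\<lambda>x. D k x + D' k x)
        (\<lambda>h vs. (D (Suc k) x + D' (Suc k) x) (h # vs)) x" if x: "x \<in> U" for k x
    proof (rule has_fderiv_cong[OF has_fderiv_add[OF _ _ x _ _ E seminormed_multilinear[OF E F, of k]]])
      show "has_fderiv E (multilinear_nspace E F k) U (D k) (\<lambda>h vs. D (Suc k) x (h # vs)) x"
        "has_fderiv E (multilinear_nspace E F k) U (D' k) (\<lambda>h vs. D' (Suc k) x (h # vs)) x"
        using D(2) D'(2) x by (simp_all add: derivative_tower_def)
    qed (use D(2) D'(2) x E in \<open>simp_all add: derivative_tower_def fun_eq_iff\<close>)
    then show "derivative_tower E F U (\<lambda>k x. D k x + D' k x)"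
      using D(2) D'(2) seminormed.add_mem[OF seminormed_multilinear[OF E F]]
      unfolding derivative_tower_def by simp
  qed
qed

section \<open>Leibniz formula for higher derivatives of a product\<close>

fun pick :: "bool list \<Rightarrow> 'a list \<Rightarrow> 'a list" where
  "pick (b # bs) (v # vs) = (if b then v # pick bs vs else pick bs vs)"
| "pick _ _ = []"

lemma set_pick: "set (pick bs vs) \<subseteq> set vs"
  by (induction bs vs rule: pick.induct) auto

lemma length_pick: "length bs = length vs \<Longrightarrow> length (pick bs vs) = count_list bs True"
  by (induction bs vs rule: list_induct2) auto

text \<open>The position \<open>j\<close> does not depend on the new entry, which is what carries
  additivity and homogeneity in one slot over to the selected sublist.\<close>

lemma pick_update_in:
  "length bs = length vs \<Longrightarrow> i < length vs \<Longrightarrow> bs ! i \<Longrightarrow>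
    \<exists>j<length (pick bs vs). \<forall>x. pick bs (vs[i := x]) = (pick bs vs)[j := x]"
proof (induction bs vs arbitrary: i rule: list_induct2)
  case (Cons b bs v vs)
  show ?case
  proof (cases i)
    case 0
    with Cons.prems show ?thesis by (auto intro!: exI[of _ 0])
  next
    case (Suc n)
    with Cons obtain j where j: "j < length (pick bs vs)" "\<forall>x. pick bs (vs[n := x])
        = (pick bs vs)[j := x]"
      by fastforce
    then show ?thesis using Suc
      by (intro exI[of _ "if b then Suc j else j"]) auto
  qed
qed simp

lemma pick_update_out:
  "length bs = length vs \<Longrightarrow> i < length vs \<Longrightarrow> \<not> bs ! i \<Longrightarrow> pick bs (vs[i := x]) = pick bs vs"
proof (induction bs vs arbitrary: i rule: list_induct2)
  case (Cons b bs v vs)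
  then show ?case by (cases i) auto
qed simp

lemma prod_list_pick:
  fixes f :: "'a \<Rightarrow> real"
  shows "length bs = length vs \<Longrightarrow>
    (\<Prod>v\<leftarrow>vs. f v) = (\<Prod>v\<leftarrow>pick bs vs. f v) * (\<Prod>v\<leftarrow>pick (map Not bs) vs. f v)"
  by (induction bs vs rule: list_induct2) auto

lemma pick_arg_lists:
  assumes "length bs = k" "vs \<in> arg_lists E k"
  shows "pick bs vs \<in> arg_lists E (count_list bs True)"
  using assms set_pick[of bs vs] by (auto simp: arg_lists_def length_pick)

text \<open>One summand of the Leibniz formula: the directions marked in \<open>bs\<close>
  differentiate the first factor, the others the second, both in their original order. The guard
  supplies the value 0 that the carrier of multilinear maps demands off the argument lists.\<close>

definition shuffle_product ::
    "'a nspace \<Rightarrow> ('b \<Rightarrow> 'c \<Rightarrow> 'd::zero) \<Rightarrow> bool list \<Rightarrow> ('a list \<Rightarrow> 'b) \<Rightarrow> ('a list \<Rightarrow> 'c) \<Rightarrow> 'a list \<Rightarrow>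
        'd" where
  "shuffle_product E B bs M N = (\<lambda>vs. if vs \<in> arg_lists E (length bs)
     then B (M (pick bs vs)) (N (pick (map Not bs) vs)) else 0)"

text \<open>Bilinearity in the pair of multilinear maps is what allows the first-order product rule
  to differentiate each summand of the Leibniz formula.\<close>

lemma bounded_bilinear_shuffle_product:
  assumes B: "bounded_bilinear_nspace F G H B"
    and E: "seminormed E" and F: "seminormed F" and G: "seminormed G" and H: "seminormed H"
  shows "bounded_bilinear_nspace (multilinear_nspace E F (count_list bs True))
    (multilinear_nspace E G (count_list (map Not bs) True))
    (multilinear_nspace E H (length bs)) (shuffle_product E B bs)"
proof -
  define k where "k = length bs"
  define i where "i = count_list bs True"
  define j where "j = count_list (map Not bs) True"
  let ?P = "shuffle_product E B bs"
  let ?LF = "multilinear_nspace E F i" and ?LG = "multilinear_nspace E G j" and ?LH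
      = "multilinear_nspace E H k"
  note Bs = B[unfolded bounded_bilinear_nspace_def]
  obtain K where K: "0 \<le> K" "\<And>x y. x \<in> pts F \<Longrightarrow> y \<in> pts G \<Longrightarrow> nrm H (B x y) \<le> K * nrm F x * nrm G y"
    using bounded_bilinear_nspace_bound[OF B F G] by blast
  have args: "pick bs vs \<in> arg_lists E i" "pick (map Not bs) vs \<in> arg_lists E j"
    if "vs \<in> arg_lists E k" for vs
    using that by (auto simp: i_def j_def k_def intro!: pick_arg_lists)
  have Mm: "M ws \<in> pts F" if "M \<in> pts ?LF" "ws \<in> arg_lists E i" for M ws
    using that by (auto simp: multilinear_pts_iff)
  have Nm: "N ws \<in> pts G" if "N \<in> pts ?LG" "ws \<in> arg_lists E j" for N ws
    using that by (auto simp: multilinear_pts_iff)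
  have bd: "nrm H (?P M N vs) \<le> (K * nrm ?LF M * nrm ?LG N) * (\<Prod>v\<leftarrow>vs. nrm E v)"
    if M: "M \<in> pts ?LF" and N: "N \<in> pts ?LG" and vs: "vs \<in> arg_lists E k" for M N vs
  proof -
    let ?p = "pick bs vs" and ?q = "pick (map Not bs) vs"
    have "nrm H (?P M N vs) \<le> K * nrm F (M ?p) * nrm G (N ?q)"
      using vs K(2)[OF Mm[OF M args(1)[OF vs]] Nm[OF N args(2)[OF vs]]]
      by (simp add: shuffle_product_def k_def)
    also have "\<dots> \<le> K * (nrm ?LF M * (\<Prod>v\<leftarrow>?p. nrm E v)) * (nrm ?LG N * (\<Prod>v\<leftarrow>?q. nrm E v))"
      using K(1) M N args[OF vs]
      by (intro mult_mono multilinear_nrm(2)[OF E] mult_nonneg_nonneg multilinear_nrm(1)[OF E]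
          seminormed.nrm_ge0[OF F] seminormed.nrm_ge0[OF G] seminormed.prod_nrm_ge0[OF E] Mm Nm
              order.refl)
    also have "\<dots> = (K * nrm ?LF M * nrm ?LG N) * (\<Prod>v\<leftarrow>vs. nrm E v)"
      using prod_list_pick[of bs vs "nrm E"] vs by (simp add: arg_lists_def k_def mult_ac)
    finally show ?thesis .
  qed
  \<comment> \<open>Position \<open>n\<close> belongs to exactly one of the two selections, so
    changing that entry changes one factor in one slot and leaves the other factor alone.\<close>
  have upd: "(bs ! n \<and> (\<exists>m<i. (\<forall>x. pick bs (vs[n := x]) = (pick bs vs)[m := x])) \<and>
       (\<forall>x. pick (map Not bs) (vs[n := x]) = pick (map Not bs) vs)) \<or>
      (\<exists>m<j. (\<forall>x. pick (map Not bs) (vs[n := x]) = (pick (map Not bs) vs)[m := x])) \<and>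
       (\<forall>x. pick bs (vs[n := x]) = pick bs vs)"
    if "vs \<in> arg_lists E k" "n < k" for vs n
    using pick_update_in[of bs vs n] pick_update_out[of bs vs n]
      pick_update_in[of "map Not bs" vs n] pick_update_out[of "map Not bs" vs n] that
      length_pick[of bs vs] length_pick[of "map Not bs" vs]
    by (cases "bs ! n") (auto simp: arg_lists_def k_def i_def j_def)
  have mem: "?P M N \<in> pts ?LH" if M: "M \<in> pts ?LF" and N: "N \<in> pts ?LG" for M N
    unfolding multilinear_pts_iff
  proof (intro conjI allI ballI impI)
    show "?P M N vs = 0" if "vs \<notin> arg_lists E k" for vs
      using that by (simp add: shuffle_product_def k_def)
    show "?P M N vs \<in> pts H" if "vs \<in> arg_lists E k" for vs
      using that Bs Mm[OF M args(1)] Nm[OF N args(2)] by (simp add: shuffle_product_def k_def)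
    show "\<exists>C. \<forall>vs\<in>arg_lists E k. nrm H (?P M N vs) \<le> C * (\<Prod>v\<leftarrow>vs. nrm E v)"
      using bd[OF M N] by blast
    fix vs n x assume vs: "vs \<in> arg_lists E k" and n: "n < k" and x: "x \<in> pts E"
    have a: "vs[n := z] \<in> arg_lists E k" if "z \<in> pts E" for z
      by (rule arg_lists_update[OF vs that])
    have P: "?P M N (vs[n := z]) = B (M (pick bs (vs[n := z]))) (N (pick (map Not bs) (vs[n := z])))"
      if "z \<in> pts E" for z
      using a[OF that] by (simp add: shuffle_product_def k_def)
    note aM = arg_lists_update[OF args(1)[OF vs]] and aN = arg_lists_update[OF args(2)[OF vs]]
    show "?P M N (vs[n := x + y]) = ?P M N (vs[n := x]) + ?P M N (vs[n := y])" if y: "y \<in> pts E" for y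
    proof -
      have xy: "x + y \<in> pts E" by (rule seminormed.add_mem[OF E x y])
      from upd[OF vs n] show ?thesis
      proof (elim disjE conjE exE)
        fix m assume m: "m < i" and eq: "\<forall>x. pick bs (vs[n := x]) = (pick bs vs)[m := x]"
          "\<forall>x. pick (map Not bs) (vs[n := x]) = pick (map Not bs) vs"
        have "M ((pick bs vs)[m := x + y]) = M ((pick bs vs)[m := x]) + M ((pick bs vs)[m := y])"
          using M args(1)[OF vs] m x y unfolding multilinear_pts_iff by blast
        then show ?thesis unfolding P[OF xy] P[OF x] P[OF y] using eq Bs
            Mm[OF M aM[OF x]] Mm[OF M aM[OF y]] Nm[OF N args(2)[OF vs]] by simp
      next
        fix m assume m: "m < j" and eq: "\<forall>x. pick (map Not bs) (vs[n := x])
            = (pick (map Not bs) vs)[m := x]"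
          "\<forall>x. pick bs (vs[n := x]) = pick bs vs"
        have "N ((pick (map Not bs) vs)[m := x + y]) = N ((pick (map Not bs) vs)[m := x])
            + N ((pick (map Not bs) vs)[m := y])"
          using N args(2)[OF vs] m x y unfolding multilinear_pts_iff by blast
        then show ?thesis unfolding P[OF xy] P[OF x] P[OF y] using eq Bs
            Nm[OF N aN[OF x]] Nm[OF N aN[OF y]] Mm[OF M args(1)[OF vs]] by simp
      qed
    qed
    show "?P M N (vs[n := c *\<^sub>R x]) = c *\<^sub>R ?P M N (vs[n := x])" for c
    proof -
      have xy: "c *\<^sub>R x \<in> pts E" by (rule seminormed.scale_mem[OF E x])
      from upd[OF vs n] show ?thesis
      proof (elim disjE conjE exE)
        fix m assume m: "m < i" and eq: "\<forall>x. pick bs (vs[n := x]) = (pick bs vs)[m := x]"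
          "\<forall>x. pick (map Not bs) (vs[n := x]) = pick (map Not bs) vs"
        have "M ((pick bs vs)[m := c *\<^sub>R x]) = c *\<^sub>R M ((pick bs vs)[m := x])"
          using M args(1)[OF vs] m x unfolding multilinear_pts_iff by blast
        then show ?thesis unfolding P[OF xy] P[OF x] using eq Bs
            Mm[OF M aM[OF x]] Nm[OF N args(2)[OF vs]] by simp
      next
        fix m assume m: "m < j" and eq: "\<forall>x. pick (map Not bs) (vs[n := x])
            = (pick (map Not bs) vs)[m := x]"
          "\<forall>x. pick bs (vs[n := x]) = pick bs vs"
        have "N ((pick (map Not bs) vs)[m := c *\<^sub>R x]) = c *\<^sub>R N ((pick (map Not bs) vs)[m := x])"
          using N args(2)[OF vs] m x unfolding multilinear_pts_iff by blast
        then show ?thesis unfolding P[OF xy] P[OF x] using eq Bs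
            Nm[OF N aN[OF x]] Mm[OF M args(1)[OF vs]] by simp
      qed
    qed
  qed
  have nrm: "nrm ?LH (?P M N) \<le> K * nrm ?LF M * nrm ?LG N" if "M \<in> pts ?LF" "N \<in> pts ?LG" for M N
    using bd[OF that] K(1) multilinear_nrm(1)[OF E that(1)] multilinear_nrm(1)[OF E that(2)]
    by (intro multilinear_nrm(3)[OF E mem[OF that]]) auto
  have "\<exists>C. \<forall>M\<in>pts ?LF. \<forall>N\<in>pts ?LG. nrm ?LH (?P M N) \<le> C * nrm ?LF M * nrm ?LG N"
    using nrm by blast
  then show ?thesis
    unfolding bounded_bilinear_nspace_def i_def[symmetric] j_def[symmetric] k_def[symmetric]
    using mem Mm Nm args Bs
    by (auto simp: shuffle_product_def fun_eq_iff scaleR_fun_def k_def[symmetric])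
qed

text \<open>The \<open>k\<close>-th derivative is given by the Leibniz rule: \<open>bs\<close> runs over all ways of distributing
  the \<open>k\<close> directions among the two factors.\<close>

lemma smooth_nspace_bilinear:
  assumes f: "smooth_nspace E F U f" and g: "smooth_nspace E G U g"
    and B: "bounded_bilinear_nspace F G H B"
    and E: "seminormed E" and F: "seminormed F" and G: "seminormed G" and H: "seminormed H"
  shows "smooth_nspace E H U (\<lambda>x. B (f x) (g x))"
proof -
  obtain D where D: "\<forall>x\<in>U. D 0 x = (\<lambda>vs. if vs = [] then f x else 0)" "derivative_tower E F U D"
    using f by (auto simp: smooth_nspace_iff)
  obtain D' where D': "\<forall>x\<in>U. D' 0 x = (\<lambda>vs. if vs = [] then g x else 0)" "derivative_tower E G U D'"
    using g by (auto simp: smooth_nspace_iff)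
  define T where "T = (\<lambda>bs x. shuffle_product E B bs (D (count_list bs True) x)
      (D' (count_list (map Not bs) True) x))"
  define P where "P = (\<lambda>k x. \<Sum>bs | length bs = k. T bs x)"
  have fin: "finite {bs :: bool list. length bs = k}" for k
    using finite_lists_length_eq[of "UNIV :: bool set" k] by simp
  note bil = bounded_bilinear_shuffle_product[OF B E F G H]
  have Dm: "D k x \<in> pts (multilinear_nspace E F k)" "D' k x \<in> pts (multilinear_nspace E G k)"
      if "x \<in> U" for k x
    using D(2) D'(2) that by (auto simp: derivative_tower_def)
  have Tm: "T bs x \<in> pts (multilinear_nspace E H k)" if "x \<in> U" "length bs = k" for bs x k
    using bil[of bs] Dm[OF that(1)] that(2) unfolding T_def bounded_bilinear_nspace_def by blast
  have Pm: "P k x \<in> pts (multilinear_nspace E H k)" if "x \<in> U" for k x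
    unfolding P_def using Tm[OF that]
    by (intro seminormed.sum_mem[OF seminormed_multilinear[OF E H]]) auto
  \<comment> \<open>The new direction is prepended to the list, so masks of length
    \<open>Suc k\<close> split by which factor receives it; these are the two terms of the product
    rule.\<close>
  have Suc_eq: "{bs :: bool list. length bs = Suc k} =
      Cons True ` {bs. length bs = k} \<union> Cons False ` {bs. length bs = k}" for k
    by (auto simp: length_Suc_conv)
  have sum_Suc: "P (Suc k) x = (\<Sum>bs | length bs = k. T (True # bs) x + T (False # bs) x)" for k x
    unfolding P_def Suc_eq
    by (subst sum.union_disjoint) (auto simp: fin sum.reindex sum.distrib)
  have apply_sum: "(\<Sum>i\<in>I. h i) v = (\<Sum>i\<in>I. h i v)" for I :: "bool list set"
      and h :: "bool list \<Rightarrow> 'a list \<Rightarrow> 'd" and v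
    by (induction I rule: infinite_finite_induct) auto
  have der: "has_fderiv E (multilinear_nspace E H k) U (P k) (\<lambda>h vs. P (Suc k) x (h # vs)) x"
      if x: "x \<in> U" for k x
  proof -
    have d1: "has_fderiv E (multilinear_nspace E H k) U (\<lambda>x. T bs x)
        (\<lambda>h. shuffle_product E B bs (\<lambda>vs. D (Suc (count_list bs True)) x (h # vs)) (D' (count_list
            (map Not bs) True) x)
          + shuffle_product E B bs (D (count_list bs True) x) (\<lambda>vs. D' (Suc (count_list (map Not
              bs) True)) x (h # vs))) x"
      if len: "length bs = k" for bs
      unfolding T_def len[symmetric]
      by (rule has_fderiv_bilinear[OF _ _ x _ _ bil E seminormed_multilinear[OF E F]
            seminormed_multilinear[OF E G] seminormed_multilinear[OF E H]])
        (use D(2) D'(2) x Dm in \<open>simp_all add: derivative_tower_def\<close>)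
    have d2: "has_fderiv E (multilinear_nspace E H k) U (\<lambda>x. \<Sum>bs | length bs = k. T bs x)
       (\<lambda>h. \<Sum>bs | length bs = k.
          shuffle_product E B bs (\<lambda>vs. D (Suc (count_list bs True)) x (h # vs)) (D' (count_list
              (map Not bs) True) x)
          + shuffle_product E B bs (D (count_list bs True) x) (\<lambda>vs. D' (Suc (count_list (map Not
              bs) True)) x (h # vs))) x"
      by (rule has_fderiv_sum[OF fin d1 x _ E seminormed_multilinear[OF E H]]) (use Tm in auto)
    show ?thesis
    proof (rule has_fderiv_cong[OF d2 x _ _ E])
      show "(\<Sum>bs | length bs = k. T bs y) = P k y" if "y \<in> U" for y by (simp add: P_def)
      show "(\<Sum>bs | length bs = k.
          shuffle_product E B bs (\<lambda>vs. D (Suc (count_list bs True)) x (h # vs)) (D' (count_list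
              (map Not bs) True) x)
          + shuffle_product E B bs (D (count_list bs True) x) (\<lambda>vs. D' (Suc (count_list (map Not
              bs) True)) x (h # vs)))
          = (\<lambda>vs. P (Suc k) x (h # vs))" if h: "h \<in> pts E" for h
      proof
        fix vs
        show "(\<Sum>bs | length bs = k.
          shuffle_product E B bs (\<lambda>vs. D (Suc (count_list bs True)) x (h # vs)) (D' (count_list
              (map Not bs) True) x)
          + shuffle_product E B bs (D (count_list bs True) x) (\<lambda>vs. D' (Suc (count_list (map Not
              bs) True)) x (h # vs))) vs
          = P (Suc k) x (h # vs)"
          unfolding sum_Suc apply_sum
          by (intro sum.cong refl) (auto simp: T_def shuffle_product_def arg_lists_Suc h)
      qed
    qed
  qed
  show ?thesis unfolding smooth_nspace_iff
  proof (intro exI conjI ballI)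
    show "P 0 x = (\<lambda>vs. if vs = [] then B (f x) (g x) else 0)" if "x \<in> U" for x
    proof -
      have "{bs :: bool list. length bs = 0} = {[]}" by auto
      then have "P 0 x = T [] x" unfolding P_def by (simp only: sum.insert finite.emptyI) simp
      then show ?thesis
        using D(1) D'(1) that by (simp add: T_def shuffle_product_def arg_lists_def fun_eq_iff)
    qed
    show "derivative_tower E H U P"
      unfolding derivative_tower_def using Pm der by blast
  qed
qed

lemma prod_list_update:
  fixes ws :: "'a::comm_monoid_mult list"
  shows "n < length ws \<Longrightarrow> prod_list (ws[n := z]) = z * (prod_list (take n ws) * prod_list (drop
      (Suc n) ws))"
  by (simp add: upd_conv_take_nth_drop mult_ac)

text \<open>For a function of \<open>L x\<close> with values in an algebra, the k-th derivative in
  directions h1, ..., hk is \<open>G k x\<close> times the product of the \<open>L hi\<close>. The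
  passage \<open>T k\<close> from the coefficient to this k-linear map is bounded and linear, so
  only the one-variable pattern of derivatives of the \<open>G k\<close> remains to be checked. For
  the exponential all \<open>G k\<close> agree; for the reciprocal of f they are (-1)^k k! /
  f^(k+1).\<close>

lemma smooth_nspace_scheme:
  fixes A :: "('c \<Rightarrow> real) nspace"
  assumes G: "\<And>k x. x \<in> U \<Longrightarrow> G k x \<in> pts A"
    and D: "\<And>k x. x \<in> U \<Longrightarrow> has_fderiv E A U (G k) (\<lambda>h. G (Suc k) x * L h) x"
    and L: "bounded_linear_nspace E A L" and E: "seminormed E" and A: "seminormed A"
    and alg: "bounded_bilinear_nspace A A A (*)" and one: "1 \<in> pts A"
  shows "smooth_nspace E A U (G 0)"
proof -
  define T where "T = (\<lambda>k a vs. if vs \<in> arg_lists E k then a * prod_list (map L vs) else 0)"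
  obtain K where K: "0 \<le> K" "\<And>x y. x \<in> pts A \<Longrightarrow> y \<in> pts A \<Longrightarrow> nrm A (x * y) \<le> K * nrm A x * nrm A y"
    using bounded_bilinear_nspace_bound[OF alg A A] by blast
  obtain C where C: "0 \<le> C" "\<And>x. x \<in> pts E \<Longrightarrow> nrm A (L x) \<le> C * nrm E x"
    using bounded_linear_nspace_bound[OF L E] by blast
  have mulm: "x * y \<in> pts A" if "x \<in> pts A" "y \<in> pts A" for x y
    using alg that by (simp add: bounded_bilinear_nspace_def)
  have Lm: "L x \<in> pts A" if "x \<in> pts E" for x using L that by (simp add: bounded_linear_nspace_def)
  have pm: "prod_list (map L vs) \<in> pts A" if "set vs \<subseteq> pts E" for vs
    using that by (induction vs) (auto intro: one mulm Lm)
  have pb: "nrm A (a * prod_list (map L vs)) \<le> (K * C) ^ length vs * nrm A a * (\<Prod>v\<leftarrow>vs. nrm E v)"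
    if "a \<in> pts A" "set vs \<subseteq> pts E" for a vs
    using that
  proof (induction vs arbitrary: a)
    case (Cons v vs)
    have v: "v \<in> pts E" "a * L v \<in> pts A" using Cons.prems by (auto intro: mulm Lm)
    have "nrm A (a * L v) \<le> K * nrm A a * nrm A (L v)" using K(2) Cons.prems Lm by simp
    also have "\<dots> \<le> K * nrm A a * (C * nrm E v)"
      using C(2)[OF v(1)] K(1) seminormed.nrm_ge0[OF A Cons.prems(1)] by (intro mult_left_mono) auto
    finally have av: "nrm A (a * L v) \<le> K * nrm A a * (C * nrm E v)" .
    have "nrm A ((a * L v) * prod_list (map L vs)) \<le> (K * C) ^ length vs * nrm A (a * L v) *
        (\<Prod>v\<leftarrow>vs. nrm E v)"
      by (rule Cons.IH[OF v(2)]) (use Cons.prems(2) in auto)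
    also have "\<dots> \<le> (K * C) ^ length vs * (K * nrm A a * (C * nrm E v)) * (\<Prod>v\<leftarrow>vs. nrm E v)"
      using K(1) C(1) seminormed.prod_nrm_ge0[OF E, of vs "length vs"] Cons.prems
      by (intro mult_right_mono mult_left_mono av) (auto simp: arg_lists_def)
    finally show ?case by (simp only: list.map prod_list.Cons list.size power_Suc add_0_right
        add_Suc_right mult_ac)
  qed simp
  have Tm: "T k a \<in> pts (multilinear_nspace E A k)" if a: "a \<in> pts A" for k a
    unfolding multilinear_pts_iff
  proof (intro conjI allI ballI impI)
    show "T k a vs = 0" if "vs \<notin> arg_lists E k" for vs using that by (simp add: T_def)
    show "T k a vs \<in> pts A" if "vs \<in> arg_lists E k" for vs
      using that a pm by (auto simp: T_def arg_lists_def intro!: mulm)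
    show "\<exists>C. \<forall>vs\<in>arg_lists E k. nrm A (T k a vs) \<le> C * (\<Prod>v\<leftarrow>vs. nrm E v)"
      using pb[OF a] by (intro exI[of _ "(K * C) ^ k * nrm A a"]) (auto simp: T_def arg_lists_def)
    fix vs n x assume vs: "vs \<in> arg_lists E k" and n: "n < k" and x: "x \<in> pts E"
    note upd = arg_lists_update[OF vs]
    show "T k a (vs[n := x + y]) = T k a (vs[n := x]) + T k a (vs[n := y])" if y: "y \<in> pts E" for y
    proof -
      have "L (x + y) = L x + L y" using L x y by (simp add: bounded_linear_nspace_def)
      then show ?thesis
        using vs n upd[OF x] upd[OF y] upd[OF seminormed.add_mem[OF E x y]]
        by (simp add: T_def map_update prod_list_update arg_lists_def distrib_left distrib_right)
    qed
    show "T k a (vs[n := c *\<^sub>R x]) = c *\<^sub>R T k a (vs[n := x])" for c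
    proof -
      have "L (c *\<^sub>R x) = c *\<^sub>R L x" using L x by (simp add: bounded_linear_nspace_def)
      then show ?thesis
        using vs n upd[OF x] upd[OF seminormed.scale_mem[OF E x]]
        by (simp add: T_def map_update prod_list_update arg_lists_def) (simp add: fun_eq_iff
            scaleR_fun_def)
    qed
  qed
  have T: "bounded_linear_nspace A (multilinear_nspace E A k) (T k)" for k
  proof -
    have "nrm (multilinear_nspace E A k) (T k a) \<le> (K * C) ^ k * nrm A a" if "a \<in> pts A" for a
      using pb[OF that] K(1) C(1) seminormed.nrm_ge0[OF A that]
      by (intro multilinear_nrm(3)[OF E Tm[OF that]]) (auto simp: T_def arg_lists_def)
    then have "\<exists>C. \<forall>a\<in>pts A. nrm (multilinear_nspace E A k) (T k a) \<le> C * nrm A a" by blast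
    with Tm show ?thesis unfolding bounded_linear_nspace_def
      by (simp add: T_def fun_eq_iff scaleR_fun_def distrib_right)
  qed
  show ?thesis unfolding smooth_nspace_iff
  proof (intro exI conjI ballI)
    show "T 0 (G 0 x) = (\<lambda>vs. if vs = [] then G 0 x else 0)" for x
      by (auto simp: T_def arg_lists_def)
    show "derivative_tower E A U (\<lambda>k x. T k (G k x))"
      unfolding derivative_tower_def
    proof (intro conjI allI ballI)
      fix k x assume x: "x \<in> U"
      show "T k (G k x) \<in> pts (multilinear_nspace E A k)" by (rule Tm[OF G[OF x]])
      show "has_fderiv E (multilinear_nspace E A k) U (\<lambda>x. T k (G k x))
          (\<lambda>h vs. T (Suc k) (G (Suc k) x) (h # vs)) x"
        by (rule has_fderiv_cong[OF has_fderiv_linear[OF D[OF x] x G T E A] x _ _ E])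
          (auto simp: T_def arg_lists_Suc fun_eq_iff)
    qed
  qed
qed

section \<open>Fourier analysis on the circle\<close>

lemma proj_eq_iff: "proj x = proj y \<longleftrightarrow> x - y \<in> \<int>"
  by (rule circle.abs_eq_iff)

lemma proj_rep_circle [simp]: "proj (rep_circle p) = p"
  using Quotient_abs_rep[OF Quotient_circle] .

lemma proj_add_1 [simp]: "proj (x + 1) = proj x"
  by (simp add: proj_eq_iff)

lemma circle_ext: "(\<And>x. u (proj x) = v (proj x)) \<Longrightarrow> u = v"
  by (metis ext proj_rep_circle)

lemma periodic_Ints:
  assumes p: "\<And>x::real. g (x + 1) = g x" and "x - y \<in> \<int>"
  shows "g x = g y"
proof -
  have n: "g (y + of_nat n) = g y" for n y
    by (induction n) (auto simp: p add.assoc[symmetric] add.commute[of 1])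
  obtain k where k: "x = y + of_int k"
    using assms(2) by (metis Ints_cases add_diff_cancel_left' diff_add_cancel add.commute)
  show ?thesis
  proof (cases k)
    case (nonneg m)
    then show ?thesis using k n[of y m] by simp
  next
    case (neg m)
    then have "y = x + of_nat (Suc m)" using k by simp
    then show ?thesis using n[of x "Suc m"] by simp
  qed
qed

text \<open>This is how periodic functions on the line descend to the circle: evaluation at the
  chosen representative is harmless.\<close>

lemma periodic_rep_circle:
  assumes "\<And>x::real. g (x + 1) = g x"
  shows "g (rep_circle (proj x)) = g x"
  by (rule periodic_Ints[of g, OF assms]) (simp flip: proj_eq_iff)

definition character :: "int \<Rightarrow> real \<Rightarrow> complex" where
  "character k x = cis (2 * pi * of_int k * x)"

lemma character_mult: "character j x * character k x = character (j + k) x"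
  by (simp add: character_def cis_mult algebra_simps)

lemma cnj_character [simp]: "cnj (character k x) = character (- k) x"
  by (simp add: character_def cis_cnj)

lemma norm_character [simp]: "norm (character k x) = 1"
  by (simp add: character_def)

lemma character_0 [simp]: "character 0 x = 1"
  by (simp add: character_def)

lemma character_at_0 [simp]: "character k 0 = 1"
  by (simp add: character_def)

lemma character_periodic [simp]: "character k (x + 1) = character k x"
proof -
  have "cis (2 * pi * of_int k) = 1"
    using cis_multiple_2pi[of "of_int k"] by (simp add: mult_ac)
  then show ?thesis by (simp add: character_def distrib_left flip: cis_mult)
qed

lemma character_at_1 [simp]: "character k 1 = 1"
  using character_periodic[of k 0] by simp

lemma character_deriv:
  "(character k has_vector_derivative (2 * of_real pi * of_int k * \<i>) * character k x) (at x within S)"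
proof -
  have "((\<lambda>z. exp (2 * of_real pi * of_int k * \<i> * z)) has_field_derivative
      (2 * of_real pi * of_int k * \<i>) * exp (2 * of_real pi * of_int k * \<i> * of_real x)) (at
          (of_real x))"
    by (auto intro!: derivative_eq_intros)
  from has_vector_derivative_real_field[OF this]
  show ?thesis by (simp add: character_def[abs_def] cis_conv_exp mult_ac)
qed

lemma continuous_on_character [continuous_intros]: "continuous_on S (character k)"
  unfolding character_def cis_conv_exp by (intro continuous_intros)

lemma integral_complex_of_real_HK:
  "f integrable_on S \<Longrightarrow> integral S (\<lambda>x. complex_of_real (f x)) = complex_of_real (integral S f)"
  by (intro integral_unique has_integral_of_real integrable_integral)

text \<open>Unlike \<open>fourier\<close>, it accepts complex functions on the line, as needed for
  sums of Fourier series and for derivatives of lifts.\<close>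

definition coeff :: "(real \<Rightarrow> complex) \<Rightarrow> int \<Rightarrow> complex" where
  "coeff f k = integral {0..1} (\<lambda>x. f x * character (- k) x)"

lemma fourier_coeff: "fourier u = coeff (\<lambda>x. complex_of_real (u (proj x)))"
  by (simp add: fourier_def coeff_def character_def fun_eq_iff)

lemma integral_character: "integral {0..1} (character k) = (if k = 0 then 1 else 0)"
proof (cases "k = 0")
  case True
  have "character 0 = (\<lambda>x. 1)" by auto
  then show ?thesis using True by simp
next
  case False
  let ?c = "2 * of_real pi * of_int k * \<i> :: complex"
  have "((\<lambda>x. ?c * character k x) has_integral character k 1 - character k 0) {0..1}"
    by (rule fundamental_theorem_of_calculus) (auto intro: character_deriv)
  from integral_unique[OF this] have "integral {0..1} (\<lambda>x. ?c * character k x) = 0" by simp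
  then have "?c * integral {0..1} (character k) = 0" by simp
  with False show ?thesis by simp
qed

lemma coeff_diff_real:
  assumes "continuous_on UNIV f" "continuous_on UNIV g"
  shows "coeff (\<lambda>x. f x - g x) k = coeff f k - coeff g k"
  unfolding coeff_def left_diff_distrib
  by (intro integral_diff integrable_continuous_interval continuous_intros
      continuous_on_subset[OF assms(1)] continuous_on_subset[OF assms(2)]) auto

section \<open>Uniqueness of Fourier coefficients\<close>

inductive trig_poly :: "(real \<Rightarrow> complex) \<Rightarrow> bool" where
  character: "trig_poly (\<lambda>x. c * character k x)"
| add: "trig_poly f \<Longrightarrow> trig_poly g \<Longrightarrow> trig_poly (\<lambda>x. f x + g x)"

lemma trig_poly_mult:
  assumes "trig_poly f" "trig_poly g"
  shows "trig_poly (\<lambda>x. f x * g x)"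
  using assms(1)
proof (induction f rule: trig_poly.induct)
  case (character c k)
  show ?case using assms(2)
  proof (induction g rule: trig_poly.induct)
    case (character d j)
    have "(\<lambda>x. c * character k x * (d * character j x)) = (\<lambda>x. (c * d) * character (k + j) x)"
      by (simp add: fun_eq_iff mult_ac flip: character_mult)
    then show ?case using trig_poly.character by metis
  next
    case (add f g)
    then show ?case by (simp add: distrib_left trig_poly.add)
  qed
next
  case (add f f')
  then show ?case by (simp add: distrib_right trig_poly.add)
qed

text \<open>On the unit circle the real coordinates are combinations of z and its conjugate, which
  are the characters of index 1 and -1; trigonometric polynomials are closed under products. This
  connects polynomial approximation in the plane with Fourier coefficients.\<close>

lemma trig_poly_real_polynomial:
  fixes p :: "complex \<Rightarrow> real"
  assumes "real_polynomial_function p"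
  shows "trig_poly (\<lambda>x. complex_of_real (p (character 1 x)))"
  using assms
proof (induction p rule: real_polynomial_function.induct)
  case (linear f)
  have 1: "f z = Re z * f 1 + Im z * f \<i>" for z
  proof -
    have "z = Re z *\<^sub>R 1 + Im z *\<^sub>R \<i>" by (simp add: complex_eq_iff)
    then have "f z = f (Re z *\<^sub>R 1 + Im z *\<^sub>R \<i>)" by simp
    also have "\<dots> = Re z * f 1 + Im z * f \<i>"
      using linear by (simp add: linear_simps)
    finally show ?thesis .
  qed
  have 2: "complex_of_real (Re z * a + Im z * b) = (a / 2 - \<i> * b / 2) * z + (a / 2
      + \<i> * b / 2) * cnj z"
    for z a b by (simp add: complex_eq_iff field_simps)
  have "complex_of_real (f (character 1 x)) = (f 1 / 2 - \<i> * f \<i> / 2) * character 1 x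
     + (f 1 / 2 + \<i> * f \<i> / 2) * character (-1) x" for x
    unfolding 1[of "character 1 x"] 2 cnj_character by simp
  then show ?case by (simp only:) (intro trig_poly.intros)
next
  case (const c)
  show ?case using trig_poly.character[of c 0] by simp
qed (auto intro: trig_poly.add trig_poly_mult)

lemma trig_poly_continuous: "trig_poly f \<Longrightarrow> continuous_on S f"
  by (induction rule: trig_poly.induct) (auto intro!: continuous_intros)

lemma trig_poly_orthogonal:
  assumes "trig_poly f" and g: "continuous_on UNIV g" and 0: "\<And>k. coeff g k = 0"
  shows "integral {0..1} (\<lambda>x. g x * f x) = 0"
  using assms(1)
proof (induction rule: trig_poly.induct)
  case (character c k)
  have "integral {0..1} (\<lambda>x. c * (g x * character k x)) = c * coeff g (- k)"
    by (simp add: coeff_def)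
  then show ?case by (simp add: 0 mult_ac)
next
  case (add f f')
  have "(\<lambda>x. g x * f x) integrable_on {0..1}" "(\<lambda>x. g x * f' x) integrable_on {0..1}"
    by (intro integrable_continuous_interval continuous_on_mult trig_poly_continuous add.hyps
        continuous_on_subset[OF g] subset_UNIV)+
  with add.IH show ?case by (simp add: distrib_left integral_add)
qed

text \<open>A periodic function is a function of the angle. \<open>Arg\<close> jumps on the negative
  real axis and \<open>Arg2pi\<close> on the positive one; they differ by multiples of 2 pi, which
  \<open>g\<close> does not see, so each point of the circle has a continuous branch.\<close>

lemma continuous_on_sphere_periodic:
  fixes g :: "real \<Rightarrow> real"
  assumes g: "continuous_on UNIV g" and p: "\<And>x. g (x + 1) = g x"
  obtains G where "continuous_on (sphere 0 1) G" "\<And>x. G (character 1 x) = g x"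
proof
  let ?G = "\<lambda>z. g (Arg z / (2 * pi))"
  have eq: "g a = ?G z" if z: "z = cis (2 * pi * a)" for a z
  proof (rule periodic_Ints[of g, OF p])
    have "z \<noteq> 0" "cmod z = 1" using z by auto
    then have "cis (Arg z) = cis (2 * pi * a)" using z by (simp add: cis_Arg sgn_div_norm)
    then have c1: "cis (2 * pi * a - Arg z) = 1" by (simp flip: cis_divide)
    obtain n :: int where "2 * pi * a - Arg z = of_int n * 2 * pi"
      using arg_cong[OF c1, of Re] cos_one_2pi_int[of "2 * pi * a - Arg z"] by fastforce
    then have "a - Arg z / (2 * pi) = of_int n" by (simp add: field_simps)
    then show "a - Arg z / (2 * pi) \<in> \<int>" by simp
  qed
  show "?G (character 1 x) = g x" for x
    by (rule eq[symmetric]) (simp add: character_def)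
  have eq2: "?G z = g (Arg2pi z / (2 * pi))" if "z \<noteq> 0" for z
  proof -
    have "g (Arg2pi z / (2 * pi)) = ?G (cis (Arg2pi z))" by (rule eq) simp
    also have "Arg (cis (Arg2pi z)) = Arg z"
    proof -
      have "z = of_real (cmod z) * cis (Arg2pi z)"
        using Arg2pi_eq[of z] by (simp add: cis_conv_exp)
      then have "Arg z = Arg (of_real (cmod z) * cis (Arg2pi z))" by simp
      then show ?thesis using that by (simp add: Arg_times_of_real)
    qed
    finally show ?thesis by simp
  qed
  have gc: "isCont g x" for x using g by (simp add: continuous_on_eq_continuous_at)
  have "isCont ?G z" if "z \<noteq> 0" for z
  proof (cases "z \<in> \<real>\<^sub>\<le>\<^sub>0")
    case False
    then have "isCont (\<lambda>z. Arg z / (2 * pi)) z"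
      by (intro continuous_intros continuous_at_Arg) auto
    then show ?thesis by (rule isCont_o2[OF _ gc])
  next
    case True
    then have "z \<notin> \<real>\<^sub>\<ge>\<^sub>0" using that by (auto elim!: nonpos_Reals_cases nonneg_Reals_cases)
    then have "isCont (\<lambda>z. Arg2pi z / (2 * pi)) z"
      by (intro continuous_intros continuous_at_Arg2pi) auto
    then have c: "isCont (\<lambda>z. g (Arg2pi z / (2 * pi))) z" by (rule isCont_o2[OF _ gc])
    have "\<forall>\<^sub>F w in nhds z. w \<noteq> 0" using that by (rule t1_space_nhds)
    then have "\<forall>\<^sub>F w in nhds z. g (Arg2pi w / (2 * pi)) = ?G w"
      by eventually_elim (simp add: eq2)
    then show ?thesis using c by (simp add: isCont_cong)
  qed
  moreover have "z \<noteq> 0" if "z \<in> sphere 0 1" for z :: complex using that by auto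
  ultimately show "continuous_on (sphere 0 1) ?G"
    by (intro continuous_at_imp_continuous_on ballI) blast
qed

text \<open>By Stone-Weierstrass on the unit circle, \<open>g\<close> is uniformly within e of a
  trigonometric polynomial P. Since \<open>g\<close> is orthogonal to P, the integral of g^2 equals
  that of g (g - P), hence is at most e times the integral of |g|. Letting e shrink gives g =
  0.\<close>

lemma coeff_unique:
  fixes g :: "real \<Rightarrow> real"
  assumes g: "continuous_on UNIV g" and p: "\<And>x. g (x + 1) = g x"
    and 0: "\<And>k. coeff (\<lambda>x. complex_of_real (g x)) k = 0"
  shows "g x = 0"
proof -
  obtain G where G: "continuous_on (sphere 0 1) G" "\<And>x. G (character 1 x) = g x"
    by (rule continuous_on_sphere_periodic[OF g p], rule that)
  have gc: "continuous_on {0..1} g" by (rule continuous_on_subset[OF g]) simp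
  define I where "I = integral {0..1} (\<lambda>x. \<bar>g x\<bar>)"
  have I0: "0 \<le> I" unfolding I_def by (intro integral_nonneg integrable_continuous_interval
      continuous_intros gc) auto
  have le: "integral {0..1} (\<lambda>x. g x * g x) \<le> e * I" if e: "e > 0" for e
  proof -
    obtain q where q: "real_polynomial_function q" "\<And>z. z \<in> sphere 0 1 \<Longrightarrow> \<bar>G z - q z\<bar> < e"
      by (rule Stone_Weierstrass_real_polynomial_function[OF compact_sphere G(1) e], rule that)
    let ?P = "\<lambda>x. q (character 1 x)"
    have tp: "trig_poly (\<lambda>x. complex_of_real (?P x))" by (rule trig_poly_real_polynomial[OF q(1)])
    have "continuous_on {0..1} (\<lambda>x. Re (complex_of_real (?P x)))"
      by (intro continuous_intros trig_poly_continuous tp)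
    then have Pc: "continuous_on {0..1} ?P" by simp
    have "integral {0..1} (\<lambda>x. complex_of_real (g x) * complex_of_real (?P x)) = 0"
      by (rule trig_poly_orthogonal[OF tp _ 0]) (intro continuous_intros g)
    moreover have "integral {0..1} (\<lambda>x. complex_of_real (g x * ?P x))
        = complex_of_real (integral {0..1} (\<lambda>x. g x * ?P x))"
      by (rule integral_complex_of_real_HK) (intro integrable_continuous_interval
          continuous_intros gc Pc)
    ultimately have z: "integral {0..1} (\<lambda>x. g x * ?P x) = 0" by simp
    have "integral {0..1} (\<lambda>x. g x * g x) - integral {0..1} (\<lambda>x. g x * ?P x)
        = integral {0..1} (\<lambda>x. g x * g x - g x * ?P x)"
      by (intro integral_diff[symmetric] integrable_continuous_interval continuous_intros gc Pc)
    also have "\<dots> \<le> integral {0..1} (\<lambda>x. e * \<bar>g x\<bar>)"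
    proof (intro integral_le integrable_continuous_interval continuous_intros gc Pc)
      fix x :: real
      have "\<bar>g x - ?P x\<bar> \<le> e" using q(2)[of "character 1 x"] G(2) by (simp add: less_imp_le)
      then have "\<bar>g x\<bar> * \<bar>g x - ?P x\<bar> \<le> \<bar>g x\<bar> * e" by (intro mult_left_mono) auto
      moreover have "g x * g x - g x * ?P x \<le> \<bar>g x * (g x - ?P x)\<bar>" by (simp add: right_diff_distrib)
      ultimately show "g x * g x - g x * ?P x \<le> e * \<bar>g x\<bar>" by (simp add: abs_mult mult.commute)
    qed
    also have "\<dots> = e * I" by (simp add: I_def)
    finally show ?thesis using z by simp
  qed
  have "integral {0..1} (\<lambda>x. g x * g x) \<le> 0"
  proof (rule ccontr)
    assume "\<not> ?thesis"
    then have pos: "integral {0..1} (\<lambda>x. g x * g x) > 0" by simp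
    define J where "J = integral {0..1} (\<lambda>x. g x * g x)"
    \<comment> \<open>This choice of e makes the bound smaller than J; the added 1 allows for I =
      0.\<close>
    have "J \<le> J / (2 * (I + 1)) * I" using le[of "J / (2 * (I + 1))"] pos I0 by (simp add: J_def)
    also have "\<dots> < J" using pos I0 by (simp add: J_def field_simps add_nonneg_pos)
    finally show False by simp
  qed
  moreover have "0 \<le> integral {0..1} (\<lambda>x. g x * g x)"
    by (intro integral_nonneg integrable_continuous_interval continuous_intros gc) auto
  ultimately have "integral {0..1} (\<lambda>x. g x * g x) = 0" by simp
  moreover have "continuous_on {0..1} (\<lambda>x. g x * g x)" by (intro continuous_intros gc)
  ultimately have z: "g x * g x = 0" if "x \<in> {0..1}" for x
    using integral_eq_0_iff[of 0 1 "\<lambda>x. g x * g x"] that by simp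
  \<comment> \<open>The integral only controls one period; \<open>frac\<close> moves any point into
    it.\<close>
  have "g x = g (frac x)" by (rule periodic_Ints[of g, OF p]) (simp add: frac_def)
  moreover have "frac x \<in> {0..1}" using frac_lt_1[of x] by (auto simp: less_imp_le)
  ultimately show ?thesis using z[of "frac x"] by simp
qed

lemma fourier_unique:
  assumes "continuous_on UNIV (\<lambda>x. u (proj x))" "continuous_on UNIV (\<lambda>x. v (proj x))"
    and "\<And>k. fourier u k = fourier v k"
  shows "u = v"
proof (rule circle_ext)
  fix x
  have "u (proj x) - v (proj x) = 0"
  proof (rule coeff_unique[where g = "\<lambda>x. u (proj x) - v (proj x)"])
    show "continuous_on UNIV (\<lambda>x. u (proj x) - v (proj x))" by (intro continuous_intros assms)
    show "coeff (\<lambda>x. complex_of_real (u (proj x) - v (proj x))) k = 0" for k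
      using assms(3)[of k] coeff_diff_real[of "\<lambda>x. complex_of_real (u (proj x))"
          "\<lambda>x. complex_of_real (v (proj x))" k]
      by (simp add: fourier_coeff continuous_on_of_real assms)
  qed simp
  then show "u (proj x) = v (proj x)" by simp
qed

lemma coeff_deriv:
  assumes d: "\<And>x. (f has_vector_derivative f' x) (at x)" and c: "continuous_on UNIV f'"
    and p: "f 1 = f 0"
  shows "coeff f' k = 2 * of_real pi * of_int k * \<i> * coeff f k"
proof -
  let ?c = "2 * of_real pi * of_int k * \<i> :: complex"
  have f: "continuous_on UNIV f"
    using d by (meson continuous_at_imp_continuous_on has_vector_derivative_continuous)
  note fc = continuous_on_subset[OF f, of "{0..1}"] continuous_on_subset[OF c, of "{0..1}"]
  have "((\<lambda>x. f x * (- ?c * character (- k) x) + f' x * character (- k) x) has_integral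
      f 1 * character (- k) 1 - f 0 * character (- k) 0) {0..1}"
  proof (rule fundamental_theorem_of_calculus)
    show "((\<lambda>x. f x * character (- k) x) has_vector_derivative f x * (- ?c * character (- k) x)
        + f' x * character (- k) x)
       (at x within {0..1})" for x
      using has_vector_derivative_mult[OF has_vector_derivative_at_within[OF d[of x], of "{0..1}"]
        character_deriv[of "-k" x "{0..1}"]] by simp
  qed simp
  then have "integral {0..1} (\<lambda>x. - ?c * (f x * character (- k) x) + f' x * character (- k) x) = 0"
    using p by (simp add: integral_unique algebra_simps)
  moreover have "integral {0..1} (\<lambda>x. - ?c * (f x * character (- k) x) + f' x * character (- k) x)
     = - ?c * coeff f k + coeff f' k"
    unfolding coeff_def
    by (subst integral_add) (auto intro!: integrable_continuous_interval continuous_intros fc)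
  ultimately show ?thesis by (simp add: algebra_simps)
qed

lemma fourier_uminus: "fourier u (- k) = cnj (fourier u k)"
  unfolding fourier_coeff coeff_def by (simp add: Henstock_Kurzweil_Integration.integral_cnj)

section \<open>Absolutely convergent Fourier series\<close>

definition fourier_series :: "(int \<Rightarrow> complex) \<Rightarrow> real \<Rightarrow> complex" where
  "fourier_series c x = (\<Sum>\<^sub>\<infinity>k. c k * character k x)"

context
  fixes c :: "int \<Rightarrow> complex"
  assumes c: "(\<lambda>k. norm (c k)) summable_on UNIV"
begin

lemma fourier_series_has_sum: "((\<lambda>k. c k * character k x) has_sum fourier_series c x) UNIV"
  unfolding fourier_series_def
  by (rule has_sum_infsum, rule abs_summable_summable) (simp add: norm_mult c)

lemma fourier_series_continuous: "continuous_on UNIV (fourier_series c)"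
proof -
  have "uniform_limit UNIV (\<lambda>X x. \<Sum>k\<in>X. c k * character k x) (fourier_series c)
      (finite_subsets_at_top UNIV)"
    unfolding fourier_series_def
    by (rule Weierstrass_m_test_general[OF _ c]) (simp add: norm_mult)
  then show ?thesis
    by (rule uniform_limit_theorem[rotated])
      (auto intro!: always_eventually continuous_intros)
qed

lemma fourier_series_periodic: "fourier_series c (x + 1) = fourier_series c x"
  by (simp add: fourier_series_def)

text \<open>The M-test gives uniform convergence, so sum and integral commute against any continuous
  \<open>G\<close>. A character for \<open>G\<close> recovers the coefficients, the conjugate of the
  series gives Parseval's identity, and a function times a character gives the convolution formula
  for products.\<close>

lemma fourier_series_integral:
  assumes G: "continuous_on {0..1} G"
  shows "((\<lambda>k. c k * integral {0..1} (\<lambda>x. character k x * G x)) has_sum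
     integral {0..1} (\<lambda>x. fourier_series c x * G x)) UNIV"
proof -
  have "bounded (G ` {0..1})" using G by (intro compact_imp_bounded compact_continuous_image) auto
  then obtain B where B: "\<And>x. x \<in> {0..1} \<Longrightarrow> norm (G x) \<le> B" unfolding bounded_iff by blast
  have ul: "uniform_limit {0..1} (\<lambda>X x. \<Sum>k\<in>X. c k * character k x * G x)
      (\<lambda>x. fourier_series c x * G x) (finite_subsets_at_top UNIV)"
  proof (rule Weierstrass_m_test_general'[where M = "\<lambda>k. norm (c k) * B"])
    show "norm (c k * character k x * G x) \<le> norm (c k) * B" if "x \<in> {0..1}" for k x
      using B[OF that] by (auto simp: norm_mult intro: mult_left_mono)
    show "((\<lambda>k. c k * character k x * G x) has_sum fourier_series c x * G x) UNIV" for x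
      by (rule has_sum_cmult_left[OF fourier_series_has_sum])
  qed (intro summable_on_cmult_left c)
  have "continuous_on {0..1} (\<lambda>x. \<Sum>k\<in>X. c k * character k x * G x)" for X
    by (intro continuous_intros G)
  then obtain I J where IJ: "\<And>X. ((\<lambda>x. \<Sum>k\<in>X. c k * character k x * G x) has_integral I X) {0..1}"
    "((\<lambda>x. fourier_series c x * G x) has_integral J) {0..1}" "(I \<longlongrightarrow> J) (finite_subsets_at_top UNIV)"
    using uniform_limit_integral[OF ul] by auto
  have I: "I X = (\<Sum>k\<in>X. c k * integral {0..1} (\<lambda>x. character k x * G x))" for X
  proof -
    have "I X = integral {0..1} (\<lambda>x. \<Sum>k\<in>X. c k * character k x * G x)"
      using IJ(1)[of X] by (simp add: integral_unique)
    also have "\<dots> = (\<Sum>k\<in>X. c k * integral {0..1} (\<lambda>x. character k x * G x))"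
    proof (cases "finite X")
      case True
      have "integral {0..1} (\<lambda>x. \<Sum>k\<in>X. c k * (character k x * G x)) =
          (\<Sum>k\<in>X. integral {0..1} (\<lambda>x. c k * (character k x * G x)))"
        by (intro integral_sum True integrable_continuous_interval continuous_intros G)
      then show ?thesis by (simp add: mult.assoc)
    qed simp
    finally show ?thesis .
  qed
  have "((\<lambda>X. I X) \<longlongrightarrow> integral {0..1} (\<lambda>x. fourier_series c x * G x)) (finite_subsets_at_top UNIV)"
    using IJ(2,3) by (simp add: integral_unique)
  then show ?thesis unfolding has_sum_def I .
qed

lemma coeff_fourier_series: "coeff (fourier_series c) j = c j"
proof -
  have "((\<lambda>k. c k * integral {0..1} (\<lambda>x. character k x * character (- j) x))
      has_sum coeff (fourier_series c) j) UNIV"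
    unfolding coeff_def by (intro fourier_series_integral continuous_intros)
  moreover have "(\<lambda>k. c k * integral {0..1} (\<lambda>x. character k x * character (- j) x)) = (\<lambda>k. if k
      = j then c j else 0)"
    using integral_character by (auto simp: character_mult fun_eq_iff)
  moreover have "((\<lambda>k. if k = j then c j else 0) has_sum c j) UNIV"
    by (rule has_sum_finite_neutralI[of "{j}"]) auto
  ultimately show ?thesis using has_sum_unique[of "\<lambda>k. if k = j then c j else 0"] by simp
qed

lemma fourier_series_parseval:
  "((\<lambda>k. (cmod (c k))\<^sup>2) has_sum integral {0..1} (\<lambda>x. (cmod (fourier_series c x))\<^sup>2)) UNIV"
proof -
  let ?S = "fourier_series c"
  have S: "continuous_on {0..1} ?S" by (rule continuous_on_subset[OF fourier_series_continuous]) simp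
  have "integral {0..1} (\<lambda>x. character k x * cnj (?S x)) = cnj (c k)" for k
  proof -
    have "integral {0..1} (\<lambda>x. cnj (?S x * character (- k) x)) = cnj (coeff ?S k)"
      unfolding coeff_def by (rule Henstock_Kurzweil_Integration.integral_cnj[symmetric])
    then show ?thesis by (simp add: coeff_fourier_series mult.commute)
  qed
  then have "((\<lambda>k. c k * cnj (c k)) has_sum integral {0..1} (\<lambda>x. ?S x * cnj (?S x))) UNIV"
    using fourier_series_integral[of "\<lambda>x. cnj (?S x)"] S by (simp add: continuous_on_cnj)
  then have "((\<lambda>k. Re (c k * cnj (c k))) has_sum Re (integral {0..1} (\<lambda>x. ?S x * cnj (?S x)))) UNIV"
    by (rule has_sum_Re)
  moreover have "integral {0..1} (\<lambda>x. ?S x * cnj (?S x)) = complex_of_real (integral {0..1} (\<lambda>x.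
      (cmod (?S x))\<^sup>2))"
    unfolding complex_norm_square[symmetric]
    by (rule integral_complex_of_real_HK) (intro integrable_continuous_interval continuous_intros S)
  ultimately show ?thesis by (simp add: complex_norm_square[symmetric] complex_mult_cnj cmod_power2)
qed

text \<open>Conjugation sends the term of index k to that of index -k, so it only permutes the
  series.\<close>

lemma fourier_series_real:
  assumes "\<And>k. c (- k) = cnj (c k)"
  shows "complex_of_real (Re (fourier_series c x)) = fourier_series c x"
proof -
  have "((\<lambda>k. cnj (c k * character k x)) has_sum cnj (fourier_series c x)) UNIV"
    using fourier_series_has_sum[of x] by (simp only: has_sum_cnj_iff)
  then have "((\<lambda>k. c (- k) * character (- k) x) has_sum cnj (fourier_series c x)) UNIV"
    by (simp add: assms)
  moreover have "bij (uminus :: int \<Rightarrow> int)" by (simp add: bij_uminus)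
  ultimately have "((\<lambda>k. c k * character k x) has_sum cnj (fourier_series c x)) UNIV"
    using has_sum_reindex_bij_betw[of uminus UNIV UNIV "\<lambda>k. c k * character k x" "cnj
        (fourier_series c x)"] by simp
  then have "cnj (fourier_series c x) = fourier_series c x"
    by (rule has_sum_unique[OF _ fourier_series_has_sum])
  then show ?thesis by (simp add: complex_eq_iff)
qed

end

text \<open>The sum of the series is continuous, periodic and real and has the same coefficients as
  \<open>u\<close>; uniqueness of coefficients identifies the two.\<close>

lemma fourier_inversion:
  assumes u: "continuous_on UNIV (\<lambda>x. u (proj x))" and c: "(\<lambda>k. norm (fourier u k)) summable_on UNIV"
  shows "fourier_series (fourier u) x = complex_of_real (u (proj x))"
proof -
  let ?S = "fourier_series (fourier u)"
  have S: "complex_of_real (Re (?S x)) = ?S x" for x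
    by (rule fourier_series_real[OF c fourier_uminus])
  have "u (proj x) - Re (?S x) = 0"
  proof (rule coeff_unique[where g = "\<lambda>x. u (proj x) - Re (?S x)"])
    show "continuous_on UNIV (\<lambda>x. u (proj x) - Re (?S x))"
      by (intro continuous_intros u fourier_series_continuous c)
    show "coeff (\<lambda>x. complex_of_real (u (proj x) - Re (?S x))) k = 0" for k
      using coeff_diff_real[of "\<lambda>x. complex_of_real (u (proj x))" ?S k] fourier_series_continuous[OF c]
      by (simp add: S coeff_fourier_series[OF c] u continuous_on_of_real flip: fourier_coeff)
  qed (simp add: fourier_series_periodic[OF c])
  then show ?thesis using S[of x] by simp
qed

text \<open>With T the partial sum over F, the pairings of T with itself, of T with f and of f with
  T all equal the sum of the squared coefficients, so nonnegativity of the integral of |f - T|^2 is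
  the claim. Only continuity of f is required, so functions whose series might not converge
  absolutely are covered.\<close>

lemma bessel:
  assumes f: "continuous_on {0..1} f" and F: "finite F"
  shows "(\<Sum>k\<in>F. (cmod (coeff f k))\<^sup>2) \<le> integral {0..1} (\<lambda>x. (cmod (f x))\<^sup>2)"
proof -
  define c where "c = coeff f"
  define T where "T = (\<lambda>x. \<Sum>k\<in>F. c k * character k x)"
  have T: "continuous_on {0..1} T" unfolding T_def by (intro continuous_intros)
  have Tint: "integral {0..1} (\<lambda>x. T x * g x) = (\<Sum>k\<in>F. c k * integral {0..1} (\<lambda>x. character k x * g x))"
    if g: "continuous_on {0..1} g" for g
  proof -
    have "integral {0..1} (\<lambda>x. \<Sum>k\<in>F. c k * (character k x * g x)) =
          (\<Sum>k\<in>F. integral {0..1} (\<lambda>x. c k * (character k x * g x)))"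
      by (intro integral_sum F integrable_continuous_interval continuous_intros g)
    then show ?thesis by (simp add: T_def sum_distrib_right mult.assoc)
  qed
  have cT: "integral {0..1} (\<lambda>x. character k x * cnj (T x)) = cnj (c k)" if "k \<in> F" for k
  proof -
    have "integral {0..1} (\<lambda>x. T x * character (- k) x) = (\<Sum>j\<in>F. c j * (if j = k then 1 else 0))"
      using integral_character by (subst Tint) (auto simp: character_mult intro!:
          continuous_intros sum.cong)
    also have "\<dots> = c k" using that F by (simp add: sum.delta if_distrib cong: if_cong)
    finally have "cnj (integral {0..1} (\<lambda>x. T x * character (- k) x)) = cnj (c k)" by simp
    then show ?thesis by (simp add: Henstock_Kurzweil_Integration.integral_cnj mult.commute)
  qed
  have cf: "integral {0..1} (\<lambda>x. character k x * cnj (f x)) = cnj (c k)" for k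
  proof -
    have "cnj (integral {0..1} (\<lambda>x. f x * character (- k) x)) = cnj (c k)"
        by (simp add: c_def coeff_def)
    then show ?thesis by (simp add: Henstock_Kurzweil_Integration.integral_cnj mult.commute)
  qed
  define N where "N = (\<Sum>k\<in>F. c k * cnj (c k))"
  have TT: "integral {0..1} (\<lambda>x. T x * cnj (T x)) = N"
    unfolding N_def by (subst Tint) (auto intro!: continuous_intros T simp: cT)
  have Tf: "integral {0..1} (\<lambda>x. T x * cnj (f x)) = N"
    unfolding N_def by (subst Tint) (auto intro!: continuous_intros f simp: cf)
  have "cnj N = N" unfolding N_def by (simp add: mult.commute)
  have fT: "integral {0..1} (\<lambda>x. f x * cnj (T x)) = N"
    using arg_cong[OF Tf, of cnj] \<open>cnj N = N\<close> by (simp add: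
        Henstock_Kurzweil_Integration.integral_cnj mult.commute)
  have R: "integral {0..1} (\<lambda>x. complex_of_real ((cmod (g x))\<^sup>2))
      = complex_of_real (integral {0..1} (\<lambda>x. (cmod (g x))\<^sup>2))"
    if "continuous_on {0..1} g" for g :: "real \<Rightarrow> complex"
    by (rule integral_complex_of_real_HK) (intro integrable_continuous_interval continuous_intros that)
  have "complex_of_real (integral {0..1} (\<lambda>x. (cmod (f x - T x))\<^sup>2))
     = integral {0..1} (\<lambda>x. ((f x * cnj (f x) - T x * cnj (f x)) - f x * cnj (T x)) + T x * cnj (T x))"
  proof (subst R[symmetric])
    show "continuous_on {0..1} (\<lambda>x. f x - T x)" by (intro continuous_intros f T)
  qed (intro integral_cong, simp only: complex_norm_square, simp add: algebra_simps)
  also have "\<dots> = integral {0..1} (\<lambda>x. f x * cnj (f x)) - N - N + N"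
  proof -
    have h: "(h has_integral integral {0..1} h) {0..1}" if "continuous_on {0..1} h"
        for h :: "real \<Rightarrow> complex"
      by (intro integrable_integral integrable_continuous_interval that)
    show ?thesis
      using integral_unique[OF has_integral_add[OF has_integral_diff[OF has_integral_diff[OF
          h[of "\<lambda>x. f x * cnj (f x)"] h[of "\<lambda>x. T x * cnj (f x)"]]
          h[of "\<lambda>x. f x * cnj (T x)"]] h[of "\<lambda>x. T x * cnj (T x)"]]]
      by (simp add: Tf fT TT continuous_intros f T)
  qed
  also have "\<dots> = complex_of_real (integral {0..1} (\<lambda>x. (cmod (f x))\<^sup>2)) - N"
    by (subst R[symmetric, OF f]) (simp only: complex_norm_square, simp)
  also have "N = complex_of_real (\<Sum>k\<in>F. (cmod (c k))\<^sup>2)"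
    unfolding N_def of_real_sum by (simp only: complex_norm_square)
  finally have "integral {0..1} (\<lambda>x. (cmod (f x - T x))\<^sup>2)
     = integral {0..1} (\<lambda>x. (cmod (f x))\<^sup>2) - (\<Sum>k\<in>F. (cmod (c k))\<^sup>2)"
    by (simp only: of_real_diff[symmetric] of_real_eq_iff)
  moreover have "0 \<le> integral {0..1} (\<lambda>x. (cmod (f x - T x))\<^sup>2)"
    by (intro integral_nonneg integrable_continuous_interval continuous_intros f T) auto
  ultimately show ?thesis by (simp add: c_def)
qed

section \<open>Sobolev spaces\<close>

text \<open>The Fourier multiplier of A; its powers are the weights of the Sobolev scale.\<close>

definition symbol :: "int \<Rightarrow> real" where
  "symbol k = 1 + (2 * pi * of_int k)\<^sup>2"

text \<open>The sequence whose l^2 norm is the norm of \<open>H^r\<close>. Its l^1 norm is used as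
  well, to control absolute convergence.\<close>

definition weighted :: "real \<Rightarrow> (circle \<Rightarrow> real) \<Rightarrow> int \<Rightarrow> real" where
  "weighted r u k = symbol k powr (r / 2) * cmod (fourier u k)"

text \<open>The circle is a plain quotient type without a topology, so continuity is tested on the
  periodic lift.\<close>

definition cts :: "(circle \<Rightarrow> real) \<Rightarrow> bool" where
  "cts u \<longleftrightarrow> continuous_on UNIV (\<lambda>x. u (proj x))"

lemma symbol_ge_1: "1 \<le> symbol k"
  by (simp add: symbol_def)

lemma symbol_pos: "0 < symbol k"
  using symbol_ge_1[of k] by simp

lemma weighted_nonneg: "0 \<le> weighted r u k"
  by (simp add: weighted_def)

lemma weighted_square: "(weighted r u k)\<^sup>2 = symbol k powr r * (cmod (fourier u k))\<^sup>2"
proof -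
  have "(symbol k powr (r / 2))\<^sup>2 = symbol k powr r"
    by (simp add: power2_eq_square flip: powr_add)
  then show ?thesis by (simp add: weighted_def power_mult_distrib)
qed

lemma sobolev_pts_iff: "u \<in> pts (sobolev r) \<longleftrightarrow> cts u \<and> (\<lambda>k. (weighted r u k)\<^sup>2) summable_on UNIV"
  by (simp add: sobolev_def cts_def weighted_square symbol_def)

lemma sobolev_nrm_eq: "nrm (sobolev r) u = sqrt (\<Sum>\<^sub>\<infinity>k. (weighted r u k)\<^sup>2)"
  by (simp add: sobolev_def weighted_square symbol_def)

lemma sobolev_cts: "u \<in> pts (sobolev r) \<Longrightarrow> cts u"
  by (simp add: sobolev_pts_iff)

lemma sobolev_L2_le:
  assumes "u \<in> pts (sobolev r)" "finite F"
  shows "L2_set (weighted r u) F \<le> nrm (sobolev r) u"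
  unfolding L2_set_def sobolev_nrm_eq
  using assms by (intro real_sqrt_le_mono finite_sum_le_infsum) (auto simp: sobolev_pts_iff)

text \<open>Uniform bounds over finite sets of frequencies give membership and the norm bound
  together. Estimates can thus be made on finite sums, where the triangle inequality for
  \<open>L2_set\<close> is available and no summability has to be known beforehand.\<close>

lemma sobolevI:
  assumes c: "cts u" and C: "\<And>F. finite F \<Longrightarrow> L2_set (weighted r u) F \<le> C"
  shows "u \<in> pts (sobolev r)" "nrm (sobolev r) u \<le> C"
proof -
  have C0: "0 \<le> C" using C[of "{}"] by simp
  have le: "(\<Sum>k\<in>F. (weighted r u k)\<^sup>2) \<le> C\<^sup>2" if "finite F" for F
  proof -
    have "(L2_set (weighted r u) F)\<^sup>2 \<le> C\<^sup>2" by (intro power_mono C that L2_set_nonneg)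
    then show ?thesis by (simp add: L2_set_def sum_nonneg)
  qed
  have s: "(\<lambda>k. (weighted r u k)\<^sup>2) summable_on UNIV"
    using le by (intro nonneg_bdd_above_summable_on) (auto intro!: bdd_aboveI[of _ "C\<^sup>2"])
  then show "u \<in> pts (sobolev r)" using c by (simp add: sobolev_pts_iff)
  have "(\<Sum>\<^sub>\<infinity>k. (weighted r u k)\<^sup>2) \<le> C\<^sup>2"
    using le by (intro infsum_le_finite_sums s) auto
  then show "nrm (sobolev r) u \<le> C"
    unfolding sobolev_nrm_eq using C0 by (intro real_le_lsqrt) auto
qed

lemma cts_add: "cts u \<Longrightarrow> cts v \<Longrightarrow> cts (u + v)"
  by (simp add: cts_def continuous_on_add)

lemma cts_mult: "cts u \<Longrightarrow> cts v \<Longrightarrow> cts (u * v)"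
  by (simp add: cts_def continuous_on_mult)

lemma cts_scale: "cts u \<Longrightarrow> cts (c *\<^sub>R u)"
  by (simp add: cts_def scaleR_fun_def continuous_on_mult)

lemma cts_const: "cts (\<lambda>p. c)"
  by (simp add: cts_def)

lemma cts_coeff_continuous: "cts u \<Longrightarrow> continuous_on S (\<lambda>x. complex_of_real (u (proj x)))"
  unfolding cts_def by (intro continuous_on_of_real) (rule continuous_on_subset, auto)

lemma fourier_add: "cts u \<Longrightarrow> cts v \<Longrightarrow> fourier (u + v) k = fourier u k + fourier v k"
  unfolding fourier_coeff coeff_def
  by (subst integral_add[symmetric])
    (auto intro!: integrable_continuous_interval continuous_on_mult cts_coeff_continuous
      continuous_on_character simp: distrib_right)

lemma fourier_scale: "fourier (c *\<^sub>R u) k = of_real c * fourier u k"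
  unfolding fourier_coeff coeff_def
  by (simp add: scaleR_fun_def mult.assoc)

lemma fourier_const: "fourier (\<lambda>p. c) k = (if k = 0 then of_real c else 0)"
  unfolding fourier_coeff coeff_def using integral_character[of "-k"] by simp

lemma seminormed_sobolev: "seminormed (sobolev r)"
proof
  have z: "fourier 0 k = 0" for k using fourier_scale[of 0 0 k] by simp
  have "cts 0" by (simp add: cts_def)
  then show "0 \<in> pts (sobolev r)" by (simp add: sobolev_pts_iff weighted_def z)
next
  fix u v assume u: "u \<in> pts (sobolev r)" and v: "v \<in> pts (sobolev r)"
  have le: "L2_set (weighted r (u + v)) F \<le> nrm (sobolev r) u + nrm (sobolev r) v"
      if F: "finite F" for F
  proof -
    have "weighted r (u + v) k \<le> weighted r u k + weighted r v k" for k
      unfolding weighted_def fourier_add[OF sobolev_cts[OF u] sobolev_cts[OF v]] distrib_left[symmetric]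
      by (intro mult_left_mono norm_triangle_ineq) auto
    then have "L2_set (weighted r (u + v)) F \<le> L2_set (\<lambda>k. weighted r u k + weighted r v k) F"
      by (intro L2_set_mono weighted_nonneg)
    also have "\<dots> \<le> L2_set (weighted r u) F + L2_set (weighted r v) F" by (rule L2_set_triangle_ineq)
    also have "\<dots> \<le> nrm (sobolev r) u + nrm (sobolev r) v" by (intro add_mono sobolev_L2_le u v F)
    finally show ?thesis .
  qed
  show "u + v \<in> pts (sobolev r)" "nrm (sobolev r) (u + v) \<le> nrm (sobolev r) u + nrm (sobolev r) v"
    by (rule sobolevI[OF cts_add[OF sobolev_cts[OF u] sobolev_cts[OF v]] le], assumption)+
next
  fix u :: "circle \<Rightarrow> real" and c assume u: "u \<in> pts (sobolev r)"
  have "weighted r (c *\<^sub>R u) = (\<lambda>k. \<bar>c\<bar> * weighted r u k)"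
    by (simp add: weighted_def fourier_scale norm_mult fun_eq_iff)
  then have sq: "(\<lambda>k. (weighted r (c *\<^sub>R u) k)\<^sup>2) = (\<lambda>k. c\<^sup>2 * (weighted r u k)\<^sup>2)"
    by (simp add: power_mult_distrib)
  show "c *\<^sub>R u \<in> pts (sobolev r)"
    using u unfolding sobolev_pts_iff sq by (auto intro: cts_scale summable_on_cmult_right)
  show "nrm (sobolev r) (c *\<^sub>R u) = \<bar>c\<bar> * nrm (sobolev r) u"
    unfolding sobolev_nrm_eq sq by (simp add: infsum_cmult_right' real_sqrt_mult)
next
  fix u assume u: "u \<in> pts (sobolev r)"
  show "0 \<le> nrm (sobolev r) u" by (simp add: sobolev_nrm_eq infsum_nonneg)
qed

lemma sobolev_const: "(\<lambda>p. c) \<in> pts (sobolev r)" "nrm (sobolev r) (\<lambda>p. c) \<le> \<bar>c\<bar>"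
proof -
  have le: "L2_set (weighted r (\<lambda>p. c)) F \<le> \<bar>c\<bar>" if F: "finite F" for F
  proof -
    have "L2_set (weighted r (\<lambda>p. c)) F \<le> (\<Sum>k\<in>F. weighted r (\<lambda>p. c) k)"
      by (rule L2_set_le_sum) (simp add: weighted_nonneg)
    also have "\<dots> = (\<Sum>k\<in>F. if k = 0 then \<bar>c\<bar> else 0)"
      by (intro sum.cong) (auto simp: weighted_def fourier_const symbol_def)
    also have "\<dots> \<le> \<bar>c\<bar>" using F by simp
    finally show ?thesis .
  qed
  show "(\<lambda>p. c) \<in> pts (sobolev r)" "nrm (sobolev r) (\<lambda>p. c) \<le> \<bar>c\<bar>"
    by (rule sobolevI[OF cts_const le], assumption)+
qed

lemma sobolev_one: "1 \<in> pts (sobolev r)"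
  using sobolev_const(1)[of 1 r] by (simp add: one_fun_def)

lemma sobolev_mono:
  assumes "t \<le> r" "u \<in> pts (sobolev r)"
  shows "u \<in> pts (sobolev t)" "nrm (sobolev t) u \<le> nrm (sobolev r) u"
proof -
  have le: "L2_set (weighted t u) F \<le> nrm (sobolev r) u" if F: "finite F" for F
  proof -
    have "weighted t u k \<le> weighted r u k" for k
      unfolding weighted_def using assms(1) symbol_ge_1[of k] by (intro mult_right_mono powr_mono) auto
    then have "L2_set (weighted t u) F \<le> L2_set (weighted r u) F"
      by (intro L2_set_mono weighted_nonneg)
    with sobolev_L2_le[OF assms(2) F] show ?thesis by simp
  qed
  show "u \<in> pts (sobolev t)" "nrm (sobolev t) u \<le> nrm (sobolev r) u"
    by (rule sobolevI[OF sobolev_cts[OF assms(2)] le], assumption)+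
qed

section \<open>Embeddings and products in Sobolev spaces\<close>

lemma symbol_summable:
  assumes "r > 1/2"
  shows "(\<lambda>k. symbol k powr (- r)) summable_on UNIV"
proof -
  have n: "(\<lambda>n. symbol (int n) powr (- r)) summable_on UNIV"
  proof -
    \<comment> \<open>The comparison series: \<open>symbol (int n)\<close> is at least n^2, and 2 r
      > 1.\<close>
    have "summable (\<lambda>n. real n powr (- (2 * r)))" using assms by (simp add: summable_real_powr_iff)
    then have "summable (\<lambda>n. symbol (int n) powr (- r))"
    proof (rule summable_comparison_test_ev[rotated])
      have "norm (symbol (int n) powr (- r)) \<le> real n powr (- (2 * r))" if "n \<ge> 1" for n
      proof -
        have "(real n)\<^sup>2 \<le> symbol (int n)"
        proof -
          have "1 * real n \<le> (2 * pi) * real n" using pi_ge_two by (intro mult_right_mono) auto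
          then have "(real n)\<^sup>2 \<le> (2 * pi * real n)\<^sup>2" by (intro power_mono) auto
          then have "(real n)\<^sup>2 \<le> 1 + (2 * pi * real n)\<^sup>2" by linarith
          then show ?thesis by (simp add: symbol_def)
        qed
        then have "symbol (int n) powr (- r) \<le> ((real n)\<^sup>2) powr (- r)"
          using that assms by (intro powr_mono2') auto
        also have "\<dots> = real n powr (- (2 * r))"
          using that by (simp add: powr_powr flip: powr_numeral)
        finally show ?thesis by simp
      qed
      then show "\<forall>\<^sub>F n in sequentially. norm (symbol (int n) powr (- r)) \<le> real n powr (- (2 * r))"
        unfolding eventually_sequentially by blast
    qed
    then show ?thesis by (intro norm_summable_imp_summable_on) simp
  qed
  have p: "(\<lambda>k. symbol k powr (- r)) summable_on range int"
    using n by (subst summable_on_reindex) (auto simp: o_def)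
  have m: "(\<lambda>k. symbol k powr (- r)) summable_on range (\<lambda>n. - int n)"
    using n by (subst summable_on_reindex) (auto simp: o_def inj_def symbol_def)
  have "(\<lambda>k. symbol k powr (- r)) summable_on (range int \<union> range (\<lambda>n. - int n))"
    by (rule summable_on_union[OF p m])
  moreover have "range int \<union> range (\<lambda>n. - int n) = UNIV"
  proof -
    have "k \<in> range int \<union> range (\<lambda>n. - int n)" for k :: int
      by (cases k rule: int_cases2) auto
    then show ?thesis by blast
  qed
  ultimately show ?thesis by simp
qed

text \<open>Cauchy-Schwarz against the square-summable weights
  \<open>symbol k powr (- (r - a) / 2)\<close>. This is the Sobolev embedding on the Fourier side: a
  = 0 yields an absolutely convergent series, a = 1 an absolutely convergent series for the
  derivative.\<close>

lemma sobolev_l1: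
  assumes "r > a + 1/2"
  obtains Z where "0 \<le> Z" "\<And>u F. u \<in> pts (sobolev r) \<Longrightarrow> finite F \<Longrightarrow>
    (\<Sum>k\<in>F. weighted a u k) \<le> Z * nrm (sobolev r) u"
proof
  let ?Z = "sqrt (\<Sum>\<^sub>\<infinity>k. symbol k powr (- (r - a)))"
  have s: "(\<lambda>k. symbol k powr (- (r - a))) summable_on UNIV" using assms by (intro symbol_summable) simp
  show "0 \<le> ?Z" by (simp add: infsum_nonneg)
  fix u F assume u: "u \<in> pts (sobolev r)" and F: "finite (F :: int set)"
  have eq: "weighted a u k = \<bar>symbol k powr (- (r - a) / 2)\<bar> * \<bar>weighted r u k\<bar>" for k
    by (simp add: weighted_def abs_mult mult.assoc[symmetric] diff_divide_distrib flip: powr_add)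
  have "(\<Sum>k\<in>F. weighted a u k) \<le> L2_set (\<lambda>k. symbol k powr (- (r - a) / 2)) F * L2_set (weighted r u) F"
    unfolding eq by (rule L2_set_mult_ineq)
  also have "\<dots> \<le> ?Z * nrm (sobolev r) u"
  proof (intro mult_mono sobolev_L2_le u F L2_set_nonneg)
    have "(symbol k powr (- (r - a) / 2))\<^sup>2 = symbol k powr (- (r - a))" for k
      by (simp add: power2_eq_square flip: powr_add)
    then show "L2_set (\<lambda>k. symbol k powr (- (r - a) / 2)) F \<le> ?Z"
      unfolding L2_set_def using finite_sum_le_infsum[OF s F] by simp
  qed (simp add: infsum_nonneg)
  finally show "(\<Sum>k\<in>F. weighted a u k) \<le> ?Z * nrm (sobolev r) u" .
qed

lemma sobolev_weighted_summable:
  assumes "r > a + 1/2" "u \<in> pts (sobolev r)"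
  shows "weighted a u summable_on UNIV"
proof -
  obtain Z where "0 \<le> Z" "\<And>u F. u \<in> pts (sobolev r) \<Longrightarrow> finite F \<Longrightarrow>
    (\<Sum>k\<in>F. weighted a u k) \<le> Z * nrm (sobolev r) u"
    by (rule sobolev_l1[OF assms(1)], rule that)
  then show ?thesis using assms(2)
    by (intro nonneg_bdd_above_summable_on) (auto intro!: bdd_aboveI[of _ "Z * nrm (sobolev r) u"]
        weighted_nonneg)
qed

lemma weighted_0: "weighted 0 u k = cmod (fourier u k)"
  using symbol_pos[of k] by (simp add: weighted_def)

lemma sobolev_abs_summable:
  assumes "r > 1/2" "u \<in> pts (sobolev r)"
  shows "(\<lambda>k. norm (fourier u k)) summable_on UNIV"
  using sobolev_weighted_summable[of 0 r u] assms by (simp add: weighted_0[abs_def])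

lemma sobolev_fourier_series:
  assumes "r > 1/2" "u \<in> pts (sobolev r)"
  shows "fourier_series (fourier u) x = complex_of_real (u (proj x))"
  using sobolev_cts[OF assms(2)] by (intro fourier_inversion sobolev_abs_summable[OF assms]) (simp
      add: cts_def)

text \<open>From k = (k - j) + j the symbol of k is at most four times the larger of the two
  symbols. In a convolution this places the weight on one factor at a time.\<close>

lemma symbol_powr_subadd:
  assumes "0 \<le> r"
  shows "symbol k powr (r / 2) \<le> 4 powr (r / 2) * (symbol (k - j) powr (r / 2) + symbol j powr (r / 2))"
proof -
  let ?m = "max (symbol (k - j)) (symbol j)"
  have "0 \<le> (of_int (k - j) - of_int j :: real)\<^sup>2" by simp
  then have "(of_int k)\<^sup>2 \<le> 2 * ((of_int (k - j) :: real)\<^sup>2 + (of_int j)\<^sup>2)"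
    by (simp add: power2_eq_square algebra_simps)
  then have "(2 * pi)\<^sup>2 * (of_int k)\<^sup>2 \<le> (2 * pi)\<^sup>2 * (2 * ((of_int (k - j) :: real)\<^sup>2 + (of_int j)\<^sup>2))"
    by (intro mult_left_mono) auto
  then have "symbol k \<le> 2 * (symbol (k - j) + symbol j)"
    unfolding symbol_def power_mult_distrib[of "2 * pi"]
    by (simp only: distrib_left mult.left_commute[of _ 2] mult_1_right)
  also have "\<dots> \<le> 4 * ?m" by simp
  finally have "symbol k powr (r / 2) \<le> (4 * ?m) powr (r / 2)"
    using assms symbol_pos[of k] by (intro powr_mono2) auto
  also have "\<dots> = 4 powr (r / 2) * ?m powr (r / 2)" using symbol_pos
      by (simp add: powr_mult less_imp_le max_def)
  also have "\<dots> \<le> 4 powr (r / 2) * (symbol (k - j) powr (r / 2) + symbol j powr (r / 2))"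
    by (intro mult_left_mono) (auto simp: max_def)
  finally show ?thesis .
qed

lemma L2_set_sum_le: "finite J \<Longrightarrow> L2_set (\<lambda>k. \<Sum>j\<in>J. f j k) F \<le> (\<Sum>j\<in>J. L2_set (f j) F)"
proof (induction J rule: finite_induct)
  case empty
  then show ?case by (simp add: L2_set_def)
next
  case (insert j J)
  then show ?case using L2_set_triangle_ineq[of "f j" "\<lambda>k. \<Sum>j\<in>J. f j k" F] by simp
qed

text \<open>A convolution is a combination of translates of \<open>a\<close> with weights
  \<open>b\<close>; translation preserves the l^2 bound, and the triangle inequality leaves the l^1
  bound of the weights.\<close>

lemma young_convolution:
  fixes a b :: "int \<Rightarrow> real"
  assumes a: "\<And>G. finite G \<Longrightarrow> L2_set a G \<le> A" and b: "\<And>j. 0 \<le> b j" and B: "sum b J \<le> B"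
    and F: "finite F" and J: "finite J"
  shows "L2_set (\<lambda>k. \<Sum>j\<in>J. b j * a (k - j)) F \<le> B * A"
proof -
  have "L2_set (\<lambda>k. b j * a (k - j)) F \<le> b j * A" for j
  proof -
    have "L2_set (\<lambda>k. b j * a (k - j)) F = b j * L2_set (\<lambda>k. a (k - j)) F"
      by (simp add: L2_set_right_distrib b)
    also have "L2_set (\<lambda>k. a (k - j)) F = L2_set a ((\<lambda>k. k - j) ` F)"
      unfolding L2_set_def by (subst sum.reindex) (auto simp: inj_on_def)
    finally show ?thesis using a[of "(\<lambda>k. k - j) ` F"] F by (auto intro: mult_left_mono b)
  qed
  then have "(\<Sum>j\<in>J. L2_set (\<lambda>k. b j * a (k - j)) F) \<le> sum b J * A"
    by (simp add: sum_distrib_right sum_mono)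
  with L2_set_sum_le[OF J, of "\<lambda>j k. b j * a (k - j)" F]
  have "L2_set (\<lambda>k. \<Sum>j\<in>J. b j * a (k - j)) F \<le> sum b J * A" by linarith
  also have "\<dots> \<le> B * A" using B a[of "{}"] by (intro mult_right_mono) auto
  finally show ?thesis .
qed

text \<open>Only \<open>v\<close> is expanded into its series, which is then integrated termwise
  against the continuous function \<open>u\<close> times a character.\<close>

lemma fourier_mult:
  assumes "r > 1/2" and u: "cts u" and v: "v \<in> pts (sobolev r)"
  shows "((\<lambda>j. fourier v j * fourier u (k - j)) has_sum fourier (u * v) k) UNIV"
proof -
  let ?G = "\<lambda>x. complex_of_real (u (proj x)) * character (- k) x"
  have G: "continuous_on {0..1} ?G" by (intro continuous_intros cts_coeff_continuous u)
  have 1: "integral {0..1} (\<lambda>x. character j x * ?G x) = fourier u (k - j)" for j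
    unfolding fourier_coeff coeff_def
    by (intro integral_cong) (simp add: mult_ac character_mult)
  have 2: "integral {0..1} (\<lambda>x. fourier_series (fourier v) x * ?G x) = fourier (u * v) k"
    unfolding fourier_coeff[of "u * v"] coeff_def[of "\<lambda>x. complex_of_real ((u * v) (proj x))"]
    by (intro integral_cong) (simp add: sobolev_fourier_series[OF assms(1) v] mult_ac)
  show ?thesis
    using fourier_series_integral[OF sobolev_abs_summable[OF assms(1) v] G] by (simp only: 1 2)
qed

text \<open>The weight is distributed over the two factors. Each resulting sum convolves an
  unweighted l^1 sequence, available because r > 1/2, with a weighted l^2 sequence, so Young's
  inequality bounds it.\<close>

lemma sobolev_algebra:
  assumes r: "r > 1/2"
  obtains K where "0 \<le> K" "\<And>u v. u \<in> pts (sobolev r) \<Longrightarrow> v \<in> pts (sobolev r) \<Longrightarrow> u * v \<in> pts (sobolev r)"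
    "\<And>u v. u \<in> pts (sobolev r) \<Longrightarrow> v \<in> pts (sobolev r) \<Longrightarrow>
      nrm (sobolev r) (u * v) \<le> K * nrm (sobolev r) u * nrm (sobolev r) v"
proof -
  have r0: "r > 0 + 1/2" using r by simp
  obtain Z where Z: "0 \<le> Z" "\<And>u F. u \<in> pts (sobolev r) \<Longrightarrow> finite F \<Longrightarrow>
    (\<Sum>k\<in>F. weighted 0 u k) \<le> Z * nrm (sobolev r) u"
    by (rule sobolev_l1[OF r0], rule that)
  define K where "K = 4 powr (r / 2) * (2 * Z)"
  have main: "L2_set (weighted r (u * v)) F \<le> K * nrm (sobolev r) u * nrm (sobolev r) v"
    if u: "u \<in> pts (sobolev r)" and v: "v \<in> pts (sobolev r)" and F: "finite F" for u v F
  proof -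
    let ?S = "\<lambda>J k. \<Sum>j\<in>J. fourier v j * fourier u (k - j)"
    \<comment> \<open>The convolution is truncated to a finite set \<open>J\<close> and bounded
      uniformly in \<open>J\<close>; the bound survives the limit because \<open>F\<close> is
      finite.\<close>
    have lim: "((\<lambda>J. L2_set (\<lambda>k. symbol k powr (r / 2) * cmod (?S J k)) F) \<longlongrightarrow> L2_set (weighted r (u
        * v)) F)
        (finite_subsets_at_top UNIV)"
      unfolding L2_set_def weighted_def
      using fourier_mult[OF r sobolev_cts[OF u] v] unfolding has_sum_def
      by (intro tendsto_intros)
    have bound: "L2_set (\<lambda>k. symbol k powr (r / 2) * cmod (?S J k)) F
        \<le> K * nrm (sobolev r) u * nrm (sobolev r) v"
      if J: "finite J" for J
    proof -
      let ?w = "4 powr (r / 2) :: real"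
      \<comment> \<open>The substitution i = k - j produces an index set depending on k. It is
        enlarged to \<open>I\<close>, which serves all k in \<open>F\<close> at once, as Young's
        inequality requires; the added terms are nonnegative.\<close>
      define I where "I = (\<lambda>(k, j). k - j) ` (F \<times> J)"
      have I: "finite I" unfolding I_def using F J by blast
      have "symbol k powr (r / 2) * cmod (?S J k) \<le>
          ?w * ((\<Sum>j\<in>J. weighted 0 v j * weighted r u (k - j))
              + (\<Sum>j\<in>I. weighted 0 u j * weighted r v (k - j)))"
        if k: "k \<in> F" for k
      proof -
        have "symbol k powr (r / 2) * cmod (?S J k) \<le> symbol k powr (r / 2) * (\<Sum>j\<in>J. cmod (fourier
            v j) * cmod (fourier u (k - j)))"
          by (intro mult_left_mono order.trans[OF norm_sum]) (simp_all add: norm_mult)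
        also have "\<dots> = (\<Sum>j\<in>J. symbol k powr (r / 2) * (cmod (fourier v j) * cmod (fourier u (k - j))))"
          by (rule sum_distrib_left)
        also have "\<dots> \<le> (\<Sum>j\<in>J. (?w * (symbol (k - j) powr (r / 2)
            + symbol j powr (r / 2))) * (cmod (fourier v j) * cmod (fourier u (k - j))))"
          using r by (intro sum_mono mult_right_mono symbol_powr_subadd) auto
        also have "\<dots> = ?w * ((\<Sum>j\<in>J. weighted 0 v j * weighted r u (k - j))
            + (\<Sum>j\<in>J. weighted 0 u (k - j) * weighted r v j))"
          by (simp add: weighted_0) (simp add: weighted_def sum_distrib_left
              sum.distrib[symmetric] algebra_simps)
        also have "(\<Sum>j\<in>J. weighted 0 u (k - j) * weighted r v j)
            = (\<Sum>i\<in>(\<lambda>j. k - j) ` J. weighted 0 u i * weighted r v (k - i))"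
          by (subst sum.reindex) (auto simp: inj_on_def)
        also have "\<dots> \<le> (\<Sum>i\<in>I. weighted 0 u i * weighted r v (k - i))"
          using k by (intro sum_mono2 I) (auto simp: I_def weighted_nonneg)
        finally show ?thesis by (simp add: mult_left_mono)
      qed
      then have "L2_set (\<lambda>k. symbol k powr (r / 2) * cmod (?S J k)) F \<le>
         L2_set (\<lambda>k. ?w * ((\<Sum>j\<in>J. weighted 0 v j * weighted r u (k - j))
             + (\<Sum>j\<in>I. weighted 0 u j * weighted r v (k - j)))) F"
        by (intro L2_set_mono) auto
      also have "\<dots> = ?w * L2_set (\<lambda>k. (\<Sum>j\<in>J. weighted 0 v j * weighted r u (k - j))
          + (\<Sum>j\<in>I. weighted 0 u j * weighted r v (k - j))) F"
        by (simp add: L2_set_right_distrib)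
      also have "\<dots> \<le> ?w * ((Z * nrm (sobolev r) v) * nrm (sobolev r) u
          + (Z * nrm (sobolev r) u) * nrm (sobolev r) v)"
        by (intro mult_left_mono order.trans[OF L2_set_triangle_ineq] add_mono young_convolution F J I
            sobolev_L2_le u v weighted_nonneg Z) auto
      finally show ?thesis by (simp add: K_def algebra_simps)
    qed
    show ?thesis
      by (rule tendsto_upperbound[OF lim]) (auto intro!: eventually_finite_subsets_at_top_weakI bound)
  qed
  show thesis
  proof (rule that)
    show "0 \<le> K" using Z by (simp add: K_def)
    show "u * v \<in> pts (sobolev r)" "nrm (sobolev r) (u * v) \<le> K * nrm (sobolev r) u * nrm (sobolev r) v"
      if "u \<in> pts (sobolev r)" "v \<in> pts (sobolev r)" for u v
      by (rule sobolevI[OF cts_mult[OF sobolev_cts[OF that(1)] sobolev_cts[OF that(2)]] main[OF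
          that]], assumption)+
  qed
qed

lemma sobolev_mult_mem: "r > 1/2 \<Longrightarrow> u \<in> pts (sobolev r) \<Longrightarrow> v \<in> pts (sobolev r) \<Longrightarrow> u * v \<in> pts (sobolev r)"
  by (rule sobolev_algebra[of r]) auto

lemma bounded_bilinear_sobolev_mult:
  assumes "1/2 < t" "t \<le> r" "t \<le> q"
  shows "bounded_bilinear_nspace (sobolev r) (sobolev q) (sobolev t) (*)"
proof -
  obtain K where K: "0 \<le> K" "\<And>u v. u \<in> pts (sobolev t) \<Longrightarrow> v \<in> pts (sobolev t) \<Longrightarrow> u * v \<in> pts (sobolev t)"
    "\<And>u v. u \<in> pts (sobolev t) \<Longrightarrow> v \<in> pts (sobolev t) \<Longrightarrow>
      nrm (sobolev t) (u * v) \<le> K * nrm (sobolev t) u * nrm (sobolev t) v"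
    by (rule sobolev_algebra[OF assms(1)], rule that)
  have bd: "nrm (sobolev t) (u * v) \<le> K * nrm (sobolev r) u * nrm (sobolev q) v"
    if u: "u \<in> pts (sobolev r)" and v: "v \<in> pts (sobolev q)" for u v
  proof -
    note u' = sobolev_mono[OF assms(2) u] and v' = sobolev_mono[OF assms(3) v]
    have "nrm (sobolev t) (u * v) \<le> K * nrm (sobolev t) u * nrm (sobolev t) v"
      by (rule K(3)[OF u'(1) v'(1)])
    also have "\<dots> \<le> K * nrm (sobolev r) u * nrm (sobolev q) v"
      using K(1) u' v' seminormed.nrm_ge0[OF seminormed_sobolev] u
      by (intro mult_mono mult_nonneg_nonneg) auto
    finally show ?thesis .
  qed
  have mem: "u * v \<in> pts (sobolev t)" if "u \<in> pts (sobolev r)" "v \<in> pts (sobolev q)" for u v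
    by (rule K(2)[OF sobolev_mono(1)[OF assms(2) that(1)] sobolev_mono(1)[OF assms(3) that(2)]])
  show ?thesis unfolding bounded_bilinear_nspace_def
  proof (intro conjI ballI allI)
    show "\<exists>C. \<forall>u\<in>pts (sobolev r). \<forall>v\<in>pts (sobolev q). nrm (sobolev t) (u * v)
        \<le> C * nrm (sobolev r) u * nrm (sobolev q) v"
      using bd by (intro exI[of _ K]) auto
  qed (simp_all add: mem distrib_left distrib_right, simp_all add: fun_eq_iff scaleR_fun_def)
qed

section \<open>Derivatives\<close>

text \<open>\<open>Dx\<close> is total because \<open>deriv\<close> is; \<open>C1\<close> guarantees
  that it is the true derivative, and a continuous one.\<close>

definition C1 :: "(circle \<Rightarrow> real) \<Rightarrow> bool" where
  "C1 u \<longleftrightarrow> (\<forall>x. ((\<lambda>x. u (proj x)) has_real_derivative Dx u (proj x)) (at x)) \<and> cts (Dx u)"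

text \<open>A derivative \<open>g\<close> computed on the line is periodic by uniqueness of
  derivatives, hence agrees with \<open>Dx u\<close>, which is evaluated at a chosen
  representative.\<close>

lemma C1I:
  assumes d: "\<And>x. ((\<lambda>x. u (proj x)) has_real_derivative g x) (at x)" and g: "continuous_on UNIV g"
  shows "C1 u" "Dx u (proj x) = g x"
proof -
  have p: "g (x + 1) = g x" for x
  proof -
    have "((\<lambda>x. u (proj (x + 1))) has_real_derivative g (x + 1)) (at x)"
      using d[of "x + 1"] by (subst (asm) DERIV_shift)
    then have "((\<lambda>x. u (proj x)) has_real_derivative g (x + 1)) (at x)" by simp
    then show ?thesis using d[of x] DERIV_unique by blast
  qed
  have Dx: "Dx u (proj x) = g x" for x
    using periodic_rep_circle[of g, OF p] DERIV_imp_deriv[OF d] by (simp add: Dx_def)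
  then show "Dx u (proj x) = g x" .
  show "C1 u" using d g by (simp add: C1_def cts_def Dx)
qed

lemma C1_deriv: "C1 u \<Longrightarrow> ((\<lambda>x. u (proj x)) has_real_derivative Dx u (proj x)) (at x)"
  by (simp add: C1_def)

lemma C1_cts: "C1 u \<Longrightarrow> cts u"
  unfolding cts_def by (intro DERIV_continuous_on) (auto intro: has_field_derivative_at_within C1_deriv)

lemma C1_cts_Dx: "C1 u \<Longrightarrow> cts (Dx u)"
  by (simp add: C1_def)

lemma fourier_Dx:
  assumes "C1 u"
  shows "fourier (Dx u) k = 2 * of_real pi * of_int k * \<i> * fourier u k"
  unfolding fourier_coeff
proof (rule coeff_deriv)
  show "((\<lambda>x. complex_of_real (u (proj x))) has_vector_derivative complex_of_real (Dx u (proj x)))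
      (at x)" for x
    by (rule has_vector_derivative_of_real[OF C1_deriv[OF assms]])
  show "continuous_on UNIV (\<lambda>x. complex_of_real (Dx u (proj x)))"
    by (rule cts_coeff_continuous[OF C1_cts_Dx[OF assms]])
  show "complex_of_real (u (proj 1)) = complex_of_real (u (proj 0))"
    using proj_add_1[of 0] by simp
qed

lemma C1_rules:
  assumes u: "C1 u" and v: "C1 v"
  shows "C1 (u + v)" "Dx (u + v) = Dx u + Dx v"
    "C1 (u * v)" "Dx (u * v) = Dx u * v + u * Dx v"
proof -
  have "((\<lambda>x. (u + v) (proj x)) has_real_derivative (Dx u + Dx v) (proj x)) (at x)" for x
    by (auto intro!: derivative_eq_intros C1_deriv u v)
  moreover have "continuous_on UNIV (\<lambda>x. (Dx u + Dx v) (proj x))"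
    using cts_add[OF C1_cts_Dx[OF u] C1_cts_Dx[OF v]] by (simp add: cts_def)
  ultimately show "C1 (u + v)" "Dx (u + v) = Dx u + Dx v"
    by (rule C1I(1), intro circle_ext C1I(2)[of "u + v" "\<lambda>x. (Dx u + Dx v) (proj x)"])
  have "((\<lambda>x. (u * v) (proj x)) has_real_derivative (Dx u * v + u * Dx v) (proj x)) (at x)" for x
    by (auto intro!: derivative_eq_intros C1_deriv u v)
  moreover have "continuous_on UNIV (\<lambda>x. (Dx u * v + u * Dx v) (proj x))"
    using cts_add[OF cts_mult[OF C1_cts_Dx[OF u] C1_cts[OF v]] cts_mult[OF C1_cts[OF u]
        C1_cts_Dx[OF v]]] by (simp add: cts_def)
  ultimately show "C1 (u * v)" "Dx (u * v) = Dx u * v + u * Dx v"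
    by (rule C1I(1), intro circle_ext C1I(2)[of "u * v" "\<lambda>x. (Dx u * v + u * Dx v) (proj x)"])
qed

lemma C1_compose:
  assumes u: "C1 u" and f: "\<And>p. (f has_real_derivative f' (u p)) (at (u p))"
    and c: "cts (\<lambda>p. f' (u p))"
  shows "C1 (\<lambda>p. f (u p))" "Dx (\<lambda>p. f (u p)) = (\<lambda>p. f' (u p)) * Dx u"
proof -
  have d: "((\<lambda>x. f (u (proj x))) has_real_derivative ((\<lambda>p. f' (u p)) * Dx u) (proj x)) (at x)" for x
    using DERIV_chain2[OF f[of "proj x"] C1_deriv[OF u, of x]] by simp
  have "continuous_on UNIV (\<lambda>x. ((\<lambda>p. f' (u p)) * Dx u) (proj x))"
    using cts_mult[OF c C1_cts_Dx[OF u]] by (simp add: cts_def)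
  with d show "C1 (\<lambda>p. f (u p))" "Dx (\<lambda>p. f (u p)) = (\<lambda>p. f' (u p)) * Dx u"
    by (rule C1I(1), intro circle_ext C1I(2)[of "\<lambda>p. f (u p)" "\<lambda>x. ((\<lambda>p. f' (u p)) * Dx u) (proj x)"])
qed

lemma C1_const: "C1 (\<lambda>p. c)" "Dx (\<lambda>p. c) = 0"
proof -
  show "C1 (\<lambda>p. c)" by (rule C1I(1)[where g = "\<lambda>x. 0"]) auto
  show "Dx (\<lambda>p. c) = 0" by (intro circle_ext) (simp add: C1I(2)[where g = "\<lambda>x. 0"])
qed

lemma cts_bounded:
  assumes "cts u"
  obtains M where "0 \<le> M" "\<And>p. \<bar>u p\<bar> \<le> M"
proof -
  have "bounded ((\<lambda>x. u (proj x)) ` {0..1})"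
    using assms unfolding cts_def by (intro compact_imp_bounded compact_continuous_image) (rule
        continuous_on_subset, auto)
  then obtain M where M: "\<And>x. x \<in> {0..1} \<Longrightarrow> \<bar>u (proj x)\<bar> \<le> M"
    unfolding bounded_iff real_norm_def by blast
  have le: "\<bar>u p\<bar> \<le> M" for p
  proof -
    have "u p = u (proj (frac (rep_circle p)))"
      using periodic_Ints[of "\<lambda>x. u (proj x)" "rep_circle p" "frac (rep_circle p)"]
          by (simp add: frac_def)
    then show ?thesis using M[of "frac (rep_circle p)"] frac_lt_1[of "rep_circle p"] by simp
  qed
  show thesis by (rule that[OF _ le]) (use le[of undefined] in linarith)
qed

lemma cts_inverse:
  assumes "cts u" "\<And>p. u p \<noteq> 0"
  shows "cts (\<lambda>p. inverse (u p))"
  using assms unfolding cts_def by (intro continuous_on_inverse) auto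

section \<open>The resolvents of the derivative\<close>

text \<open>\<open>resolvent \<sigma>\<close> is \<open>(1 + \<sigma> \<partial>\<^sub>x)\<^sup>-\<^sup>1\<close>, used for \<open>\<sigma> = \<plusminus>1\<close>: the two factors of \<open>A\<^sup>-\<^sup>1\<close>.\<close>

definition resolvent :: "real \<Rightarrow> (circle \<Rightarrow> real) \<Rightarrow> circle \<Rightarrow> real" where
  "resolvent \<sigma> g = (SOME z. C1 z \<and> z + \<sigma> *\<^sub>R Dx z = g)"

lemma continuous_antiderivative:
  assumes "\<And>x. isCont f (x :: real)"
  obtains F where "\<And>x. (F has_real_derivative f x) (at x)"
proof -
  have "\<exists>F. \<forall>x :: real. -\<infinity> < ereal x \<longrightarrow> ereal x < \<infinity> \<longrightarrow> (F has_vector_derivative f x) (at x)"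
    by (rule einterval_antiderivative) (auto intro: assms)
  then obtain F where "\<And>x. (F has_real_derivative f x) (at x)"
    by (auto simp: has_real_derivative_iff_has_vector_derivative)
  then show thesis by (rule that)
qed

text \<open>Variation of constants: with F an antiderivative of exp(\<sigma> y) g, every function
  exp(-\<sigma> x) (a + \<sigma> F x) solves the equation, because \<sigma>^2 = 1, and one value of
  a makes it periodic.\<close>

lemma resolvent_exists:
  assumes s: "\<sigma> = 1 \<or> \<sigma> = - 1" and g: "cts g"
  shows "\<exists>z. C1 z \<and> z + \<sigma> *\<^sub>R Dx z = g"
proof -
  let ?f = "\<lambda>y. exp (\<sigma> * y) * g (proj y)"
  have gc: "continuous_on UNIV (\<lambda>x. g (proj x))" using g by (simp add: cts_def)
  have fc: "isCont ?f x" for x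
    using gc by (intro continuous_intros) (simp add: continuous_on_eq_continuous_at)
  obtain F where F: "\<And>x. (F has_real_derivative ?f x) (at x)"
    by (rule continuous_antiderivative[of ?f, OF fc], rule that)
  define b where "b = F 1 - exp \<sigma> * F 0"
  have "((\<lambda>x. F (x + 1) - exp \<sigma> * F x) has_real_derivative 0) (at x)" for x
  proof -
    have "((\<lambda>x. F (x + 1)) has_real_derivative ?f (x + 1)) (at x)"
      using F[of "x + 1"] by (subst (asm) DERIV_shift)
    then show ?thesis
      by (auto intro!: derivative_eq_intros F simp: exp_add distrib_left)
  qed
  then have c0: "F (x + 1) - exp \<sigma> * F x = F (0 + 1) - exp \<sigma> * F 0" for x :: real
    using DERIV_isconst_all[of "\<lambda>x. F (x + 1) - exp \<sigma> * F x"] by blast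
  have F1: "F (x + 1) = exp \<sigma> * F x + b" for x
    using c0[of x] by (simp add: b_def algebra_simps)
  \<comment> \<open>Since F(x + 1) = exp \<sigma> F(x) + b, periodicity amounts to a + \<sigma> b =
    exp \<sigma> a, solvable because exp \<sigma> differs from 1.\<close>
  define a where "a = \<sigma> * b / (exp \<sigma> - 1)"
  have e: "exp \<sigma> \<noteq> 1" using s by auto
  define Z where "Z = (\<lambda>x. exp (- \<sigma> * x) * (a + \<sigma> * F x))"
  have Zp: "Z (x + 1) = Z x" for x
  proof -
    have "Z (x + 1) = exp (- \<sigma> * x) * (exp (- \<sigma>) * (a + \<sigma> * (exp \<sigma> * F x + b)))"
      unfolding Z_def F1 by (simp add: distrib_left exp_diff exp_minus field_simps)
    also have "exp (- \<sigma>) * (a + \<sigma> * (exp \<sigma> * F x + b)) = a + \<sigma> * F x"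
    proof -
      have "a + \<sigma> * b = exp \<sigma> * a" using e by (simp add: a_def field_simps)
      then have "a + \<sigma> * (exp \<sigma> * F x + b) = exp \<sigma> * (a + \<sigma> * F x)" by (simp add: algebra_simps)
      then show ?thesis by (simp add: mult.assoc[symmetric] flip: exp_add)
    qed
    finally show ?thesis by (simp add: Z_def)
  qed
  define z where "z = (\<lambda>p. Z (rep_circle p))"
  have z: "z (proj x) = Z x" for x unfolding z_def by (rule periodic_rep_circle[of Z, OF Zp])
  have Zd: "(Z has_real_derivative (- \<sigma> * Z x + \<sigma> * g (proj x))) (at x)" for x
  proof -
    have "exp (- \<sigma> * x) * exp (\<sigma> * x) = 1" by (simp flip: exp_add)
    then have "\<sigma> * g (proj x) = exp (- \<sigma> * x) * (\<sigma> * (exp (\<sigma> * x) * g (proj x)))"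
      by (simp add: mult_ac)
    then show ?thesis unfolding Z_def
      by (auto intro!: derivative_eq_intros F simp: algebra_simps)
  qed
  have d: "((\<lambda>x. z (proj x)) has_real_derivative (- \<sigma> * Z x + \<sigma> * g (proj x))) (at x)" for x
    unfolding z by (rule Zd)
  have c: "continuous_on UNIV (\<lambda>x. - \<sigma> * Z x + \<sigma> * g (proj x))"
    by (intro continuous_intros gc DERIV_continuous_on[where D = "\<lambda>x. - \<sigma> * Z x + \<sigma> * g (proj x)"])
      (rule has_field_derivative_at_within[OF Zd])
  have "z + \<sigma> *\<^sub>R Dx z = g"
  proof (rule circle_ext)
    fix x
    have "\<sigma> * \<sigma> = 1" using s by auto
    then have ss: "\<sigma> * (\<sigma> * y) = y" for y by (metis mult.assoc mult_1_left)
    then show "(z + \<sigma> *\<^sub>R Dx z) (proj x) = g (proj x)"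
      by (simp add: scaleR_fun_def z C1I(2)[OF d c] distrib_left right_diff_distrib ss)
  qed
  with C1I(1)[OF d c] show ?thesis by blast
qed

lemma resolvent:
  assumes "\<sigma> = 1 \<or> \<sigma> = - 1" "cts g"
  shows "C1 (resolvent \<sigma> g)" "resolvent \<sigma> g + \<sigma> *\<^sub>R Dx (resolvent \<sigma> g) = g"
  using someI_ex[OF resolvent_exists[OF assms]] by (simp_all add: resolvent_def)

lemma fourier_resolvent_eq:
  assumes "C1 z" "z + \<sigma> *\<^sub>R Dx z = g"
  shows "fourier g k = (1 + of_real \<sigma> * (2 * of_real pi * of_int k * \<i>)) * fourier z k"
  unfolding assms(2)[symmetric]
  by (simp add: fourier_add fourier_scale fourier_Dx assms(1) C1_cts C1_cts_Dx cts_scale algebra_simps)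

lemma norm_resolvent_symbol:
  assumes "\<sigma> = 1 \<or> \<sigma> = - 1"
  shows "cmod (1 + of_real \<sigma> * (2 * of_real pi * of_int k * \<i>)) = symbol k powr (1/2)"
proof -
  have "\<sigma>\<^sup>2 = 1" using assms by auto
  then have "(cmod (1 + of_real \<sigma> * (2 * of_real pi * of_int k * \<i>)))\<^sup>2 = symbol k"
    by (simp add: cmod_power2 symbol_def power_mult_distrib)
  then show ?thesis using symbol_pos[of k] by (simp add: powr_half_sqrt real_sqrt_unique)
qed

text \<open>On the Fourier side the equation divides by 1 + 2 pi i k \<sigma>, which never vanishes,
  so it determines every coefficient of z.\<close>

lemma resolvent_unique:
  assumes s: "\<sigma> = 1 \<or> \<sigma> = - 1" and z: "C1 z" "z + \<sigma> *\<^sub>R Dx z = g"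
  shows "resolvent \<sigma> g = z"
proof -
  have g: "cts g" unfolding z(2)[symmetric] using z(1) by (intro cts_add cts_scale C1_cts C1_cts_Dx)
  note R = resolvent[OF s g]
  show ?thesis
  proof (rule fourier_unique)
    fix k
    have "(1 + of_real \<sigma> * (2 * of_real pi * of_int k * \<i>)) \<noteq> (0 :: complex)"
      using norm_resolvent_symbol[OF s, of k] symbol_pos[of k]
          by (metis norm_zero powr_gt_zero less_irrefl)
    with fourier_resolvent_eq[OF R, of k] fourier_resolvent_eq[OF z, of k]
    show "fourier (resolvent \<sigma> g) k = fourier z k" by (metis mult_left_cancel)
  qed (use C1_cts[OF R(1)] C1_cts[OF z(1)] in \<open>simp_all add: cts_def\<close>)
qed

text \<open>The multiplier has modulus \<open>symbol k powr (1/2)\<close>, which is exactly one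
  order of the scale; the resolvent is therefore isometric from \<open>H^r\<close> to
  \<open>H^(r+1)\<close>.\<close>

lemma weighted_resolvent:
  assumes s: "\<sigma> = 1 \<or> \<sigma> = - 1" and z: "C1 z" "z + \<sigma> *\<^sub>R Dx z = g"
  shows "weighted (r + 1) z = weighted r g"
proof
  fix k
  have "cmod (fourier g k) = symbol k powr (1/2) * cmod (fourier z k)"
    unfolding fourier_resolvent_eq[OF z] norm_mult norm_resolvent_symbol[OF s] ..
  then show "weighted (r + 1) z k = weighted r g k"
    by (simp add: weighted_def add_divide_distrib powr_add mult.assoc)
qed

lemma resolvent_sobolev:
  assumes s: "\<sigma> = 1 \<or> \<sigma> = - 1" and g: "g \<in> pts (sobolev r)"
  shows "resolvent \<sigma> g \<in> pts (sobolev (r + 1))" "nrm (sobolev (r + 1)) (resolvent \<sigma> g)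
      = nrm (sobolev r) g"
proof -
  note R = resolvent[OF s sobolev_cts[OF g]]
  note w = weighted_resolvent[OF s R, of r]
  show "resolvent \<sigma> g \<in> pts (sobolev (r + 1))"
    using g C1_cts[OF R(1)] by (simp add: sobolev_pts_iff w)
  show "nrm (sobolev (r + 1)) (resolvent \<sigma> g) = nrm (sobolev r) g"
    by (simp add: sobolev_nrm_eq w)
qed

lemma Dx_scale: "C1 u \<Longrightarrow> C1 (c *\<^sub>R u)" "C1 u \<Longrightarrow> Dx (c *\<^sub>R u) = c *\<^sub>R Dx u"
proof -
  assume u: "C1 u"
  have eq: "c *\<^sub>R u = (\<lambda>p. c) * u" by (simp add: fun_eq_iff scaleR_fun_def)
  show "C1 (c *\<^sub>R u)" unfolding eq by (intro C1_rules C1_const u)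
  show "Dx (c *\<^sub>R u) = c *\<^sub>R Dx u" unfolding eq using C1_rules(4)[OF C1_const(1) u, of c]
    by (simp add: C1_const fun_eq_iff scaleR_fun_def)
qed

lemma bounded_linear_resolvent:
  assumes s: "\<sigma> = 1 \<or> \<sigma> = - 1"
  shows "bounded_linear_nspace (sobolev r) (sobolev (r + 1)) (resolvent \<sigma>)"
  unfolding bounded_linear_nspace_def
proof (intro conjI ballI allI)
  note R = resolvent[OF s sobolev_cts]
  show "resolvent \<sigma> (x + y) = resolvent \<sigma> x + resolvent \<sigma> y" if "x \<in> pts (sobolev r)" "y
      \<in> pts (sobolev r)" for x y
  proof (rule resolvent_unique[OF s])
    show "C1 (resolvent \<sigma> x + resolvent \<sigma> y)" by (intro C1_rules R(1)[OF that(1)] R(1)[OF that(2)])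
    have "resolvent \<sigma> x + resolvent \<sigma> y + \<sigma> *\<^sub>R Dx (resolvent \<sigma> x + resolvent \<sigma> y)
      = (resolvent \<sigma> x + \<sigma> *\<^sub>R Dx (resolvent \<sigma> x)) + (resolvent \<sigma> y + \<sigma> *\<^sub>R Dx (resolvent \<sigma> y))"
      by (simp add: C1_rules(2)[OF R(1)[OF that(1)] R(1)[OF that(2)]] scaleR_add_right)
    then show "resolvent \<sigma> x + resolvent \<sigma> y + \<sigma> *\<^sub>R Dx (resolvent \<sigma> x + resolvent \<sigma> y) = x + y"
      by (simp only: R(2)[OF that(1)] R(2)[OF that(2)])
  qed
  show "resolvent \<sigma> (c *\<^sub>R x) = c *\<^sub>R resolvent \<sigma> x" if "x \<in> pts (sobolev r)" for x c
  proof (rule resolvent_unique[OF s])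
    show "C1 (c *\<^sub>R resolvent \<sigma> x)" by (intro Dx_scale R(1)[OF that])
    have "c *\<^sub>R resolvent \<sigma> x + \<sigma> *\<^sub>R Dx (c *\<^sub>R resolvent \<sigma> x) = c *\<^sub>R (resolvent \<sigma> x
        + \<sigma> *\<^sub>R Dx (resolvent \<sigma> x))"
      by (simp add: Dx_scale(2)[OF R(1)[OF that]] scaleR_add_right mult.commute)
    then show "c *\<^sub>R resolvent \<sigma> x + \<sigma> *\<^sub>R Dx (c *\<^sub>R resolvent \<sigma> x) = c *\<^sub>R x"
      by (simp only: R(2)[OF that])
  qed
  show "\<exists>C. \<forall>x\<in>pts (sobolev r). nrm (sobolev (r + 1)) (resolvent \<sigma> x) \<le> C * nrm (sobolev r) x"
    using resolvent_sobolev(2)[OF s] by (intro exI[of _ 1]) auto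
qed (use resolvent_sobolev(1)[OF s] in auto)

section \<open>Derivatives in Sobolev spaces\<close>

lemma fourier_synthesis:
  assumes s: "(\<lambda>k. norm (c k)) summable_on UNIV" and cnj: "\<And>k. c (- k) = cnj (c k)"
  obtains g where "cts g" "\<And>k. fourier g k = c k"
proof -
  have re: "complex_of_real (Re (fourier_series c x)) = fourier_series c x" for x
    by (intro fourier_series_real s cnj)
  define g where "g = (\<lambda>p. Re (fourier_series c (rep_circle p)))"
  have gp: "g (proj x) = Re (fourier_series c x)" for x
    unfolding g_def by (rule periodic_rep_circle) (simp add: fourier_series_periodic[OF s])
  have g: "cts g"
    unfolding cts_def gp by (intro continuous_intros fourier_series_continuous s)
  have fg: "fourier g k = c k" for k
    unfolding fourier_coeff gp re by (rule coeff_fourier_series[OF s])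
  show thesis by (rule that[OF g fg])
qed

text \<open>Instead of differentiating the series of \<open>u\<close> termwise, a continuous g is
  synthesised from the expected coefficients of u + u', summable as r > 3/2. Then \<open>u\<close>
  has the coefficients of \<open>resolvent 1 g\<close>, which is continuously differentiable by
  construction.\<close>

lemma sobolev_C1:
  assumes r: "r > 3/2" and u: "u \<in> pts (sobolev r)"
  shows "C1 u"
proof -
  define c where "c = (\<lambda>k. (1 + of_real 1 * (2 * of_real pi * of_int k * \<i>)) * fourier u k)"
  have cw: "norm (c k) = weighted 1 u k" for k
    unfolding c_def norm_mult using norm_resolvent_symbol[of 1 k] by (simp add: weighted_def)
  have s: "(\<lambda>k. norm (c k)) summable_on UNIV"
    unfolding cw using r by (intro sobolev_weighted_summable[OF _ u]) simp
  have cn: "c (- k) = cnj (c k)" for k by (simp add: c_def fourier_uminus)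
  obtain g where g: "cts g" and fg: "\<And>k. fourier g k = c k"
    by (rule fourier_synthesis[OF s cn], rule that)
  have R: "C1 (resolvent 1 g)" "resolvent 1 g + 1 *\<^sub>R Dx (resolvent 1 g) = g"
    using resolvent[of 1 g] g by auto
  have "u = resolvent 1 g"
  proof (rule fourier_unique)
    fix k
    have "(1 + of_real 1 * (2 * of_real pi * of_int k * \<i>)) \<noteq> (0 :: complex)"
      using norm_resolvent_symbol[of 1 k] symbol_pos[of k] by (metis norm_zero powr_gt_zero less_irrefl)
    with fourier_resolvent_eq[OF R, of k] fg[of k]
    show "fourier u k = fourier (resolvent 1 g) k" unfolding c_def by (metis mult_left_cancel)
  qed (use C1_cts[OF R(1)] sobolev_cts[OF u] in \<open>simp_all add: cts_def\<close>)
  with R(1) show ?thesis by simp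
qed

lemma symbol_split: "symbol k = 1 + (cmod (2 * of_real pi * of_int k * \<i>))\<^sup>2"
  by (simp add: symbol_def norm_mult power_mult_distrib)

lemma sobolev_Dx:
  assumes r: "r > 3/2" and u: "u \<in> pts (sobolev r)"
  shows "Dx u \<in> pts (sobolev (r - 1))" "nrm (sobolev (r - 1)) (Dx u) \<le> nrm (sobolev r) u"
proof -
  note C = sobolev_C1[OF r u]
  have le: "L2_set (weighted (r - 1) (Dx u)) F \<le> nrm (sobolev r) u" if F: "finite F" for F
  proof -
    have "weighted (r - 1) (Dx u) k \<le> weighted r u k" for k
    proof -
      have "(cmod (2 * of_real pi * of_int k * \<i>))\<^sup>2 \<le> symbol k" by (simp add: symbol_split)
      then have "cmod (2 * of_real pi * of_int k * \<i>) \<le> symbol k powr (1/2)"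
        using symbol_pos[of k] by (simp add: powr_half_sqrt real_le_rsqrt)
      then have "symbol k powr ((r - 1) / 2) * (cmod (2 * of_real pi * of_int k * \<i>) * cmod
          (fourier u k))
         \<le> symbol k powr ((r - 1) / 2) * (symbol k powr (1/2) * cmod (fourier u k))"
        by (intro mult_left_mono mult_right_mono) auto
      also have "\<dots> = weighted r u k"
        by (simp add: weighted_def diff_divide_distrib mult.assoc[symmetric] flip: powr_add)
      finally show ?thesis
        unfolding weighted_def[of "r - 1"] fourier_Dx[OF C] norm_mult[of _ "fourier u k"] .
    qed
    then have "L2_set (weighted (r - 1) (Dx u)) F \<le> L2_set (weighted r u) F"
      by (intro L2_set_mono weighted_nonneg)
    with sobolev_L2_le[OF u F] show ?thesis by simp
  qed
  show "Dx u \<in> pts (sobolev (r - 1))" "nrm (sobolev (r - 1)) (Dx u) \<le> nrm (sobolev r) u"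
    by (rule sobolevI[OF C1_cts_Dx[OF C] le], assumption)+
qed

lemma bounded_linear_Dx:
  assumes r: "r > 3/2"
  shows "bounded_linear_nspace (sobolev r) (sobolev (r - 1)) Dx"
  unfolding bounded_linear_nspace_def
  using sobolev_Dx[OF r] C1_rules(2)[OF sobolev_C1[OF r] sobolev_C1[OF r]] Dx_scale(2)[OF
      sobolev_C1[OF r]]
  by (auto intro!: exI[of _ 1])

text \<open>For nonzero k the symbol is at most twice the squared modulus of 2 pi i k, so the
  derivative controls one more order. The mean is invisible to the derivative and enters as a single
  extra term.\<close>

lemma sobolev_from_Dx:
  assumes u: "C1 u" and d: "Dx u \<in> pts (sobolev t)"
  shows "u \<in> pts (sobolev (t + 1))"
proof -
  have le: "(weighted (t + 1) u k)\<^sup>2 \<le> 2 * (weighted t (Dx u) k)\<^sup>2 + (if k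
      \<in> {0} then (cmod (fourier u 0))\<^sup>2 else 0)" for k
  proof (cases "k = 0")
    case True
    then show ?thesis by (simp add: weighted_def symbol_def)
  next
    case False
    let ?c = "(cmod (2 * of_real pi * of_int k * \<i>))\<^sup>2"
    have "1 \<le> \<bar>of_int k :: real\<bar>" using False by linarith
    then have "1 * 1 \<le> (2 * pi) * \<bar>of_int k :: real\<bar>" using pi_ge_two by (intro mult_mono) auto
    then have "1\<^sup>2 \<le> ?c" by (intro power_mono) (auto simp: norm_mult)
    then have "symbol k \<le> 2 * ?c" by (simp add: symbol_split)
    then have "(symbol k powr t * (cmod (fourier u k))\<^sup>2) * symbol k
        \<le> (symbol k powr t * (cmod (fourier u k))\<^sup>2) * (2 * ?c)"
      by (intro mult_left_mono) auto
    moreover have "symbol k powr (t + 1) = symbol k powr t * symbol k"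
      using symbol_pos[of k] by (simp add: powr_add)
    ultimately show ?thesis
      unfolding weighted_square fourier_Dx[OF u] norm_mult[of _ "fourier u k"]
          power_mult_distrib[of "cmod _"]
      using False by (simp add: mult_ac)
  qed
  have "(\<lambda>k. if k \<in> {0} then (cmod (fourier u 0))\<^sup>2 else 0) summable_on (UNIV :: int set)"
    by (rule finite_nonzero_values_imp_summable_on) (auto intro: finite_subset[of _ "{0}"])
  then have "(\<lambda>k. 2 * (weighted t (Dx u) k)\<^sup>2 + (if k \<in> {0} then (cmod (fourier u 0))\<^sup>2 else 0))
      summable_on UNIV"
    using d by (intro summable_on_add summable_on_cmult_right) (simp_all add: sobolev_pts_iff)
  then have "(\<lambda>k. (weighted (t + 1) u k)\<^sup>2) summable_on UNIV"
    using le by (rule summable_on_comparison_test) auto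
  then show ?thesis using C1_cts[OF u] by (simp add: sobolev_pts_iff)
qed

lemma sobolev_0: "cts u \<Longrightarrow> u \<in> pts (sobolev 0)"
proof (rule sobolevI)
  fix F :: "int set" assume u: "cts u" and F: "finite F"
  show "L2_set (weighted 0 u) F \<le> sqrt (integral {0..1} (\<lambda>x. (cmod (complex_of_real (u (proj x))))\<^sup>2))"
    unfolding L2_set_def weighted_0 fourier_coeff
    by (intro real_sqrt_le_mono bessel cts_coeff_continuous u F)
qed

lemma C1_sobolev_1: "C1 u \<Longrightarrow> u \<in> pts (sobolev 1)"
  using sobolev_from_Dx[of u 0] sobolev_0[OF C1_cts_Dx] by simp

section \<open>Reciprocals and exponentials\<close>

text \<open>Bootstrapping on \<open>(1/f)' = - f' (1/f)\<^sup>2\<close>, starting from \<open>C\<^sup>1 \<subseteq> H\<^sup>1\<close>.\<close>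

lemma sobolev_inverse:
  assumes r: "r > 3/2" and f: "f \<in> pts (sobolev r)" and nz: "\<And>p. f p \<noteq> 0"
  shows "(\<lambda>p. inverse (f p)) \<in> pts (sobolev r)"
proof -
  let ?g = "\<lambda>p. inverse (f p)"
  note C = sobolev_C1[OF r f]
  have gc: "cts ?g" by (rule cts_inverse[OF C1_cts[OF C] nz])
  have d: "(inverse has_real_derivative - (inverse (f p))\<^sup>2) (at (f p))" for p
    using DERIV_inverse[OF nz] by (simp add: power_inverse numeral_2_eq_2)
  have "cts (\<lambda>p. - (inverse (f p))\<^sup>2)"
    using cts_scale[OF cts_mult[OF gc gc], of "-1"] by (simp add: cts_def scaleR_fun_def
        power2_eq_square)
  note D = C1_compose[OF C d this]
  have eq: "Dx ?g = (-1) *\<^sub>R ((?g * ?g) * Dx f)"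
    unfolding D(2) by (simp add: fun_eq_iff scaleR_fun_def power2_eq_square)
  have "?g \<in> pts (sobolev (min (of_nat (Suc n)) r))" for n
  proof (induction n)
    case 0
    show ?case using sobolev_mono(1)[OF _ C1_sobolev_1[OF D(1)], of "min 1 r"] by simp
  next
    case (Suc n)
    \<comment> \<open>Each round gains one order until the order r - 1 of \<open>Dx f\<close> caps
      it; \<open>?t\<close> stays above 1/2, so the product of three factors is again in the
      space.\<close>
    let ?t = "min (of_nat (Suc n)) (r - 1)"
    have t: "?t > 1/2" using r by simp
    have g: "?g \<in> pts (sobolev ?t)" by (rule sobolev_mono(1)[OF _ Suc]) simp
    have f': "Dx f \<in> pts (sobolev ?t)" by (rule sobolev_mono(1)[OF _ sobolev_Dx(1)[OF r f]]) simp
    have "Dx ?g \<in> pts (sobolev ?t)"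
      unfolding eq by (intro seminormed.scale_mem[OF seminormed_sobolev] sobolev_mult_mem t g f')
    then have "?g \<in> pts (sobolev (?t + 1))" by (rule sobolev_from_Dx[OF D(1)])
    moreover have "?t + 1 = min (of_nat (Suc (Suc n))) r" by simp
    ultimately show ?case by simp
  qed
  moreover obtain n where "r \<le> of_nat n" using real_arch_simple by blast
  then have "min (of_nat (Suc n)) r = r" by simp
  ultimately show ?thesis by metis
qed

lemma norm_coeff_le:
  assumes "continuous_on {0..1} f" "\<And>x. x \<in> {0..1} \<Longrightarrow> norm (f x) \<le> B"
  shows "norm (coeff f k) \<le> B"
  using integral_bound[of 0 1 "\<lambda>x. f x * character (- k) x" B] assms
  unfolding coeff_def by (auto simp: norm_mult intro!: continuous_intros)

text \<open>Uniform convergence moves each Fourier coefficient, hence each finite weighted sum, to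
  the limit. This lower semicontinuity is what places the sum of the exponential series in
  \<open>H^r\<close>.\<close>

lemma sobolev_uniform_limit:
  assumes u: "\<And>n. u n \<in> pts (sobolev r)" "\<And>n. nrm (sobolev r) (u n) \<le> B"
    and lim: "uniform_limit UNIV u v sequentially"
  shows "v \<in> pts (sobolev r)" "nrm (sobolev r) v \<le> B"
proof -
  have lim': "uniform_limit UNIV (\<lambda>n x. u n (proj x)) (\<lambda>x. v (proj x)) sequentially"
    using lim unfolding uniform_limit_iff by (rule all_forward) (auto elim: eventually_mono)
  have v: "cts v" unfolding cts_def
    by (rule uniform_limit_theorem[OF _ lim']) (use sobolev_cts[OF u(1)] in \<open>auto simp: cts_def\<close>)
  have four: "(\<lambda>n. fourier (u n) k) \<longlonglongrightarrow> fourier v k" for k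
  proof (rule tendstoI)
    fix e :: real assume e: "e > 0"
    have "\<forall>\<^sub>F n in sequentially. \<forall>p\<in>UNIV. dist (u n p) (v p) < e / 2"
      using lim e unfolding uniform_limit_iff by (meson half_gt_zero)
    then show "\<forall>\<^sub>F n in sequentially. dist (fourier (u n) k) (fourier v k) < e"
    proof eventually_elim
      case (elim n)
      have "norm (coeff (\<lambda>x. complex_of_real (u n (proj x)) - complex_of_real (v (proj x))) k) \<le> e / 2"
      proof (rule norm_coeff_le)
        show "continuous_on {0..1} (\<lambda>x. complex_of_real (u n (proj x)) - complex_of_real (v (proj x)))"
          by (intro continuous_intros cts_coeff_continuous v sobolev_cts[OF u(1)])
        show "cmod (complex_of_real (u n (proj x)) - complex_of_real (v (proj x))) \<le> e / 2" for x
          using elim by (metis UNIV_I dist_real_def less_imp_le norm_of_real of_real_diff)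
      qed
      then show ?case
        using e cts_coeff_continuous[OF v, of UNIV] cts_coeff_continuous[OF sobolev_cts[OF u(1)],
            of UNIV n]
        by (simp add: coeff_diff_real fourier_coeff dist_norm)
    qed
  qed
  have le: "L2_set (weighted r v) F \<le> B" if F: "finite F" for F
  proof (rule tendsto_upperbound)
    show "(\<lambda>n. L2_set (weighted r (u n)) F) \<longlonglongrightarrow> L2_set (weighted r v) F"
      unfolding L2_set_def weighted_def by (intro tendsto_intros four)
    show "\<forall>\<^sub>F n in sequentially. L2_set (weighted r (u n)) F \<le> B"
      using sobolev_L2_le[OF u(1) F] u(2) order_trans by (intro always_eventually) blast
  qed simp
  show "v \<in> pts (sobolev r)" "nrm (sobolev r) v \<le> B"
    by (rule sobolevI[OF v le], assumption)+
qed

text \<open>The quadratic bound is the differentiability of exp at 0; the functional equation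
  transports it to every other point.\<close>

lemma sobolev_exp_remainder:
  assumes r: "r > 1/2"
  obtains K where "0 \<le> K" "\<And>u. u \<in> pts (sobolev r) \<Longrightarrow> (\<lambda>p. exp (u p) - 1 - u p) \<in> pts (sobolev r)"
    "\<And>u. u \<in> pts (sobolev r) \<Longrightarrow> nrm (sobolev r) (\<lambda>p. exp (u p) - 1 - u p) \<le>
      (K * nrm (sobolev r) u)\<^sup>2 * exp (K * nrm (sobolev r) u)"
proof -
  interpret S: seminormed "sobolev r" by (rule seminormed_sobolev)
  obtain K0 where K0: "0 \<le> K0" "\<And>u v. u \<in> pts (sobolev r) \<Longrightarrow> v \<in> pts (sobolev r) \<Longrightarrow> u * v
      \<in> pts (sobolev r)"
    "\<And>u v. u \<in> pts (sobolev r) \<Longrightarrow> v \<in> pts (sobolev r) \<Longrightarrow>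
      nrm (sobolev r) (u * v) \<le> K0 * nrm (sobolev r) u * nrm (sobolev r) v"
    by (rule sobolev_algebra[OF r], rule that)
  \<comment> \<open>The constant is raised to at least 1 so that the power estimate also holds for
    the first power.\<close>
  define K where "K = K0 + 1"
  have K: "0 \<le> K" "1 \<le> K" "K0 \<le> K" using K0(1) by (auto simp: K_def)
  have pow: "u ^ Suc n \<in> pts (sobolev r) \<and> nrm (sobolev r) (u ^ Suc n)
      \<le> (K * nrm (sobolev r) u) ^ Suc n"
    if u: "u \<in> pts (sobolev r)" for u n
  proof (induction n)
    case 0
    have "1 * nrm (sobolev r) u \<le> K * nrm (sobolev r) u" by (intro mult_right_mono K S.nrm_ge0 u)
    then show ?case using u by simp
  next
    case (Suc n)
    have "nrm (sobolev r) (u * u ^ Suc n) \<le> K0 * nrm (sobolev r) u * nrm (sobolev r) (u ^ Suc n)"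
      by (intro K0 u conjunct1[OF Suc])
    also have "\<dots> \<le> K * nrm (sobolev r) u * (K * nrm (sobolev r) u) ^ Suc n"
      by (intro mult_mono mult_nonneg_nonneg K S.nrm_ge0 u conjunct1[OF Suc] conjunct2[OF Suc]
          order.refl)
    finally show ?case unfolding power_Suc[of _ "Suc n"] using K0(2)[OF u conjunct1[OF Suc]]
        by (rule conjI[rotated])
  qed
  have main: "(\<lambda>p. exp (u p) - 1 - u p) \<in> pts (sobolev r) \<and> nrm (sobolev r) (\<lambda>p. exp (u p) - 1 - u p) \<le>
      (K * nrm (sobolev r) u)\<^sup>2 * exp (K * nrm (sobolev r) u)" if u: "u \<in> pts (sobolev r)" for u
  proof -
    define x where "x = K * nrm (sobolev r) u"
    have x0: "0 \<le> x" unfolding x_def by (intro mult_nonneg_nonneg K S.nrm_ge0 u)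
    \<comment> \<open>The remainder series starts at the second power; the shift by 2 lets x^2 be
      factored out and leaves terms dominated by those of exp x.\<close>
    define T where "T = (\<lambda>n. (1 / fact (n + 2)) *\<^sub>R u ^ (n + 2))"
    have Tm: "T n \<in> pts (sobolev r)" for n
      unfolding T_def using pow[OF u, of "Suc n"] by (intro S.scale_mem) simp
    have Tn: "nrm (sobolev r) (T n) \<le> x\<^sup>2 * (x ^ n / fact n)" for n
    proof -
      have m: "u ^ (n + 2) \<in> pts (sobolev r)" "nrm (sobolev r) (u ^ (n + 2)) \<le> x ^ (n + 2)"
        using pow[OF u, of "Suc n"] by (simp_all add: x_def)
      have "nrm (sobolev r) (T n) = (1 / fact (n + 2)) * nrm (sobolev r) (u ^ (n + 2))"
        unfolding T_def by (subst S.nrm_scale[OF m(1)]) simp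
      also have "\<dots> \<le> (1 / fact n) * x ^ (n + 2)"
        using m(2) S.nrm_ge0[OF m(1)] by (intro mult_mono divide_left_mono fact_mono) auto
      also have "\<dots> = x\<^sup>2 * (x ^ n / fact n)" by (simp add: power2_eq_square)
      finally show ?thesis .
    qed
    let ?S = "\<lambda>N. \<Sum>n<N. T n"
    have Sm: "?S N \<in> pts (sobolev r)" for N by (rule S.sum_mem[OF Tm])
    have Sn: "nrm (sobolev r) (?S N) \<le> x\<^sup>2 * exp x" for N
    proof -
      have "nrm (sobolev r) (?S N) \<le> (\<Sum>n<N. nrm (sobolev r) (T n))" by (rule S.nrm_sum[OF Tm])
      also have "\<dots> \<le> (\<Sum>n<N. x\<^sup>2 * (x ^ n / fact n))" by (intro sum_mono Tn)
      also have "\<dots> = x\<^sup>2 * (\<Sum>n<N. x ^ n / fact n)" by (simp add: sum_distrib_left)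
      also have "(\<Sum>n<N. x ^ n / fact n) \<le> exp x"
        using sum_le_suminf[OF summable_exp[of x], of "{..<N}"] x0
        by (simp add: exp_def scaleR_conv_of_real divide_inverse mult.commute)
      finally show ?thesis by (simp add: mult_left_mono)
    qed
    obtain M where M: "0 \<le> M" "\<And>p. \<bar>u p\<bar> \<le> M" by (rule cts_bounded[OF sobolev_cts[OF u]], rule that)
    have powapp: "(u ^ n) p = u p ^ n" for n p by (induction n) auto
    have Tp: "T n p = u p ^ (n + 2) / fact (n + 2)" for n p
      by (simp add: T_def scaleR_fun_def powapp del: power_add)
    have Sp: "?S N p = (\<Sum>n<N. u p ^ (n + 2) / fact (n + 2))" for N p
      unfolding Tp[symmetric] by (induction N) auto
    have ul: "uniform_limit UNIV (\<lambda>N p. \<Sum>n<N. u p ^ (n + 2) / fact (n + 2)) (\<lambda>p. \<Sum>n. u p ^ (n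
        + 2) / fact (n + 2)) sequentially"
    proof (rule Weierstrass_m_test)
      show "norm (u p ^ (n + 2) / fact (n + 2)) \<le> M ^ (n + 2) / fact (n + 2)" for n p
        unfolding norm_divide norm_power norm_fact unfolding real_norm_def
        by (intro divide_right_mono power_mono M) auto
      have "summable (\<lambda>n. M ^ n / fact n)"
        using summable_exp[of M] by (simp add: divide_inverse mult.commute)
      then show "summable (\<lambda>n. M ^ (n + 2) / fact (n + 2))" by (subst summable_iff_shift)
    qed
    have lim: "(\<Sum>n. u p ^ (n + 2) / fact (n + 2)) = exp (u p) - 1 - u p" for p
    proof -
      have s: "(\<lambda>n. u p ^ n / fact n) sums exp (u p)"
        using exp_converges[of "u p"] by (simp add: divide_inverse mult.commute)
      from sums_unique[OF sums_split_initial_segment[OF s, of 2]]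
      show ?thesis by (simp add: numeral_2_eq_2 lessThan_Suc del: power_Suc fact_Suc)
    qed
    have ul2: "uniform_limit UNIV ?S (\<lambda>p. exp (u p) - 1 - u p) sequentially"
      using ul unfolding lim Sp[symmetric] .
    show ?thesis
      using sobolev_uniform_limit[OF Sm Sn ul2] unfolding x_def by blast
  qed
  show thesis by (rule that[of K]) (use K main in auto)
qed

section \<open>Composition with diffeomorphisms\<close>

definition energy :: "(circle \<Rightarrow> real) \<Rightarrow> real" where
  "energy v = integral {0..1} (\<lambda>x. (v (proj x))\<^sup>2)"

lemma energy_coeff: "energy v = integral {0..1} (\<lambda>x. (cmod (complex_of_real (v (proj x))))\<^sup>2)"
  by (simp add: energy_def)

lemma bessel_energy: "cts v \<Longrightarrow> finite F \<Longrightarrow> (\<Sum>k\<in>F. (cmod (fourier v k))\<^sup>2) \<le> energy v"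
  unfolding energy_coeff fourier_coeff by (intro bessel cts_coeff_continuous)

lemma parseval_energy:
  assumes "r > 1/2" "v \<in> pts (sobolev r)"
  shows "((\<lambda>k. (cmod (fourier v k))\<^sup>2) has_sum energy v) UNIV"
  using fourier_series_parseval[OF sobolev_abs_summable[OF assms]]
  unfolding energy_coeff sobolev_fourier_series[OF assms] .

lemma integrable_cts: "cts v \<Longrightarrow> (\<lambda>x. v (proj x)) integrable_on {a..b}"
  unfolding cts_def by (intro integrable_continuous_interval) (rule continuous_on_subset, auto)

lemma cts_square: "cts v \<Longrightarrow> cts (\<lambda>p. (v p)\<^sup>2)"
  unfolding cts_def by (intro continuous_on_power)

lemma energy_le:
  assumes "cts v" "cts w" "\<And>p. (v p)\<^sup>2 \<le> w p"
  shows "energy v \<le> integral {0..1} (\<lambda>x. w (proj x))"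
  unfolding energy_def
  by (rule integral_le[OF integrable_cts[OF cts_square[OF assms(1)]] integrable_cts[OF assms(2)]])
    (simp add: assms(3))

text \<open>The increment over a period does not depend on where the period starts. That matters
  because a lift maps [0, 1] to an interval of length 1 with a different origin.\<close>

lemma cts_antiderivative:
  assumes F: "cts F"
  obtains G where "\<And>x. (G has_real_derivative F (proj x)) (at x)"
    "\<And>x. G (x + 1) - G x = integral {0..1} (\<lambda>x. F (proj x))"
proof -
  have c: "isCont (\<lambda>x. F (proj x)) x" for x using F by (simp add: cts_def
      continuous_on_eq_continuous_at)
  obtain G where G: "\<And>x. (G has_real_derivative F (proj x)) (at x)"
    by (rule continuous_antiderivative[of "\<lambda>x. F (proj x)", OF c], rule that)
  have "((\<lambda>x. G (x + 1) - G x) has_real_derivative 0) (at x)" for x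
  proof -
    have "((\<lambda>x. G (x + 1)) has_real_derivative F (proj (x + 1))) (at x)"
      using G[of "x + 1"] by (subst (asm) DERIV_shift)
    then show ?thesis using DERIV_diff[OF _ G[of x]] by fastforce
  qed
  then have 1: "G (x + 1) - G x = G (0 + 1) - G 0" for x :: real
    using DERIV_isconst_all[of "\<lambda>x. G (x + 1) - G x"] by blast
  have "((\<lambda>x. F (proj x)) has_integral (G 1 - G 0)) {0..1}"
    by (rule fundamental_theorem_of_calculus)
      (auto intro!: has_field_derivative_at_within G simp flip:
          has_real_derivative_iff_has_vector_derivative)
  then have 2: "integral {0..1} (\<lambda>x. F (proj x)) = G 1 - G 0" by (rule integral_unique)
  show thesis by (rule that[OF G]) (use 1 2 in auto)
qed

locale circle_diffeo =
  fixes u :: "circle \<Rightarrow> real"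
  assumes C1_u: "C1 u" and pos: "\<And>p. 0 < 1 + Dx u p"
begin

definition lift :: "real \<Rightarrow> real" where "lift x = x + u (proj x)"
definition unlift :: "real \<Rightarrow> real" where "unlift = inv lift"
definition diffeo :: "circle \<Rightarrow> circle" where "diffeo p = proj (rep_circle p + u p)"
definition jacobian :: "circle \<Rightarrow> real" where "jacobian p = 1 + Dx u p"
definition inv_jacobian :: "circle \<Rightarrow> real" where "inv_jacobian p = inverse (jacobian p)"

lemma lift_deriv: "(lift has_real_derivative jacobian (proj x)) (at x)"
  unfolding lift_def[abs_def] jacobian_def
  by (auto intro!: derivative_eq_intros C1_deriv[OF C1_u])

lemma jacobian_pos: "0 < jacobian p"
  by (simp add: jacobian_def pos)

lemma lift_add_1: "lift (x + 1) = lift x + 1"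
  by (simp add: lift_def)

lemma lift_strict_mono: "x < y \<Longrightarrow> lift x < lift y"
  by (rule DERIV_pos_imp_increasing) (use lift_deriv jacobian_pos in blast)+

lemma inj_lift: "inj lift"
  by (rule injI) (metis lift_strict_mono linorder_neqE_linordered_idom less_irrefl)

lemma surj_lift: "surj lift"
proof -
  obtain M where M: "0 \<le> M" "\<And>p. \<bar>u p\<bar> \<le> M" by (rule cts_bounded[OF C1_cts[OF C1_u]], rule that)
  have "\<exists>x. lift x = y" for y
  proof -
    have "lift (y - M) \<le> y" "y \<le> lift (y + M)"
      using M(2)[of "proj (y - M)"] M(2)[of "proj (y + M)"] by (auto simp: lift_def)
    moreover have "\<forall>x. isCont lift x" using lift_deriv DERIV_isCont by blast
    ultimately show ?thesis using IVT[of lift "y - M" y "y + M"] M(1) by auto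
  qed
  then show ?thesis by (metis surjI)
qed

lemma lift_unlift [simp]: "lift (unlift y) = y"
  unfolding unlift_def by (rule surj_f_inv_f[OF surj_lift])

lemma unlift_lift [simp]: "unlift (lift x) = x"
  unfolding unlift_def by (rule inv_f_f[OF inj_lift])

lemma unlift_add_1: "unlift (y + 1) = unlift y + 1"
  by (metis lift_add_1 lift_unlift unlift_lift)

lemma diffeo_proj: "diffeo (proj x) = proj (lift x)"
proof -
  have "rep_circle (proj x) - x \<in> \<int>" by (simp flip: proj_eq_iff)
  then show ?thesis by (simp add: diffeo_def lift_def proj_eq_iff)
qed

lemma unlift_Ints: "x - y \<in> \<int> \<Longrightarrow> unlift x - unlift y \<in> \<int>"
proof -
  assume "x - y \<in> \<int>"
  moreover have "proj (unlift (x + 1)) = proj (unlift x)" for x by (simp add: unlift_add_1)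
  ultimately have "proj (unlift x) = proj (unlift y)"
    using periodic_Ints[of "\<lambda>x. proj (unlift x)" x y] by blast
  then show ?thesis by (simp add: proj_eq_iff)
qed

definition inv_diffeo :: "circle \<Rightarrow> circle" where "inv_diffeo p = proj (unlift (rep_circle p))"

lemma inv_diffeo_proj: "inv_diffeo (proj y) = proj (unlift y)"
  unfolding inv_diffeo_def proj_eq_iff by (rule unlift_Ints) (simp flip: proj_eq_iff)

lemma inv_diffeo_diffeo [simp]: "inv_diffeo (diffeo p) = p"
proof -
  have "inv_diffeo (diffeo (proj x)) = proj x" for x by (simp add: diffeo_proj inv_diffeo_proj)
  then show ?thesis by (metis proj_rep_circle)
qed

lemma diffeo_inv_diffeo [simp]: "diffeo (inv_diffeo p) = p"
proof -
  have "diffeo (inv_diffeo (proj x)) = proj x" for x by (simp add: diffeo_proj inv_diffeo_proj)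
  then show ?thesis by (metis proj_rep_circle)
qed

lemma inv_diffeo_eq: "inv diffeo = inv_diffeo"
  by (rule inv_equality) simp_all

lemma unlift_cont: "isCont unlift y"
proof -
  have "isCont unlift (lift (unlift y))"
    by (rule isCont_inverse_function[where d = 1])
      (auto intro: DERIV_isCont lift_deriv)
  then show ?thesis by simp
qed

lemma unlift_deriv: "(unlift has_real_derivative inv_jacobian (proj (unlift y))) (at y)"
  unfolding inv_jacobian_def
  by (rule DERIV_inverse_function[where f = lift and a = "y - 1" and b = "y + 1"])
    (use lift_deriv jacobian_pos[of "proj (unlift y)"] unlift_cont in auto)

lemma cts_jacobian: "cts jacobian"
  using cts_add[OF cts_const[of 1] C1_cts_Dx[OF C1_u]] by (simp add: jacobian_def[abs_def] plus_fun_def)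

lemma cts_inv_jacobian: "cts inv_jacobian"
  unfolding inv_jacobian_def[abs_def] using jacobian_pos by (intro cts_inverse cts_jacobian)
      (metis less_irrefl)

lemma cts_comp: "cts g \<Longrightarrow> cts (g \<circ> inv_diffeo)"
  unfolding cts_def o_def inv_diffeo_proj
  using continuous_on_compose2[of UNIV "\<lambda>x. g (proj x)" UNIV unlift] unlift_cont
  by (auto simp: continuous_on_eq_continuous_at)

text \<open>The conjugation rule behind everything below: composing with \<phi>^-1 turns
  \<open>Dx\<close> into 1/\<phi>_x times \<open>Dx\<close>, evaluated before the
  composition.\<close>

lemma C1_comp:
  assumes "C1 g"
  shows "C1 (g \<circ> inv_diffeo)" "Dx (g \<circ> inv_diffeo) = (Dx g * inv_jacobian) \<circ> inv_diffeo"
proof -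
  have d: "((\<lambda>x. (g \<circ> inv_diffeo) (proj x)) has_real_derivative ((Dx g * inv_jacobian) \<circ>
      inv_diffeo) (proj x)) (at x)" for x
    using DERIV_chain2[OF C1_deriv[OF assms] unlift_deriv] by (simp add: inv_diffeo_proj)
  have c: "continuous_on UNIV (\<lambda>x. ((Dx g * inv_jacobian) \<circ> inv_diffeo) (proj x))"
    using cts_comp[OF cts_mult[OF C1_cts_Dx[OF assms] cts_inv_jacobian]] unfolding cts_def .
  show "C1 (g \<circ> inv_diffeo)" by (rule C1I(1)[OF d c])
  show "Dx (g \<circ> inv_diffeo) = (Dx g * inv_jacobian) \<circ> inv_diffeo"
    by (rule circle_ext) (rule C1I(2)[OF d c])
qed

text \<open>Change of variables, by monotonicity of the difference of the two antiderivatives.\<close>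

lemma integral_comp_le:
  assumes F: "cts F" "\<And>p. 0 \<le> F p" and M: "\<And>p. jacobian p \<le> M"
  shows "integral {0..1} (\<lambda>x. (F \<circ> inv_diffeo) (proj x)) \<le> M * integral {0..1} (\<lambda>x. F (proj x))"
proof -
  obtain G where G: "\<And>x. (G has_real_derivative F (proj x)) (at x)"
    "\<And>x. G (x + 1) - G x = integral {0..1} (\<lambda>x. F (proj x))"
    by (rule cts_antiderivative[OF F(1)], rule that)
  obtain Q where Q: "\<And>x. (Q has_real_derivative (F \<circ> inv_diffeo) (proj x)) (at x)"
    "\<And>x. Q (x + 1) - Q x = integral {0..1} (\<lambda>x. (F \<circ> inv_diffeo) (proj x))"
    by (rule cts_antiderivative[OF cts_comp[OF F(1)]], rule that)
  have d: "((\<lambda>x. M * G x - Q (lift x)) has_real_derivative (M - jacobian (proj x)) * F (proj x))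
      (at x)" for x
  proof -
    have "((\<lambda>x. Q (lift x)) has_real_derivative (F \<circ> inv_diffeo) (proj (lift x)) * jacobian (proj
        x)) (at x)"
      by (rule DERIV_chain2[OF Q(1) lift_deriv])
    from DERIV_diff[OF DERIV_cmult[OF G(1)[of x], of M] this]
    show ?thesis by (simp add: inv_diffeo_proj algebra_simps)
  qed
  have "M * G 0 - Q (lift 0) \<le> M * G (0 + 1) - Q (lift (0 + 1))"
  proof (rule DERIV_nonneg_imp_nondecreasing[where f = "\<lambda>x. M * G x - Q (lift x)"])
    show "\<exists>y. ((\<lambda>x. M * G x - Q (lift x)) has_real_derivative y) (at x) \<and> 0 \<le> y" for x
      using d[of x] M[of "proj x"] F(2)[of "proj x"]
      by (intro exI[of _ "(M - jacobian (proj x)) * F (proj x)"]) simp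
  qed simp
  then have "Q (lift 0 + 1) - Q (lift 0) \<le> M * (G (0 + 1) - G 0)"
    unfolding lift_add_1 by (simp add: algebra_simps)
  then show ?thesis unfolding G(2) Q(2) .
qed

lemma energy_comp_le:
  assumes "cts v" "\<And>p. jacobian p \<le> M"
  shows "energy (v \<circ> inv_diffeo) \<le> M * energy v"
  using integral_comp_le[OF cts_square[OF assms(1)] _ assms(2)] by (simp add: energy_def)

end

section \<open>Interpolation of composition between L^2 and H^2\<close>

lemma finite_symbol_less: "finite {k. symbol k < q}"
proof (rule finite_subset)
  show "{k. symbol k < q} \<subseteq> {- \<lceil>q\<rceil>..\<lceil>q\<rceil>}"
  proof
    fix k assume k: "k \<in> {k. symbol k < q}"
    have "\<bar>of_int k\<bar> \<le> symbol k"
    proof -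
      have "1 * \<bar>of_int k\<bar> \<le> (2 * pi) * \<bar>of_int k :: real\<bar>" using pi_ge_two
          by (intro mult_right_mono) auto
      then have "\<bar>of_int k\<bar> \<le> \<bar>2 * pi * of_int k\<bar>" by (simp add: abs_mult)
      moreover have "0 \<le> (\<bar>2 * pi * of_int k :: real\<bar> - 1)\<^sup>2" by simp
      then have "2 * \<bar>2 * pi * of_int k\<bar> \<le> symbol k"
        unfolding symbol_def power2_diff power2_abs by simp
      ultimately show ?thesis by linarith
    qed
    with k show "k \<in> {- \<lceil>q\<rceil>..\<lceil>q\<rceil>}" by (simp, linarith)
  qed
qed simp

text \<open>The sum below is comparable with the squared K-functional of the pair \<open>(L\<^sup>2, H\<^sup>2)\<close> at \<open>g\<close>,
  with parameter \<open>1 / q\<close>: composition is bounded on both spaces, hence on those in between.\<close>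

definition interp_weight :: "real \<Rightarrow> int \<Rightarrow> real" where
  "interp_weight q k = min 1 ((symbol k / q)\<^sup>2)"

definition interp_sum :: "(circle \<Rightarrow> real) \<Rightarrow> real \<Rightarrow> real" where
  "interp_sum g q = (\<Sum>\<^sub>\<infinity>k. interp_weight q k * (cmod (fourier g k))\<^sup>2)"

lemma fourier_sq_summable:
  assumes "r \<ge> 0" "g \<in> pts (sobolev r)"
  shows "(\<lambda>k. (cmod (fourier g k))\<^sup>2) summable_on UNIV"
  using sobolev_mono(1)[OF assms] by (simp add: sobolev_pts_iff weighted_0)

lemma interp_summable:
  assumes "r \<ge> 0" "g \<in> pts (sobolev r)"
  shows "(\<lambda>k. interp_weight q k * (cmod (fourier g k))\<^sup>2) summable_on UNIV"
  by (rule summable_on_comparison_test[OF fourier_sq_summable[OF assms]])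
    (auto simp: interp_weight_def min_def mult_left_le_one_le)

text \<open>Only finitely many modes survive, so the low-frequency part has every order of
  smoothness and can be differentiated twice even when \<open>g\<close> cannot.\<close>

lemma frequency_cutoff:
  assumes r: "r > 1/2" and g: "g \<in> pts (sobolev r)"
  obtains b where "\<And>t. b \<in> pts (sobolev t)"
    "\<And>k. fourier b k = (if symbol k < q then fourier g k else 0)"
proof -
  let ?c = "\<lambda>k. if symbol k < q then fourier g k else 0"
  have s: "(\<lambda>k. norm (?c k)) summable_on UNIV"
    by (rule finite_nonzero_values_imp_summable_on)
      (auto intro: finite_subset[OF _ finite_symbol_less[of q]])
  have cn: "?c (- k) = cnj (?c k)" for k
    by (simp add: fourier_uminus symbol_def)
  obtain b where b: "cts b" "\<And>k. fourier b k = ?c k"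
    by (rule fourier_synthesis[OF s cn], rule that)
  have "b \<in> pts (sobolev t)" for t
    unfolding sobolev_pts_iff
  proof
    show "(\<lambda>k. (weighted t b k)\<^sup>2) summable_on UNIV"
      by (rule finite_nonzero_values_imp_summable_on)
        (auto simp: weighted_def b(2) split: if_splits intro: finite_subset[OF _
            finite_symbol_less[of q]])
  qed (rule b)
  then show thesis by (rule that[OF _ b(2)])
qed

context circle_diffeo
begin

text \<open>Split g = b + h at frequency level q. The high part h is estimated in L^2. For the low
  part, A (b o \<phi>^-1) is estimated in L^2 and costs a factor q, which is regained because the
  modes in F satisfy \<open>q \<le> symbol k\<close>. The constant is uniform in r, g, q and F, so
  the estimate can later be summed over dyadic levels.\<close>

lemma interpolation_estimate:
  assumes Ji: "C1 inv_jacobian"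
  obtains C where "0 \<le> C" "\<And>r g q F. 1/2 < r \<Longrightarrow> g \<in> pts (sobolev r) \<Longrightarrow> 0 < q \<Longrightarrow> finite F \<Longrightarrow>
    \<forall>k\<in>F. q \<le> symbol k \<Longrightarrow>
    (\<Sum>k\<in>F. (cmod (fourier (g \<circ> inv_diffeo) k))\<^sup>2) \<le> C * interp_sum g q"
proof -
  obtain M where M: "0 \<le> M" "\<And>p. \<bar>jacobian p\<bar> \<le> M" by (rule cts_bounded[OF cts_jacobian], rule that)
  have M': "jacobian p \<le> M" for p using M(2)[of p] by simp
  let ?J = "inv_jacobian"
  have c1: "cts (?J * ?J)" "cts (?J * Dx ?J)"
    by (intro cts_mult C1_cts_Dx Ji cts_inv_jacobian)+
  obtain B1 where B1: "0 \<le> B1" "\<And>p. \<bar>(?J * ?J) p\<bar> \<le> B1" by (rule cts_bounded[OF c1(1)], rule that)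
  obtain B2 where B2: "0 \<le> B2" "\<And>p. \<bar>(?J * Dx ?J) p\<bar> \<le> B2" by (rule cts_bounded[OF c1(2)], rule that)
  define B where "B = 1 + B1\<^sup>2 + B2\<^sup>2"
  have B0: "0 \<le> B" by (simp add: B_def)
  \<comment> \<open>The factor 2 comes from splitting the square of a sum, M from the change of
    variables, and 18 = 2 * 3 * 3 from the three terms of \<open>w\<close> and the three energies
    bounding them.\<close>
  define C where "C = 2 * M + 18 * M * B"
  have main: "(\<Sum>k\<in>F. (cmod (fourier (g \<circ> inv_diffeo) k))\<^sup>2) \<le> C * interp_sum g q"
    if r: "1/2 < r" and g: "g \<in> pts (sobolev r)" and q: "0 < q" and F: "finite F"
      and Fq: "\<forall>k\<in>F. q \<le> symbol k" for r g q F
  proof -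
    obtain b where b: "\<And>t. b \<in> pts (sobolev t)"
      and fb: "\<And>k. fourier b k = (if symbol k < q then fourier g k else 0)"
      by (rule frequency_cutoff[OF r g, of q], rule that)
    define h where "h = g - b"
    have h: "h \<in> pts (sobolev r)"
      unfolding h_def by (intro seminormed.diff_mem[OF seminormed_sobolev] g b)
    have "g = b + h" by (simp add: h_def)
    then have "fourier g k = fourier b k + fourier h k" for k
      using fourier_add[OF sobolev_cts[OF b] sobolev_cts[OF h], of k] by simp
    then have fh: "fourier h k = (if symbol k < q then 0 else fourier g k)" for k
      by (metis add_diff_cancel_left' diff_self fb diff_zero)
    note isum = interp_summable[OF _ g, of q]
    have r0: "0 \<le> r" using r by simp
    have Is: "energy v \<le> K * interp_sum g q"
      if v: "v \<in> pts (sobolev 1)" and le: "\<And>k. (cmod (fourier v k))\<^sup>2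
          \<le> K * (interp_weight q k * (cmod (fourier g k))\<^sup>2)" for v K
    proof -
      have "((\<lambda>k. (cmod (fourier v k))\<^sup>2) has_sum energy v) UNIV" by (rule parseval_energy[OF _ v]) simp
      moreover have "((\<lambda>k. K * (interp_weight q k * (cmod (fourier g k))\<^sup>2))
          has_sum K * interp_sum g q) UNIV"
        unfolding interp_sum_def by (intro has_sum_cmult_right has_sum_infsum isum r0)
      ultimately show ?thesis using le by (rule has_sum_mono)
    qed
    have eh: "energy h \<le> 1 * interp_sum g q"
    proof -
      have "((\<lambda>k. (cmod (fourier h k))\<^sup>2) has_sum energy h) UNIV" by (rule parseval_energy[OF r h])
      moreover have "((\<lambda>k. interp_weight q k * (cmod (fourier g k))\<^sup>2) has_sum interp_sum g q) UNIV"
        unfolding interp_sum_def by (intro has_sum_infsum isum r0)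
      ultimately have "energy h \<le> interp_sum g q"
      proof (rule has_sum_mono)
        show "(cmod (fourier h k))\<^sup>2 \<le> interp_weight q k * (cmod (fourier g k))\<^sup>2" for k
        proof (cases "symbol k < q")
          case False
          then have "1 \<le> (symbol k / q)\<^sup>2" using q by (simp add: le_divide_eq)
          then show ?thesis by (simp add: fh interp_weight_def min_def)
        qed (simp add: fh interp_weight_def)
      qed
      then show ?thesis by simp
    qed
    define b1 where "b1 = Dx b"
    define b2 where "b2 = Dx b1"
    have b1: "b1 \<in> pts (sobolev t)" for t
      unfolding b1_def using sobolev_mono(1)[OF _ sobolev_Dx(1)[OF _ b], of t "max t 2 + 1"] by simp
    have b2: "b2 \<in> pts (sobolev t)" for t
      unfolding b2_def using sobolev_mono(1)[OF _ sobolev_Dx(1)[OF _ b1], of t "max t 2 + 1"] by simp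
    have C1b: "C1 b" "C1 b1" by (rule sobolev_C1[OF _ b, of 2] sobolev_C1[OF _ b1, of 2], simp)+
    let ?z = "\<lambda>k. (2 * of_real pi * of_int k * \<i>) :: complex"
    have fb1: "fourier b1 k = ?z k * fourier b k" for k unfolding b1_def by (rule fourier_Dx[OF C1b(1)])
    have fb2: "fourier b2 k = ?z k * (?z k * fourier b k)" for k
        unfolding b2_def fourier_Dx[OF C1b(2)] fb1 ..
    \<comment> \<open>Used with the multipliers of b, b1 and b2, whose squared moduli 1, |2 pi k|^2
      and |2 pi k|^4 are all at most the squared symbol.\<close>
    have low: "cc * (cmod (fourier b k))\<^sup>2 \<le> q\<^sup>2 * (interp_weight q k * (cmod (fourier g k))\<^sup>2)"
      if "cc \<le> (symbol k)\<^sup>2" for cc k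
    proof (cases "symbol k < q")
      case True
      then have "(symbol k / q)\<^sup>2 \<le> 1\<^sup>2" using q symbol_pos[of k] by (intro power_mono) auto
      then have "interp_weight q k = (symbol k / q)\<^sup>2" by (simp add: interp_weight_def min_def)
      then have eq: "q\<^sup>2 * (interp_weight q k * (cmod (fourier g k))\<^sup>2)
          = (symbol k)\<^sup>2 * (cmod (fourier g k))\<^sup>2"
        using q by (simp add: power_divide)
      have "cc * (cmod (fourier b k))\<^sup>2 \<le> (symbol k)\<^sup>2 * (cmod (fourier b k))\<^sup>2"
        using that by (intro mult_right_mono) auto
      then show ?thesis unfolding eq using True by (simp add: fb)
    next
      case False
      then show ?thesis by (simp add: fb interp_weight_def)
    qed
    have z: "(cmod (?z k))\<^sup>2 \<le> symbol k" for k by (simp only: symbol_split)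
    have sq: "symbol k \<le> (symbol k)\<^sup>2" "1 \<le> (symbol k)\<^sup>2" for k
      using symbol_ge_1[of k] by (auto simp: power2_eq_square intro: order.trans mult_mono[of 1 _
          1 , simplified])
    have e0: "energy b \<le> q\<^sup>2 * interp_sum g q"
      by (rule Is[OF b]) (use low[OF sq(2)] in simp)
    have e1: "energy b1 \<le> q\<^sup>2 * interp_sum g q"
    proof (rule Is[OF b1])
      fix k
      from low[OF order.trans[OF z sq(1)], of k]
      show "(cmod (fourier b1 k))\<^sup>2 \<le> q\<^sup>2 * (interp_weight q k * (cmod (fourier g k))\<^sup>2)"
        unfolding fb1 by (simp add: norm_mult power_mult_distrib mult_ac)
    qed
    have e2: "energy b2 \<le> q\<^sup>2 * interp_sum g q"
    proof (rule Is[OF b2])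
      fix k
      have "(cmod (?z k))\<^sup>2 * (cmod (?z k))\<^sup>2 \<le> (symbol k)\<^sup>2"
        unfolding power2_eq_square[of "symbol k"] using symbol_pos[of k] by (intro mult_mono z) auto
      from low[OF this] show "(cmod (fourier b2 k))\<^sup>2 \<le> q\<^sup>2 * (interp_weight q k * (cmod (fourier
          g k))\<^sup>2)"
        unfolding fb2 by (simp add: norm_mult power_mult_distrib mult_ac)
    qed
    define v where "v = b \<circ> inv_diffeo"
    \<comment> \<open>\<open>w\<close> is A conjugated by the composition and applied to b, computed
      at the source point: the second conjugated derivative is (b1 J)' J = b2 J^2 + b1 J J'. Hence w
      o \<phi>^-1 = A v.\<close>
    define w where "w = b - (b2 * (?J * ?J) + b1 * (?J * Dx ?J))"
    have v1: "C1 v" "Dx v = (b1 * ?J) \<circ> inv_diffeo"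
      unfolding v_def b1_def by (rule C1_comp[OF C1b(1)])+
    have bJ: "C1 (b1 * ?J)" "Dx (b1 * ?J) = b2 * ?J + b1 * Dx ?J"
      unfolding b2_def by (rule C1_rules(3,4)[OF C1b(2) Ji])+
    have v2: "C1 (Dx v)" "Dx (Dx v) = ((b2 * ?J + b1 * Dx ?J) * ?J) \<circ> inv_diffeo"
      unfolding v1(2) C1_comp(2)[OF bJ(1)] bJ(2) by (rule C1_comp(1)[OF bJ(1)] refl)+
    have w: "w \<circ> inv_diffeo = v + (-1) *\<^sub>R Dx (Dx v)"
      unfolding v2(2) by (simp add: w_def v_def fun_eq_iff scaleR_fun_def algebra_simps)
    have cw: "cts w"
    proof -
      have "w = b + (-1) *\<^sub>R (b2 * (?J * ?J) + b1 * (?J * Dx ?J))"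
        by (simp add: w_def fun_eq_iff scaleR_fun_def)
      then show ?thesis by (simp only:) (intro cts_add cts_mult cts_scale sobolev_cts[OF b[of 1]]
            sobolev_cts[OF b1[of 1]] sobolev_cts[OF b2[of 1]] cts_inv_jacobian C1_cts_Dx Ji)
    qed
    have fw: "fourier (w \<circ> inv_diffeo) k = of_real (symbol k) * fourier v k" for k
    proof -
      have "fourier (w \<circ> inv_diffeo) k = fourier v k - ?z k * (?z k * fourier v k)"
        unfolding w fourier_add[OF C1_cts[OF v1(1)] cts_scale[OF C1_cts_Dx[OF v2(1)]]] fourier_scale
          fourier_Dx[OF v2(1)] fourier_Dx[OF v1(1)] by simp
      also have "\<dots> = of_real (symbol k) * fourier v k"
        by (simp add: symbol_def power2_eq_square algebra_simps)
      finally show ?thesis .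
    qed
    have ew: "energy w \<le> 9 * B * q\<^sup>2 * interp_sum g q"
    proof -
      let ?W = "\<lambda>p. (3 * B) * ((b p)\<^sup>2 + ((b1 p)\<^sup>2 + (b2 p)\<^sup>2))"
      have pw: "(w p)\<^sup>2 \<le> ?W p" for p
      proof -
        let ?x = "b2 p * (?J * ?J) p" and ?y = "b1 p * (?J * Dx ?J) p"
        have tri: "(a - (x + y))\<^sup>2 \<le> 3 * (a\<^sup>2 + (x\<^sup>2 + y\<^sup>2))" for a x y :: real
        proof -
          have "0 \<le> (a + x)\<^sup>2 + (a + y)\<^sup>2 + (x - y)\<^sup>2" by simp
          then show ?thesis by (simp add: power2_eq_square algebra_simps)
        qed
        have "(?J * ?J) p ^ 2 \<le> B1\<^sup>2" "(?J * Dx ?J) p ^ 2 \<le> B2\<^sup>2"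
          using B1(2)[of p] B2(2)[of p] B1(1) B2(1) by (metis abs_of_nonneg abs_le_square_iff)+
        then have "?x\<^sup>2 \<le> (b2 p)\<^sup>2 * B" "?y\<^sup>2 \<le> (b1 p)\<^sup>2 * B"
          unfolding power_mult_distrib by (intro mult_left_mono; simp add: B_def add_increasing
              add_increasing2)+
        moreover have "(b p)\<^sup>2 * 1 \<le> (b p)\<^sup>2 * B" by (intro mult_left_mono) (auto simp: B_def)
        moreover have "(w p)\<^sup>2 \<le> 3 * ((b p)\<^sup>2 + (?x\<^sup>2 + ?y\<^sup>2))"
          using tri[of "b p" ?x ?y] by (simp add: w_def)
        ultimately show ?thesis by (simp add: algebra_simps)
      qed
      have cs: "cts (\<lambda>p. (b p)\<^sup>2)" "cts (\<lambda>p. (b1 p)\<^sup>2)" "cts (\<lambda>p. (b2 p)\<^sup>2)"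
        by (intro cts_square sobolev_cts[OF b[of 1]] sobolev_cts[OF b1[of 1]] sobolev_cts[OF b2[of 1]])+
      have "cts ?W"
        using cs unfolding cts_def by (intro continuous_on_mult continuous_on_add continuous_on_const)
      then have "energy w \<le> integral {0..1} (\<lambda>x. ?W (proj x))" by (rule energy_le[OF cw _ pw])
      also have "\<dots> = (3 * B) * (energy b + (energy b1 + energy b2))"
      proof -
        have i: "(\<lambda>x. (b (proj x))\<^sup>2) integrable_on {0..1}" "(\<lambda>x. (b1 (proj x))\<^sup>2) integrable_on {0..1}"
          "(\<lambda>x. (b2 (proj x))\<^sup>2) integrable_on {0..1}"
          using integrable_cts[OF cs(1)] integrable_cts[OF cs(2)] integrable_cts[OF cs(3)] by auto
        show ?thesis
          unfolding energy_def by (simp add: integral_add[OF i(2,3), symmetric] integral_add[OF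
              i(1) integrable_add[OF i(2,3)], symmetric])
      qed
      also have "\<dots> \<le> (3 * B) * (q\<^sup>2 * interp_sum g q + (q\<^sup>2 * interp_sum g q + q\<^sup>2 * interp_sum g q))"
        using B0 by (intro mult_left_mono add_mono e0 e1 e2) auto
      finally show ?thesis by (simp add: mult_ac)
    qed
    have gb: "g \<circ> inv_diffeo = v + (h \<circ> inv_diffeo)"
      by (simp add: v_def h_def fun_eq_iff)
    have cc: "cts v" "cts (h \<circ> inv_diffeo)"
      by (rule C1_cts[OF v1(1)], rule cts_comp[OF sobolev_cts[OF h]])
    have "(\<Sum>k\<in>F. (cmod (fourier (g \<circ> inv_diffeo) k))\<^sup>2) \<le>
        (\<Sum>k\<in>F. 2 * (cmod (fourier (h \<circ> inv_diffeo) k))\<^sup>2 + 2 / q\<^sup>2 * (cmod (fourier (w \<circ>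
            inv_diffeo) k))\<^sup>2)"
    proof (rule sum_mono)
      fix k assume k: "k \<in> F"
      have two: "(cmod (x + y))\<^sup>2 \<le> 2 * (cmod y)\<^sup>2 + 2 * (cmod x)\<^sup>2" for x y :: complex
      proof -
        have "(cmod (x + y))\<^sup>2 \<le> (cmod x + cmod y)\<^sup>2" by (intro power_mono norm_triangle_ineq) simp
        moreover have "0 \<le> (cmod x - cmod y)\<^sup>2" by simp
        ultimately show ?thesis by (simp add: power2_eq_square algebra_simps)
      qed
      have "q\<^sup>2 * (cmod (fourier v k))\<^sup>2 \<le> (symbol k)\<^sup>2 * (cmod (fourier v k))\<^sup>2"
        using q Fq k by (intro mult_right_mono power_mono) auto
      also have "\<dots> = (cmod (fourier (w \<circ> inv_diffeo) k))\<^sup>2"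
        using symbol_pos[of k] by (simp add: fw norm_mult power_mult_distrib)
      finally have "2 * (cmod (fourier v k))\<^sup>2 \<le> 2 / q\<^sup>2 * (cmod (fourier (w \<circ> inv_diffeo) k))\<^sup>2"
        using q by (simp add: field_simps)
      then show "(cmod (fourier (g \<circ> inv_diffeo) k))\<^sup>2 \<le> 2 * (cmod (fourier (h \<circ> inv_diffeo) k))\<^sup>2
          + 2 / q\<^sup>2 * (cmod (fourier (w \<circ> inv_diffeo) k))\<^sup>2"
        using two[of "fourier v k" "fourier (h \<circ> inv_diffeo) k"] unfolding gb fourier_add[OF cc]
            by linarith
    qed
    also have "\<dots> = 2 * (\<Sum>k\<in>F. (cmod (fourier (h \<circ> inv_diffeo) k))\<^sup>2)
        + 2 / q\<^sup>2 * (\<Sum>k\<in>F. (cmod (fourier (w \<circ> inv_diffeo) k))\<^sup>2)"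
      by (simp add: sum.distrib sum_distrib_left)
    also have "\<dots> \<le> 2 * (M * (1 * interp_sum g q)) + 2 / q\<^sup>2 * (M * (9 * B * q\<^sup>2 * interp_sum g q))"
    proof (intro add_mono mult_left_mono)
      show "(\<Sum>k\<in>F. (cmod (fourier (h \<circ> inv_diffeo) k))\<^sup>2) \<le> M * (1 * interp_sum g q)"
        using bessel_energy[OF cc(2) F] energy_comp_le[OF sobolev_cts[OF h] M'] mult_left_mono[OF
            eh M(1)] by linarith
      show "(\<Sum>k\<in>F. (cmod (fourier (w \<circ> inv_diffeo) k))\<^sup>2) \<le> M * (9 * B * q\<^sup>2 * interp_sum g q)"
        using bessel_energy[OF cts_comp[OF cw] F] energy_comp_le[OF cw M'] mult_left_mono[OF ew
            M(1)] by linarith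
    qed auto
    also have "\<dots> = C * interp_sum g q" using q by (simp add: C_def algebra_simps)
    finally show ?thesis .
  qed
  show thesis by (rule that[OF _ main]) (use M(1) B0 in \<open>auto simp: C_def\<close>)
qed

end

section \<open>Dyadic decomposition of the Sobolev weight\<close>

lemma geometric_sum_le:
  fixes x :: real
  assumes "1 < x" "finite A" "\<And>j. j \<in> A \<Longrightarrow> x ^ j \<le> Y" "0 \<le> Y"
  shows "(\<Sum>j\<in>A. x ^ j) \<le> x / (x - 1) * Y"
proof (cases "A = {}")
  case False
  have "(\<Sum>j\<in>A. x ^ j) \<le> (\<Sum>j<Suc (Max A). x ^ j)"
    using assms by (intro sum_mono2) (auto simp: less_Suc_eq_le)
  also have "\<dots> = (x ^ Suc (Max A) - 1) / (x - 1)" using assms(1) by (intro geometric_sum) simp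
  also have "\<dots> \<le> x * x ^ Max A / (x - 1)" using assms(1) by (intro divide_right_mono) auto
  also have "\<dots> \<le> x * Y / (x - 1)"
    using assms(1) assms(3)[OF Max_in[OF assms(2) False]] by (intro divide_right_mono
        mult_left_mono) auto
  finally show ?thesis by simp
qed (use assms in simp)

text \<open>With ratio below 1 the smallest exponent dominates, where with ratio above 1 it was the
  largest; either way a bound on the individual terms bounds the sum.\<close>

lemma geometric_sum_le':
  fixes y :: real
  assumes "0 < y" "y < 1" "finite A" "\<And>j. j \<in> A \<Longrightarrow> y ^ j \<le> Y" "0 \<le> Y"
  shows "(\<Sum>j\<in>A. y ^ j) \<le> 1 / (1 - y) * Y"
proof (cases "A = {}")
  case False
  have "(\<Sum>j\<in>A. y ^ j) \<le> (\<Sum>j=Min A..Max A. y ^ j)"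
    using assms by (intro sum_mono2) auto
  also have "\<dots> = (y ^ Min A - y ^ Suc (Max A)) / (1 - y)"
  proof -
    have "Min A \<le> Max A" using assms(3) False by simp
    then show ?thesis using assms(2) unfolding sum_gp by auto
  qed
  also have "\<dots> \<le> y ^ Min A / (1 - y)" using assms(1,2) by (intro divide_right_mono) auto
  also have "\<dots> \<le> Y / (1 - y)"
    using assms(2) assms(4)[OF Min_in[OF assms(3) False]] by (intro divide_right_mono) auto
  finally show ?thesis by simp
qed (use assms in simp)

text \<open>The minimum changes form where 4^j passes w. Below, the terms grow like 4^(j t), and
  above they decay like 4^(j (t - 2)); both sums are comparable to w^t. The end points 0 and 2 of
  the interpolation enter exactly here.\<close>

lemma dyadic_sum_le:
  assumes t: "0 < t" "t < 2"
  obtains c :: real where "0 \<le> c" "\<And>w J. 1 \<le> w \<Longrightarrow>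
    (\<Sum>j\<le>J. (4 ^ j) powr t * min 1 ((w / 4 ^ j)\<^sup>2)) \<le> c * w powr t"
proof
  define x where "x = (4 :: real) powr t"
  define y where "y = (4 :: real) powr (t - 2)"
  have x: "1 < x" using t by (simp add: x_def)
  have y: "0 < y" "y < 1" using t powr_less_mono[of "t - 2" 0 4] by (auto simp: y_def)
  have pw: "(4 ^ j) powr a = (4 powr a) ^ j" for j and a :: real
  proof -
    have "(4 ^ j) powr a = (4 powr real j) powr a" by (simp add: powr_realpow)
    also have "\<dots> = (4 powr a) powr real j" by (simp add: powr_powr mult.commute)
    finally show ?thesis by (simp add: powr_realpow)
  qed
  define c where "c = x / (x - 1) + 1 / (1 - y)"
  show "0 \<le> c" using x y by (simp add: c_def)
  fix w :: real and J :: nat assume w: "1 \<le> w"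
  define A where "A = {j. j \<le> J \<and> 4 ^ j \<le> w}"
  define B where "B = {j. j \<le> J \<and> w < 4 ^ j}"
  have AB: "{..J} = A \<union> B" "A \<inter> B = {}" "finite A" "finite B" by (auto simp: A_def B_def)
  have "(\<Sum>j\<le>J. (4 ^ j) powr t * min 1 ((w / 4 ^ j)\<^sup>2)) =
     (\<Sum>j\<in>A. (4 ^ j) powr t * min 1 ((w / 4 ^ j)\<^sup>2)) + (\<Sum>j\<in>B. (4 ^ j) powr t * min 1 ((w / 4 ^ j)\<^sup>2))"
    unfolding AB(1) by (rule sum.union_disjoint[OF AB(3,4,2)])
  also have "\<dots> \<le> (\<Sum>j\<in>A. x ^ j) + w\<^sup>2 * (\<Sum>j\<in>B. y ^ j)"
  proof (rule add_mono)
    show "(\<Sum>j\<in>A. (4 ^ j) powr t * min 1 ((w / 4 ^ j)\<^sup>2)) \<le> (\<Sum>j\<in>A. x ^ j)"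
      by (intro sum_mono) (simp add: pw x_def mult_left_le)
    have "(4 ^ j) powr t * min 1 ((w / 4 ^ j)\<^sup>2) \<le> w\<^sup>2 * y ^ j" for j
    proof -
      have "(4 ^ j) powr t * min 1 ((w / 4 ^ j)\<^sup>2) \<le> (4 ^ j) powr t * (w / 4 ^ j)\<^sup>2"
        by (intro mult_left_mono) auto
      also have "\<dots> = w\<^sup>2 * (4 ^ j) powr (t - 2)"
        by (simp add: powr_diff power_divide)
      finally show ?thesis by (simp add: pw y_def)
    qed
    then show "(\<Sum>j\<in>B. (4 ^ j) powr t * min 1 ((w / 4 ^ j)\<^sup>2)) \<le> w\<^sup>2 * (\<Sum>j\<in>B. y ^ j)"
      unfolding sum_distrib_left by (intro sum_mono)
  qed
  also have "\<dots> \<le> x / (x - 1) * w powr t + w\<^sup>2 * (1 / (1 - y) * w powr (t - 2))"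
  proof (intro add_mono mult_left_mono geometric_sum_le geometric_sum_le' x y AB)
    show "x ^ j \<le> w powr t" if "j \<in> A" for j
      using that t unfolding x_def pw[symmetric] A_def by (intro powr_mono2) auto
    show "y ^ j \<le> w powr (t - 2)" if "j \<in> B" for j
      using that t w unfolding y_def pw[symmetric] B_def by (intro powr_mono2') auto
  qed auto
  also have "\<dots> = c * w powr t"
    using w by (simp add: c_def powr_diff distrib_right)
  finally show "(\<Sum>j\<le>J. (4 ^ j) powr t * min 1 ((w / 4 ^ j)\<^sup>2)) \<le> c * w powr t" .
qed

text \<open>The largest power 4^m not exceeding w already suffices: w is less than 4 * 4^m, and one
  dyadic step costs the factor \<open>4 powr t\<close>.\<close>

lemma powr_le_dyadic_sum:
  fixes w t :: real
  assumes t: "0 < t" and w: "1 \<le> w" "w < 4 ^ J"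
  shows "w powr t \<le> 4 powr t * (\<Sum>j\<le>J. if 4 ^ j \<le> w then (4 ^ j) powr t else 0)"
proof -
  define n where "n = (LEAST n. w < 4 ^ n)"
  have n: "w < 4 ^ n" unfolding n_def by (rule LeastI[of "\<lambda>n. w < 4 ^ n", OF w(2)])
  have "n \<le> J" unfolding n_def by (rule Least_le[of "\<lambda>n. w < 4 ^ n", OF w(2)])
  have "n \<noteq> 0" using n w(1) by (intro notI) simp
  then obtain m where m: "n = Suc m" by (cases n) auto
  have "\<not> w < 4 ^ m" using not_less_Least[of m "\<lambda>n. w < 4 ^ n"] m unfolding n_def by simp
  then have mw: "4 ^ m \<le> w" by simp
  have "w powr t \<le> (4 * 4 ^ m) powr t" using n m w t by (intro powr_mono2) auto
  also have "\<dots> = 4 powr t * (4 ^ m) powr t" by (simp add: powr_mult)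
  also have "(4 ^ m) powr t \<le> (\<Sum>j\<le>J. if 4 ^ j \<le> w then (4 ^ j) powr t else 0)"
    using member_le_sum[of m "{..J}" "\<lambda>j. if 4 ^ j \<le> w then (4 ^ j) powr t else 0"] mw m \<open>n \<le> J\<close> by simp
  finally show ?thesis by simp
qed

lemma has_sum_sum:
  fixes f :: "'i \<Rightarrow> 'a \<Rightarrow> real"
  assumes "finite I" "\<And>i. i \<in> I \<Longrightarrow> (f i has_sum a i) A"
  shows "((\<lambda>x. \<Sum>i\<in>I. f i x) has_sum (\<Sum>i\<in>I. a i)) A"
  using assms by (induction I rule: finite_induct) (auto intro: has_sum_add)

context circle_diffeo
begin

text \<open>Discrete real interpolation. The weight is replaced by a sum over dyadic levels, the
  interpolation estimate is applied at each level q = 4^j to the modes above it, and after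
  exchanging the sums the levels recombine to the weight on \<open>g\<close>.\<close>

lemma sobolev_comp_low:
  assumes t: "1/2 < t" "t < 2" and Ji: "C1 inv_jacobian" and g: "g \<in> pts (sobolev t)"
  shows "g \<circ> inv_diffeo \<in> pts (sobolev t)"
proof -
  let ?f = "g \<circ> inv_diffeo"
  obtain C where C: "0 \<le> C" "\<And>r g q F. 1/2 < r \<Longrightarrow> g \<in> pts (sobolev r) \<Longrightarrow> 0 < q \<Longrightarrow> finite F \<Longrightarrow>
    \<forall>k\<in>F. q \<le> symbol k \<Longrightarrow>
    (\<Sum>k\<in>F. (cmod (fourier (g \<circ> inv_diffeo) k))\<^sup>2) \<le> C * interp_sum g q"
    by (rule interpolation_estimate[OF Ji], rule that)
  have t0: "0 < t" "0 \<le> t" using t by auto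
  obtain c where c: "0 \<le> c" "\<And>w J. 1 \<le> w \<Longrightarrow>
    (\<Sum>j\<le>J. (4 ^ j) powr t * min 1 ((w / 4 ^ j)\<^sup>2)) \<le> c * w powr t"
    by (rule dyadic_sum_le[OF t0(1) t(2)], rule that)
  define G where "G = (\<Sum>\<^sub>\<infinity>k. (weighted t g k)\<^sup>2)"
  have G: "((\<lambda>k. (weighted t g k)\<^sup>2) has_sum G) UNIV"
    unfolding G_def using g by (intro has_sum_infsum) (simp add: sobolev_pts_iff)
  define K where "K = 4 powr t * (C * (c * G))"
  have main: "(\<Sum>k\<in>F. (weighted t ?f k)\<^sup>2) \<le> K" if F: "finite F" for F
  proof -
    \<comment> \<open>The number of levels depends on \<open>F\<close>, but the constants
      \<open>C\<close> and \<open>c\<close> do not, so \<open>K\<close> bounds all finite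
      sets.\<close>
    have "\<exists>J. symbol k < 4 ^ J" for k using real_arch_pow[of 4 "symbol k"] by simp
    then obtain J0 where J0: "\<And>k. symbol k < 4 ^ J0 k" by metis
    define J where "J = Max (insert 0 (J0 ` F))"
    have J: "symbol k < 4 ^ J" if "k \<in> F" for k
    proof -
      have "J0 k \<le> J" unfolding J_def using F that by (intro Max_ge) auto
      then have "(4::real) ^ J0 k \<le> 4 ^ J" by (intro power_increasing) auto
      with J0[of k] show ?thesis by linarith
    qed
    let ?a = "\<lambda>k. (cmod (fourier ?f k))\<^sup>2"
    have "(\<Sum>k\<in>F. (weighted t ?f k)\<^sup>2) \<le>
       (\<Sum>k\<in>F. (4 powr t * (\<Sum>j\<le>J. if 4 ^ j \<le> symbol k then (4 ^ j) powr t else 0)) * ?a k)"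
      unfolding weighted_square
      by (intro sum_mono mult_right_mono powr_le_dyadic_sum t0 symbol_ge_1 J) auto
    also have "\<dots> = 4 powr t * (\<Sum>k\<in>F. \<Sum>j\<le>J. if 4 ^ j \<le> symbol k then (4 ^ j) powr t * ?a k else 0)"
      by (simp add: sum_distrib_left sum_distrib_right mult.assoc if_distrib[of
          "\<lambda>x. x * _"] cong: if_cong)
    also have "(\<Sum>k\<in>F. \<Sum>j\<le>J. if 4 ^ j \<le> symbol k then (4 ^ j) powr t * ?a k else 0)
       = (\<Sum>j\<le>J. \<Sum>k\<in>F. if 4 ^ j \<le> symbol k then (4 ^ j) powr t * ?a k else 0)" by (rule sum.swap)
    also have "\<dots> \<le> (\<Sum>j\<le>J. (4 ^ j) powr t * (C * interp_sum g (4 ^ j)))"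
    proof (rule sum_mono)
      fix j
      have "(\<Sum>k\<in>F. if 4 ^ j \<le> symbol k then (4 ^ j) powr t * ?a k else 0)
          = (4 ^ j) powr t * (\<Sum>k\<in>{k \<in> F. 4 ^ j \<le> symbol k}. ?a k)"
        using F by (simp add: sum.inter_filter[symmetric] sum_distrib_left)
      also have "\<dots> \<le> (4 ^ j) powr t * (C * interp_sum g (4 ^ j))"
        using F by (intro mult_left_mono C(2)[OF t(1) g]) auto
      finally show "(\<Sum>k\<in>F. if 4 ^ j \<le> symbol k then (4 ^ j) powr t * ?a k else 0)
          \<le> (4 ^ j) powr t * (C * interp_sum g (4 ^ j))" .
    qed
    also have "\<dots> = C * (\<Sum>j\<le>J. (4 ^ j) powr t * interp_sum g (4 ^ j))"
      by (simp add: sum_distrib_left mult.left_commute)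
    also have "(\<Sum>j\<le>J. (4 ^ j) powr t * interp_sum g (4 ^ j)) \<le> c * G"
    proof (rule has_sum_mono)
      show "((\<lambda>k. \<Sum>j\<le>J. (4 ^ j) powr t * (interp_weight (4 ^ j) k * (cmod (fourier g k))\<^sup>2)) has_sum
          (\<Sum>j\<le>J. (4 ^ j) powr t * interp_sum g (4 ^ j))) UNIV"
        unfolding interp_sum_def
        by (intro has_sum_sum has_sum_cmult_right has_sum_infsum interp_summable[OF t0(2) g]) auto
      show "((\<lambda>k. c * (weighted t g k)\<^sup>2) has_sum c * G) UNIV" by (intro has_sum_cmult_right G)
      fix k
      have "(\<Sum>j\<le>J. (4 ^ j) powr t * (interp_weight (4 ^ j) k * (cmod (fourier g k))\<^sup>2))
          = (\<Sum>j\<le>J. (4 ^ j) powr t * min 1 ((symbol k / 4 ^ j)\<^sup>2)) * (cmod (fourier g k))\<^sup>2"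
        by (simp only: interp_weight_def sum_distrib_right mult.assoc)
      also have "\<dots> \<le> (c * symbol k powr t) * (cmod (fourier g k))\<^sup>2"
        by (intro mult_right_mono c(2) symbol_ge_1) auto
      finally show "(\<Sum>j\<le>J. (4 ^ j) powr t * (interp_weight (4 ^ j) k * (cmod (fourier g k))\<^sup>2))
          \<le> c * (weighted t g k)\<^sup>2"
        by (simp add: weighted_square mult.assoc)
    qed
    finally show ?thesis using C(1) by (simp add: K_def mult_left_mono o_def)
  qed
  show ?thesis
  proof (rule sobolevI(1)[OF cts_comp[OF sobolev_cts[OF g]]])
    show "L2_set (weighted t ?f) F \<le> sqrt K" if "finite F" for F
      unfolding L2_set_def by (intro real_sqrt_le_mono main that)
  qed
qed

end

locale sobolev_diffeo =
  fixes s :: real and u :: "circle \<Rightarrow> real"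
  assumes s: "s > 5/2" and u: "u \<in> pts (sobolev s)" and u_pos: "\<And>p. 0 < 1 + Dx u p"

sublocale sobolev_diffeo \<subseteq> circle_diffeo u
  using s by unfold_locales (auto intro: u_pos sobolev_C1[OF _ u])

context sobolev_diffeo
begin

lemma jacobian_sobolev: "jacobian \<in> pts (sobolev (s - 1))"
proof -
  have "jacobian = 1 + Dx u" by (simp add: jacobian_def fun_eq_iff)
  then show ?thesis using s sobolev_Dx(1)[OF _ u]
    by (simp add: seminormed.add_mem[OF seminormed_sobolev] sobolev_one)
qed

lemma inv_jacobian_sobolev: "inv_jacobian \<in> pts (sobolev (s - 1))"
proof -
  have "jacobian p \<noteq> 0" for p using jacobian_pos[of p] by simp
  moreover have "s - 1 > 3/2" using s by simp
  ultimately show ?thesis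
    unfolding inv_jacobian_def[abs_def] by (intro sobolev_inverse jacobian_sobolev)
qed

text \<open>Differentiating g o \<phi>^-1 lowers the order by one and multiplies \<open>Dx g\<close>
  by 1/\<phi>_x, which lies in \<open>H^(s-1)\<close> and hence acts on \<open>H^(t-1)\<close>.
  Induction over windows of length one brings every order up to s down to the interpolation range t
  < 2.\<close>

lemma sobolev_comp_aux:
  "1/2 < t \<Longrightarrow> t \<le> s \<Longrightarrow> t < 2 + of_nat n \<Longrightarrow> g \<in> pts (sobolev t) \<Longrightarrow> g \<circ> inv_diffeo \<in> pts (sobolev t)"
proof (induction n arbitrary: t g)
  case 0
  have "C1 inv_jacobian" by (rule sobolev_C1[OF _ inv_jacobian_sobolev]) (use s in simp)
  then show ?case using 0 by (intro sobolev_comp_low) auto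
next
  case (Suc n)
  show ?case
  proof (cases "t < 2")
    case True
    then show ?thesis using Suc.prems by (intro Suc.IH) auto
  next
    case False
    then have t: "t > 3/2" "t - 1 > 1/2" by auto
    have d: "Dx g * inv_jacobian \<in> pts (sobolev (t - 1))"
      using Suc.prems(2) by (intro sobolev_mult_mem t sobolev_Dx Suc.prems sobolev_mono(1)[OF _
          inv_jacobian_sobolev]) auto
    note C = C1_comp[OF sobolev_C1[OF t(1) Suc.prems(4)]]
    have "Dx (g \<circ> inv_diffeo) \<in> pts (sobolev (t - 1))"
      unfolding C(2) by (rule Suc.IH[OF _ _ _ d]) (use Suc.prems t in auto)
    from sobolev_from_Dx[OF C(1) this] show ?thesis by (simp add: o_def)
  qed
qed

lemma sobolev_comp:
  assumes "g \<in> pts (sobolev s)"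
  shows "g \<circ> inv_diffeo \<in> pts (sobolev s)"
proof -
  obtain n where "s < of_nat n" using reals_Archimedean2 by blast
  then show ?thesis using s assms by (intro sobolev_comp_aux[of s n]) auto
qed

end

section \<open>Smoothness of exponential and reciprocal\<close>

definition expo :: "(circle \<Rightarrow> real) \<Rightarrow> circle \<Rightarrow> real" where
  "expo w = (\<lambda>p. exp (w p))"

definition recip :: "(circle \<Rightarrow> real) \<Rightarrow> circle \<Rightarrow> real" where
  "recip f = (\<lambda>p. inverse (f p))"

lemma sobolev_expo:
  assumes r: "r > 1/2" and u: "u \<in> pts (sobolev r)"
  shows "expo u \<in> pts (sobolev r)"
proof -
  obtain K where "0 \<le> K" and K: "\<And>u. u \<in> pts (sobolev r) \<Longrightarrow> (\<lambda>p. exp (u p) - 1 - u p) \<in> pts (sobolev r)"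
    "\<And>u. u \<in> pts (sobolev r) \<Longrightarrow> nrm (sobolev r) (\<lambda>p. exp (u p) - 1 - u p) \<le>
      (K * nrm (sobolev r) u)\<^sup>2 * exp (K * nrm (sobolev r) u)"
    by (rule sobolev_exp_remainder[OF r], rule that)
  have "expo u = (\<lambda>p. exp (u p) - 1 - u p) + (1 + u)" by (simp add: expo_def fun_eq_iff)
  then show ?thesis
    by (simp only:) (intro seminormed.add_mem[OF seminormed_sobolev] K u sobolev_one)
qed

text \<open>All levels of the scheme are the same function. The increment factors as expo (L x)
  times the remainder of exp at \<open>L h\<close>, so the quadratic remainder bound gives the
  derivative.\<close>

lemma smooth_expo:
  assumes r: "r > 1/2" and L: "bounded_linear_nspace E (sobolev r) L" and E: "seminormed E"
    and U: "U \<subseteq> pts E"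
  shows "smooth_nspace E (sobolev r) U (\<lambda>x. expo (L x))"
proof (rule smooth_nspace_scheme[where G = "\<lambda>k x. expo (L x)", OF _ _ L E seminormed_sobolev _
    sobolev_one])
  interpret A: seminormed "sobolev r" by (rule seminormed_sobolev)
  show alg: "bounded_bilinear_nspace (sobolev r) (sobolev r) (sobolev r) (*)"
    by (rule bounded_bilinear_sobolev_mult[OF r]) auto
  have Lm: "L x \<in> pts (sobolev r)" if "x \<in> pts E" for x by (rule bounded_linear_nspace_mem[OF L that])
  show em: "expo (L x) \<in> pts (sobolev r)" if "x \<in> U" for x
    using U that by (intro sobolev_expo r Lm) auto
  obtain C where C: "0 \<le> C" "\<And>x. x \<in> pts E \<Longrightarrow> nrm (sobolev r) (L x) \<le> C * nrm E x"
    by (rule bounded_linear_nspace_bound[OF L E], rule that)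
  obtain K0 where K0: "0 \<le> K0" "\<And>x y. x \<in> pts (sobolev r) \<Longrightarrow> y \<in> pts (sobolev r) \<Longrightarrow>
      nrm (sobolev r) (x * y) \<le> K0 * nrm (sobolev r) x * nrm (sobolev r) y"
    by (rule bounded_bilinear_nspace_bound[OF alg seminormed_sobolev seminormed_sobolev], rule that)
  obtain K where K: "0 \<le> K" "\<And>u. u \<in> pts (sobolev r) \<Longrightarrow> (\<lambda>p. exp (u p) - 1 - u p) \<in> pts (sobolev r)"
    "\<And>u. u \<in> pts (sobolev r) \<Longrightarrow> nrm (sobolev r) (\<lambda>p. exp (u p) - 1 - u p) \<le>
      (K * nrm (sobolev r) u)\<^sup>2 * exp (K * nrm (sobolev r) u)"
    by (rule sobolev_exp_remainder[OF r], rule that)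
  fix x assume x: "x \<in> U"
  have xE: "x \<in> pts E" using U x by auto
  define N where "N = nrm (sobolev r) (expo (L x))"
  have N0: "0 \<le> N" unfolding N_def by (rule A.nrm_ge0[OF em[OF x]])
  have lin: "bounded_linear_nspace E (sobolev r) (\<lambda>h. expo (L x) * L h)"
    by (rule bounded_linear_nspace_compose[OF L bilinear_right[OF alg seminormed_sobolev
        seminormed_sobolev em[OF x]] E seminormed_sobolev])
  \<comment> \<open>The error is at most \<open>D * n * n\<close> with n the norm of h; restricting
    to n at most 1 lets \<open>exp (K * C)\<close> bound the exponential factor.\<close>
  define D where "D = K0 * N * (K * C)\<^sup>2 * exp (K * C)"
  have D0: "0 \<le> D" using K0(1) N0 by (simp add: D_def)
  have "\<exists>\<delta>>0. \<forall>h\<in>pts E. nrm E h < \<delta> \<longrightarrow> x + h \<in> U \<longrightarrow>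
     nrm (sobolev r) (expo (L (x + h)) - expo (L x) - expo (L x) * L h) \<le> \<epsilon> * nrm E h" if e:
         "\<epsilon> > 0" for \<epsilon>
  proof (intro exI conjI ballI impI)
    show "0 < min 1 (\<epsilon> / (D + 1))" using e D0 by simp
    fix h assume h: "h \<in> pts E" "nrm E h < min 1 (\<epsilon> / (D + 1))" "x + h \<in> U"
    define n where "n = nrm E h"
    have n: "0 \<le> n" "n \<le> 1" "n \<le> \<epsilon> / (D + 1)" using h seminormed.nrm_ge0[OF E h(1)]
        by (auto simp: n_def)
    have Lxh: "L (x + h) = L x + L h" using L xE h(1) by (simp add: bounded_linear_nspace_def)
    have eq: "expo (L (x + h)) - expo (L x) - expo (L x) * L h
        = expo (L x) * (\<lambda>p. exp (L h p) - 1 - L h p)"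
      unfolding Lxh by (simp add: expo_def fun_eq_iff exp_add algebra_simps)
    have Kn: "K * nrm (sobolev r) (L h) \<le> (K * C) * n"
      using mult_left_mono[OF C(2)[OF h(1)] K(1)] by (simp add: n_def mult.assoc)
    have Kn0: "0 \<le> K * nrm (sobolev r) (L h)" using K(1) A.nrm_ge0[OF Lm[OF h(1)]] by simp
    have Kn1: "(K * C) * n \<le> (K * C) * 1" using K(1) C(1) n by (intro mult_left_mono) auto
    have "nrm (sobolev r) (expo (L x) * (\<lambda>p. exp (L h p) - 1 - L h p)) \<le>
       K0 * N * nrm (sobolev r) (\<lambda>p. exp (L h p) - 1 - L h p)"
      unfolding N_def by (rule K0(2)[OF em[OF x] K(2)[OF Lm[OF h(1)]]])
    also have "\<dots> \<le> K0 * N * (((K * C) * n)\<^sup>2 * exp (K * C))"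
    proof (rule mult_left_mono)
      have "nrm (sobolev r) (\<lambda>p. exp (L h p) - 1 - L h p) \<le> (K * nrm (sobolev r) (L h))\<^sup>2 * exp (K
          * nrm (sobolev r) (L h))"
        by (rule K(3)[OF Lm[OF h(1)]])
      also have "\<dots> \<le> ((K * C) * n)\<^sup>2 * exp (K * C)"
        by (rule mult_mono[OF power_mono[OF Kn Kn0]]) (use Kn Kn1 in auto)
      finally show "nrm (sobolev r) (\<lambda>p. exp (L h p) - 1 - L h p) \<le> ((K * C) * n)\<^sup>2 * exp (K * C)" .
    qed (use K0(1) N0 in simp)
    also have "\<dots> = (D * n) * n" by (simp add: D_def power2_eq_square mult_ac)
    also have "\<dots> \<le> \<epsilon> * n"
    proof (rule mult_right_mono[OF _ n(1)])
      have "D * n \<le> D * (\<epsilon> / (D + 1))" by (intro mult_left_mono n D0)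
      also have "\<dots> \<le> \<epsilon>" using D0 e by (simp add: field_simps)
      finally show "D * n \<le> \<epsilon>" .
    qed
    finally show "nrm (sobolev r) (expo (L (x + h)) - expo (L x) - expo (L x) * L h) \<le> \<epsilon> * nrm E h"
      unfolding eq n_def .
  qed
  with lin show "has_fderiv E (sobolev r) U (\<lambda>x. expo (L x)) (\<lambda>h. expo (L x) * L h) x"
    unfolding has_fderiv_def by blast
qed

lemma smooth_affine:
  assumes r: "r > 1/2" and L: "bounded_linear_nspace E (sobolev r) L" and E: "seminormed E"
    and U: "U \<subseteq> pts E" and a: "a \<in> pts (sobolev r)"
  shows "smooth_nspace E (sobolev r) U (\<lambda>x. a + L x)"
proof -
  interpret A: seminormed "sobolev r" by (rule seminormed_sobolev)
  \<comment> \<open>The tower of an affine map: its value, then the constant 1 multiplying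
    \<open>L h\<close>, then zero.\<close>
  define G where "G = (\<lambda>(k :: nat) x. if k = 0 then a + L x else if k
      = 1 then 1 else (0 :: circle \<Rightarrow> real))"
  have "smooth_nspace E (sobolev r) U (G 0)"
  proof (rule smooth_nspace_scheme[OF _ _ L E seminormed_sobolev _ sobolev_one])
    show "bounded_bilinear_nspace (sobolev r) (sobolev r) (sobolev r) (*)"
      by (rule bounded_bilinear_sobolev_mult[OF r]) auto
    show Gm: "G k x \<in> pts (sobolev r)" if "x \<in> U" for k x
      using U that bounded_linear_nspace_mem[OF L, of x] by (auto simp: G_def intro: A.add_mem a
          sobolev_one A.zero_mem)
    fix k x assume x: "x \<in> U"
    show "has_fderiv E (sobolev r) U (G k) (\<lambda>h. G (Suc k) x * L h) x"
    proof (cases "k = 0")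
      case True
      have "G k (x + h) - G k x - G (Suc k) x * L h = 0" if "h \<in> pts E" for h
      proof -
        have "L (x + h) = L x + L h" using L x U that by (auto simp: bounded_linear_nspace_def)
        then show ?thesis using True by (simp add: G_def)
      qed
      moreover have "(\<lambda>h. G (Suc k) x * L h) = L" using True by (simp add: G_def)
      ultimately show ?thesis unfolding has_fderiv_def
        using L seminormed.nrm_ge0[OF E] by (auto simp: A.nrm_zero intro!: exI[of _ 1])
    next
      case False
      have "has_fderiv E (sobolev r) U (\<lambda>x. if k = 1 then 1 else 0) (\<lambda>h. 0) x"
        by (rule has_fderiv_const[OF E seminormed_sobolev])
      moreover have "G k = (\<lambda>x. if k = 1 then 1 else 0)" "(\<lambda>h. G (Suc k) x * L h) = (\<lambda>h. 0)"
        using False by (simp_all add: G_def fun_eq_iff)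
      ultimately show ?thesis by simp
    qed
  qed
  then show ?thesis by (simp add: G_def)
qed

lemma bounded_linear_scaleR:
  assumes E: "seminormed E"
  shows "bounded_linear_nspace E E (\<lambda>x. c *\<^sub>R x)"
  unfolding bounded_linear_nspace_def
  using seminormed.scale_mem[OF E] seminormed.nrm_scale[OF E]
  by (auto simp: scaleR_add_right mult.commute intro: exI[of _ "\<bar>c\<bar>"])

text \<open>Pointwise nonvanishing gives membership of the reciprocals in \<open>H^r\<close> but no
  control of their norms. Near \<open>x\<close> that control comes from the identity y = I x - y (l
  I x): once l is small, the second term is absorbed into the left-hand side.\<close>

lemma smooth_recip:
  assumes r: "r > 3/2" and L: "bounded_linear_nspace E (sobolev r) L" and E: "seminormed E"
    and U: "U \<subseteq> pts E" and a: "a \<in> pts (sobolev r)" and nz: "\<And>x p. x \<in> U \<Longrightarrow> (a + L x) p \<noteq> 0"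
  shows "smooth_nspace E (sobolev r) U (\<lambda>x. recip (a + L x))"
proof -
  interpret A: seminormed "sobolev r" by (rule seminormed_sobolev)
  have r1: "r > 1/2" using r by simp
  have alg: "bounded_bilinear_nspace (sobolev r) (sobolev r) (sobolev r) (*)"
    by (rule bounded_bilinear_sobolev_mult[OF r1]) auto
  note mm = sobolev_mult_mem[OF r1]
  have Lm: "L x \<in> pts (sobolev r)" if "x \<in> pts E" for x by (rule bounded_linear_nspace_mem[OF L that])
  define I where "I = (\<lambda>x. recip (a + L x))"
  have Im: "I x \<in> pts (sobolev r)" if "x \<in> U" for x
    unfolding I_def recip_def using that U by (intro sobolev_inverse r A.add_mem a Lm nz) auto
  obtain C where C: "0 \<le> C" "\<And>x. x \<in> pts E \<Longrightarrow> nrm (sobolev r) (L x) \<le> C * nrm E x"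
    by (rule bounded_linear_nspace_bound[OF L E], rule that)
  obtain K where K: "0 \<le> K" "\<And>x y. x \<in> pts (sobolev r) \<Longrightarrow> y \<in> pts (sobolev r) \<Longrightarrow>
      nrm (sobolev r) (x * y) \<le> K * nrm (sobolev r) x * nrm (sobolev r) y"
    by (rule bounded_bilinear_nspace_bound[OF alg seminormed_sobolev seminormed_sobolev], rule that)
  have dI: "has_fderiv E (sobolev r) U I (\<lambda>h. (-1) *\<^sub>R (I x * I x * L h)) x" if x: "x \<in> U" for x
  proof -
    have xE: "x \<in> pts E" using U x by auto
    define N where "N = nrm (sobolev r) (I x)"
    have N0: "0 \<le> N" unfolding N_def by (rule A.nrm_ge0[OF Im[OF x]])
    have lin: "bounded_linear_nspace E (sobolev r) (\<lambda>h. (-1) *\<^sub>R (I x * I x * L h))"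
      by (intro bounded_linear_nspace_compose[OF bounded_linear_nspace_compose[OF L
          bilinear_right[OF alg seminormed_sobolev
          seminormed_sobolev] E seminormed_sobolev] bounded_linear_scaleR[OF seminormed_sobolev] E
              seminormed_sobolev] mm Im x)
    define D where "D = K * (K * N * N) * (K * C * (K * C * (2 * N)))"
    have D0: "0 \<le> D" using K(1) N0 C(1) by (simp add: D_def)
    \<comment> \<open>The radius within which the absorbed term has at most half the norm of
      \<open>y\<close>, so that \<open>y\<close> is bounded by \<open>2 * N\<close>.\<close>
    define d where "d = 1 / (2 * (K * K * N * C + 1))"
    have KN0: "0 \<le> K * K * N * C" using K(1) N0 C(1) by simp
    have d0: "0 < d" using KN0 by (simp add: d_def)
    have "\<exists>\<delta>>0. \<forall>h\<in>pts E. nrm E h < \<delta> \<longrightarrow> x + h \<in> U \<longrightarrow>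
       nrm (sobolev r) (I (x + h) - I x - (-1) *\<^sub>R (I x * I x * L h)) \<le> \<epsilon> * nrm E h" if e: "\<epsilon> > 0" for \<epsilon>
    proof (intro exI conjI ballI impI)
      show "0 < min d (\<epsilon> / (D + 1))" using e D0 d0 by simp
      fix h assume h: "h \<in> pts E" "nrm E h < min d (\<epsilon> / (D + 1))" "x + h \<in> U"
      define n where "n = nrm E h"
      have n: "0 \<le> n" "n \<le> d" "n \<le> \<epsilon> / (D + 1)" using h seminormed.nrm_ge0[OF E h(1)]
          by (auto simp: n_def)
      have Lxh: "L (x + h) = L x + L h" using L xE h(1) by (simp add: bounded_linear_nspace_def)
      define l where "l = L h"
      have l: "l \<in> pts (sobolev r)" "nrm (sobolev r) l \<le> C * n" unfolding l_def n_def by (rule Lm C h)+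
      note ge = A.nrm_ge0
      define y where "y = I (x + h)"
      have y: "y \<in> pts (sobolev r)" unfolding y_def by (rule Im[OF h(3)])
      have nz1: "(a + L x) p \<noteq> 0" "(a + L x) p + l p \<noteq> 0" for p
        using nz[OF x, of p] nz[OF h(3), of p] by (simp_all add: Lxh l_def add.assoc)
      have yp: "y p = inverse ((a + L x) p + l p)" "I x p = inverse ((a + L x) p)" for p
        by (simp_all add: y_def I_def recip_def Lxh l_def add.assoc)
      \<comment> \<open>With f = a + L x: 1/(f + l) = 1/f - (1/(f + l)) (l/f), which expresses
        \<open>y\<close> through itself with a small factor.\<close>
      have y1: "y = I x - y * (l * I x)"
      proof
        fix p
        have "inverse f - inverse (f + m) * (m * inverse f) = inverse (f + m)"
          if "f \<noteq> 0" "f + m \<noteq> 0" for f m :: real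
        proof -
          have "inverse f = inverse (f + m) * (f + m) * inverse f" using that by simp
          also have "\<dots> = inverse (f + m) * (f * inverse f) + inverse (f + m) * (m * inverse f)"
            by (simp only: distrib_left distrib_right mult.assoc)
          finally show ?thesis using that by simp
        qed
        from this[OF nz1[of p]] have "y p = I x p - y p * (l p * I x p)" unfolding yp by simp
        then show "y p = (I x - y * (l * I x)) p" by simp
      qed
      \<comment> \<open>The exact second-order remainder of the reciprocal is m^2 / (f^2 (f + m)).
        It is quadratic in m with coefficients already bounded in norm.\<close>
      have fl: "inverse (f + m) - inverse f + inverse f * inverse f * m
          = (inverse f * inverse f) * (m * (m * inverse (f + m)))"
        if "f \<noteq> 0" "f + m \<noteq> 0" for f m :: real
      proof -
        let ?X = "inverse (f + m) - inverse f + inverse f * inverse f * m"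
        have "((f * f) * (f + m)) * (inverse f * inverse f * inverse (f + m))
            = (f * inverse f) * (f * inverse f) * ((f + m) * inverse (f + m))" by (simp only: mult_ac)
        then have "((f * f) * (f + m)) * (inverse f * inverse f * inverse (f + m)) = 1" using that
            by simp
        then have "?X = ?X * (((f * f) * (f + m)) * (inverse f * inverse f * inverse (f + m)))" by simp
        also have "\<dots> = ((f * f) * (f + m)) * ?X * (inverse f * inverse f * inverse (f + m))"
          by (simp only: mult_ac)
        finally have "?X = ((f * f) * (f + m)) * ?X * (inverse f * inverse f * inverse (f + m))" .
        also have "((f * f) * (f + m)) * (inverse (f + m) - inverse f + inverse f * inverse f * m)
            = m * m"
        proof -
          have "((f * f) * (f + m)) * (inverse (f + m) - inverse f + inverse f * inverse f * m)
             = (f * f) * ((f + m) * inverse (f + m)) - (f * inverse f) * f * (f + m)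
                 + (f * inverse f) * (f * inverse f) * m * (f + m)"
            by (simp add: algebra_simps)
          moreover have "(f + m) * inverse (f + m) = 1" "f * inverse f = 1" using that by simp_all
          ultimately show ?thesis by (simp only:) (simp add: algebra_simps)
        qed
        finally show ?thesis by (simp add: mult_ac)
      qed
      have y2: "I (x + h) - I x - (-1) *\<^sub>R (I x * I x * L h) = (I x * I x) * (l * (l * y))"
      proof
        fix p
        have "y p - I x p + I x p * I x p * l p = (I x p * I x p) * (l p * (l p * y p))"
          unfolding yp by (rule fl[OF nz1])
        then show "(I (x + h) - I x - (-1) *\<^sub>R (I x * I x * L h)) p = ((I x * I x) * (l * (l * y))) p"
          by (simp add: scaleR_fun_def y_def l_def)
      qed
      have nl: "nrm (sobolev r) (l * I x) \<le> K * (C * n) * N"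
      proof -
        have "nrm (sobolev r) (l * I x) \<le> K * nrm (sobolev r) l * N"
          unfolding N_def by (rule K(2)[OF l(1) Im[OF x]])
        also have "\<dots> \<le> K * (C * n) * N" by (intro mult_right_mono mult_left_mono l K(1) N0)
        finally show ?thesis .
      qed
      have half: "K * (K * (C * n) * N) \<le> 1 / 2"
      proof -
        have "K * (K * (C * n) * N) = (K * K * N * C) * n" by (simp add: mult_ac)
        also have "\<dots> \<le> (K * K * N * C) * d" by (intro mult_left_mono n KN0)
        also have "\<dots> \<le> 1 / 2" using KN0 by (simp add: d_def field_simps)
        finally show ?thesis .
      qed
      have "nrm (sobolev r) y \<le> N + nrm (sobolev r) (y * (l * I x))"
        using A.nrm_diff[OF Im[OF x] mm[OF y mm[OF l(1) Im[OF x]]]] by (simp only: y1[symmetric] N_def)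
      also have "nrm (sobolev r) (y * (l * I x)) \<le> K * nrm (sobolev r) y * (K * (C * n) * N)"
        by (rule order.trans[OF K(2)[OF y mm[OF l(1) Im[OF x]]]])
          (intro mult_left_mono nl mult_nonneg_nonneg K(1) ge y)
      also have "\<dots> = nrm (sobolev r) y * (K * (K * (C * n) * N))" by (simp add: mult_ac)
      also have "\<dots> \<le> nrm (sobolev r) y * (1 / 2)" by (intro mult_left_mono half ge y)
      finally have ny: "nrm (sobolev r) y \<le> 2 * N" by simp
      have "nrm (sobolev r) (l * y) \<le> K * (C * n) * (2 * N)"
        by (rule order.trans[OF K(2)[OF l(1) y]])
          (intro mult_mono mult_left_mono mult_nonneg_nonneg l ny K(1) C(1) n(1) ge y)
      then have "nrm (sobolev r) (l * (l * y)) \<le> K * (C * n) * (K * (C * n) * (2 * N))"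
        by (intro order.trans[OF K(2)[OF l(1) mm[OF l(1) y]]] mult_mono mult_left_mono
            mult_nonneg_nonneg l K(1) C(1) n(1) ge mm y)
      then have "nrm (sobolev r) ((I x * I x) * (l * (l * y)))
          \<le> K * (K * N * N) * (K * (C * n) * (K * (C * n) * (2 * N)))"
        using K(2)[OF Im[OF x] Im[OF x], folded N_def]
        by (intro order.trans[OF K(2)[OF mm[OF Im[OF x] Im[OF x]] mm[OF l(1) mm[OF l(1) y]]]] mult_mono
            mult_left_mono mult_nonneg_nonneg K(1) N0 ge mm y l)
      also have "\<dots> = (D * n) * n" by (simp add: D_def mult_ac)
      also have "\<dots> \<le> \<epsilon> * n"
      proof (rule mult_right_mono[OF _ n(1)])
        have "D * n \<le> D * (\<epsilon> / (D + 1))" by (intro mult_left_mono n D0)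
        also have "\<dots> \<le> \<epsilon>" using D0 e by (simp add: field_simps)
        finally show "D * n \<le> \<epsilon>" .
      qed
      finally show "nrm (sobolev r) (I (x + h) - I x - (-1) *\<^sub>R (I x * I x * L h)) \<le> \<epsilon> * nrm E h"
        unfolding y2 n_def .
    qed
    with lin show ?thesis unfolding has_fderiv_def by blast
  qed
  \<comment> \<open>Higher derivatives involve powers of the reciprocal; the product rule gives them
    by induction from \<open>dI\<close>.\<close>
  define P where "P = (\<lambda>n x p. I x p ^ n)"
  have P_Suc: "P (Suc n) x = I x * P n x" for n x by (simp add: P_def fun_eq_iff)
  have P_1: "P (Suc 0) x = I x" for x by (simp add: P_def)
  have Pm: "P (Suc n) x \<in> pts (sobolev r)" if "x \<in> U" for n x
  proof (induction n)
    case 0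
    then show ?case unfolding P_1 by (rule Im[OF that])
  next
    case (Suc n)
    show ?case unfolding P_Suc[of "Suc n"] by (rule mm[OF Im[OF that] Suc])
  qed
  have dP: "has_fderiv E (sobolev r) U (P (Suc n)) (\<lambda>h. (- real (Suc n)) *\<^sub>R (P (Suc (Suc n)) x *
      L h)) x"
    if x: "x \<in> U" for n x
  proof (induction n)
    case 0
    show ?case
      by (rule has_fderiv_cong[OF dI[OF x] x _ _ E]) (simp_all add: P_def fun_eq_iff scaleR_fun_def)
  next
    case (Suc n)
    show ?case
    proof (rule has_fderiv_cong[OF has_fderiv_bilinear[OF dI[OF x] Suc x Im Pm alg E
          seminormed_sobolev seminormed_sobolev seminormed_sobolev] x _ _ E])
      show "I y * P (Suc n) y = P (Suc (Suc n)) y" for y by (rule P_Suc[symmetric])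
      show "((-1) *\<^sub>R (I x * I x * L h)) * P (Suc n) x + I x * ((- real (Suc n)) *\<^sub>R (P (Suc (Suc
          n)) x * L h))
         = (- real (Suc (Suc n))) *\<^sub>R (P (Suc (Suc (Suc n))) x * L h)" for h
      proof
        fix p
        show "(((-1) *\<^sub>R (I x * I x * L h)) * P (Suc n) x + I x * ((- real (Suc n)) *\<^sub>R (P (Suc
            (Suc n)) x * L h))) p
         = ((- real (Suc (Suc n))) *\<^sub>R (P (Suc (Suc (Suc n))) x * L h)) p"
          unfolding plus_fun_apply times_fun_apply scaleR_fun_def P_def by (simp add: algebra_simps)
      qed
    qed
  qed
  \<comment> \<open>The factor (-1)^k k! absorbs the coefficient - (k + 1) from differentiating the
    power of index k + 1, putting the family in the form the scheme asks for.\<close>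
  define G where "G = (\<lambda>k x. ((- 1) ^ k * fact k) *\<^sub>R P (Suc k) x)"
  have "smooth_nspace E (sobolev r) U (G 0)"
  proof (rule smooth_nspace_scheme[OF _ _ L E seminormed_sobolev alg sobolev_one])
    show "G k x \<in> pts (sobolev r)" if "x \<in> U" for k x
      unfolding G_def by (intro A.scale_mem Pm that)
    show "has_fderiv E (sobolev r) U (G k) (\<lambda>h. G (Suc k) x * L h) x" if x: "x \<in> U" for k x
    proof (rule has_fderiv_cong[OF has_fderiv_linear[OF dP[OF x] x Pm bounded_linear_scaleR[OF
        seminormed_sobolev] E seminormed_sobolev] x _ _ E])
      show "((- 1) ^ k * fact k) *\<^sub>R P (Suc k) y = G k y" for y by (simp add: G_def)
      show "((- 1) ^ k * fact k) *\<^sub>R (- real (Suc k)) *\<^sub>R (P (Suc (Suc k)) x * L h)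
          = G (Suc k) x * L h" for h
        by (simp add: G_def fun_eq_iff scaleR_fun_def algebra_simps)
    qed
  qed
  moreover have "G 0 = (\<lambda>x. recip (a + L x))" by (simp add: G_def P_1 I_def fun_eq_iff)
  ultimately show ?thesis by simp
qed

section \<open>Bilinear maps\<close>

lemma bilinear_compose_linear:
  assumes B: "bounded_bilinear_nspace E F G B" and L: "bounded_linear_nspace G H L"
    and "seminormed E" "seminormed F" "seminormed G"
  shows "bounded_bilinear_nspace E F H (\<lambda>x y. L (B x y))"
proof -
  obtain C where C: "0 \<le> C" "\<And>x y. x \<in> pts E \<Longrightarrow> y \<in> pts F \<Longrightarrow> nrm G (B x y) \<le> C * nrm E x * nrm F y"
    by (rule bounded_bilinear_nspace_bound[OF B assms(3,4)], rule that)
  obtain D where D: "0 \<le> D" "\<And>x. x \<in> pts G \<Longrightarrow> nrm H (L x) \<le> D * nrm G x"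
    by (rule bounded_linear_nspace_bound[OF L assms(5)], rule that)
  have "nrm H (L (B x y)) \<le> (D * C) * nrm E x * nrm F y" if "x \<in> pts E" "y \<in> pts F" for x y
  proof -
    have "B x y \<in> pts G" using B that by (simp add: bounded_bilinear_nspace_def)
    from D(2)[OF this] mult_left_mono[OF C(2)[OF that] D(1)] show ?thesis by (simp add: mult.assoc)
  qed
  then have "\<exists>C. \<forall>x\<in>pts E. \<forall>y\<in>pts F. nrm H (L (B x y)) \<le> C * nrm E x * nrm F y" by blast
  then show ?thesis using B L unfolding bounded_bilinear_nspace_def bounded_linear_nspace_def by simp
qed

lemma bilinear_precompose_linear:
  assumes B: "bounded_bilinear_nspace F G H B" and L: "bounded_linear_nspace E F L"
      and M: "bounded_linear_nspace E' G M"
    and "seminormed E" "seminormed E'" "seminormed F" "seminormed G"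
  shows "bounded_bilinear_nspace E E' H (\<lambda>x y. B (L x) (M y))"
proof -
  obtain C where C: "0 \<le> C" "\<And>x y. x \<in> pts F \<Longrightarrow> y \<in> pts G \<Longrightarrow> nrm H (B x y) \<le> C * nrm F x * nrm G y"
    by (rule bounded_bilinear_nspace_bound[OF B assms(6,7)], rule that)
  obtain D where D: "0 \<le> D" "\<And>x. x \<in> pts E \<Longrightarrow> nrm F (L x) \<le> D * nrm E x"
    by (rule bounded_linear_nspace_bound[OF L assms(4)], rule that)
  obtain D' where D': "0 \<le> D'" "\<And>x. x \<in> pts E' \<Longrightarrow> nrm G (M x) \<le> D' * nrm E' x"
    by (rule bounded_linear_nspace_bound[OF M assms(5)], rule that)
  have "nrm H (B (L x) (M y)) \<le> (C * D * D') * nrm E x * nrm E' y" if "x \<in> pts E" "y \<in> pts E'" for x y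
  proof -
    have m: "L x \<in> pts F" "M y \<in> pts G" using L M that by (auto simp: bounded_linear_nspace_def)
    have "nrm H (B (L x) (M y)) \<le> C * nrm F (L x) * nrm G (M y)" by (rule C(2)[OF m])
    also have "\<dots> \<le> C * (D * nrm E x) * (D' * nrm E' y)"
      using that m assms(4-7) by (intro mult_mono mult_left_mono mult_nonneg_nonneg C D D'
          seminormed.nrm_ge0) auto
    finally show ?thesis by (simp add: mult_ac)
  qed
  then have "\<exists>C. \<forall>x\<in>pts E. \<forall>y\<in>pts E'. nrm H (B (L x) (M y)) \<le> C * nrm E x * nrm E' y" by blast
  then show ?thesis using B L M unfolding bounded_bilinear_nspace_def bounded_linear_nspace_def by simp
qed

lemma bilinear_flip:
  "bounded_bilinear_nspace E F G B \<Longrightarrow> bounded_bilinear_nspace F E G (\<lambda>x y. B y x)"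
  unfolding bounded_bilinear_nspace_def by (auto simp: mult_ac) (metis mult.assoc mult.commute)

lemma bilinear_add:
  assumes B: "bounded_bilinear_nspace E F G B" and B': "bounded_bilinear_nspace E F G B'"
    and "seminormed E" "seminormed F" "seminormed G"
  shows "bounded_bilinear_nspace E F G (\<lambda>x y. B x y + B' x y)"
proof -
  obtain C where C: "0 \<le> C" "\<And>x y. x \<in> pts E \<Longrightarrow> y \<in> pts F \<Longrightarrow> nrm G (B x y) \<le> C * nrm E x * nrm F y"
    by (rule bounded_bilinear_nspace_bound[OF B assms(3,4)], rule that)
  obtain C' where C': "0 \<le> C'" "\<And>x y. x \<in> pts E \<Longrightarrow> y \<in> pts F \<Longrightarrow> nrm G (B' x y) \<le> C' * nrm E x * nrm F y"
    by (rule bounded_bilinear_nspace_bound[OF B' assms(3,4)], rule that)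
  have "nrm G (B x y + B' x y) \<le> (C + C') * nrm E x * nrm F y" if "x \<in> pts E" "y \<in> pts F" for x y
  proof -
    have "B x y \<in> pts G" "B' x y \<in> pts G" using B B' that by (auto simp: bounded_bilinear_nspace_def)
    from seminormed.nrm_add[OF assms(5) this] C(2)[OF that] C'(2)[OF that] show ?thesis
        by (simp add: algebra_simps)
  qed
  then have "\<exists>C. \<forall>x\<in>pts E. \<forall>y\<in>pts F. nrm G (B x y + B' x y) \<le> C * nrm E x * nrm F y" by blast
  then show ?thesis using B B' seminormed.add_mem[OF assms(5)]
    unfolding bounded_bilinear_nspace_def by (simp add: scaleR_add_right add_ac)
qed

text \<open>The normalisation that the carrier of \<open>L2sym\<close> demands.\<close>

definition restrict2 :: "'a nspace \<Rightarrow> ('a \<Rightarrow> 'a \<Rightarrow> 'b::zero) \<Rightarrow> 'a \<Rightarrow> 'a \<Rightarrow> 'b" where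
  "restrict2 E B = (\<lambda>x y. if x \<in> pts E \<and> y \<in> pts E then B x y else 0)"

lemma restrict2_L2sym:
  assumes B: "bounded_bilinear_nspace E E F B" and sym: "\<And>x y. B x y = B y x" and E: "seminormed E"
  shows "restrict2 E B \<in> pts (L2sym E F)"
proof -
  have "\<exists>C. \<forall>x\<in>pts E. \<forall>y\<in>pts E. nrm F (restrict2 E B x y) \<le> C * nrm E x * nrm E y"
    using B by (simp add: bounded_bilinear_nspace_def restrict2_def)
  then show ?thesis
    using B sym seminormed.add_mem[OF E] seminormed.scale_mem[OF E]
    unfolding L2sym_pts_iff bounded_bilinear_nspace_def by (simp add: restrict2_def)
qed

text \<open>Applying \<open>B a\<close> to the values of M preserves bilinearity and symmetry in (X,
  Y), with an operator norm bounded in both a and M. Thus smoothness of a coefficient in a function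
  space becomes smoothness in operator norm.\<close>

lemma bilinear_L2sym:
  assumes B: "bounded_bilinear_nspace F G H B"
    and E: "seminormed E" and F: "seminormed F" and G: "seminormed G" and H: "seminormed H"
  shows "bounded_bilinear_nspace F (L2sym E G) (L2sym E H) (\<lambda>a M X Y. B a (M X Y))"
proof -
  obtain C where C: "0 \<le> C" "\<And>x y. x \<in> pts F \<Longrightarrow> y \<in> pts G \<Longrightarrow> nrm H (B x y) \<le> C * nrm F x * nrm G y"
    by (rule bounded_bilinear_nspace_bound[OF B F G], rule that)
  have Mm: "M X Y \<in> pts G" if "M \<in> pts (L2sym E G)" for M X Y
    using that seminormed.zero_mem[OF G] unfolding L2sym_pts_iff by (cases "X \<in> pts E \<and> Y \<in> pts E") auto
  have B0: "B a 0 = 0" if "a \<in> pts F" for a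
    by (rule bounded_linear_nspace_zero[OF bilinear_right[OF B F G that] G])
  note Bs = B[unfolded bounded_bilinear_nspace_def]
  have bd: "nrm H (B a (M X Y)) \<le> (C * nrm F a * nrm (L2sym E G) M) * nrm E X * nrm E Y"
    if "a \<in> pts F" "M \<in> pts (L2sym E G)" "X \<in> pts E" "Y \<in> pts E" for a M X Y
  proof -
    have "nrm H (B a (M X Y)) \<le> C * nrm F a * nrm G (M X Y)" by (rule C(2)[OF that(1) Mm[OF that(2)]])
    also have "\<dots> \<le> C * nrm F a * (nrm (L2sym E G) M * nrm E X * nrm E Y)"
      by (intro mult_left_mono L2sym_nrm(2)[OF E that(2-4)] mult_nonneg_nonneg C
          seminormed.nrm_ge0[OF F] that)
    finally show ?thesis by (simp add: mult_ac)
  qed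
  have mem: "(\<lambda>X Y. B a (M X Y)) \<in> pts (L2sym E H)" if a: "a \<in> pts F" and M: "M \<in> pts (L2sym E G)"
      for a M
    unfolding L2sym_pts_iff
  proof (intro conjI allI ballI impI)
    show "\<exists>C. \<forall>X\<in>pts E. \<forall>Y\<in>pts E. nrm H (B a (M X Y)) \<le> C * nrm E X * nrm E Y"
      using bd[OF a M] by blast
    show "B a (M X Y) = 0" if "\<not> (X \<in> pts E \<and> Y \<in> pts E)" for X Y
    proof -
      have "M X Y = 0" using M that unfolding L2sym_pts_iff by blast
      then show ?thesis using B0[OF a] by simp
    qed
    show "B a (M X Y) \<in> pts H" for X Y using Bs a Mm[OF M] by simp
    show "B a (M X Y) = B a (M Y X)" if "X \<in> pts E" "Y \<in> pts E" for X Y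
      using M that unfolding L2sym_pts_iff by metis
    show "B a (M (X + Y) Z) = B a (M X Z) + B a (M Y Z)" if "X \<in> pts E" "Y \<in> pts E" "Z \<in> pts E"
        for X Y Z
    proof -
      have "M (X + Y) Z = M X Z + M Y Z" using M that unfolding L2sym_pts_iff by blast
      then show ?thesis using Bs a Mm[OF M] by simp
    qed
    show "B a (M (c *\<^sub>R X) Z) = c *\<^sub>R B a (M X Z)" if "X \<in> pts E" "Z \<in> pts E" for X Z c
    proof -
      have "M (c *\<^sub>R X) Z = c *\<^sub>R M X Z" using M that unfolding L2sym_pts_iff by blast
      then show ?thesis using Bs a Mm[OF M] by simp
    qed
  qed
  have nrm: "nrm (L2sym E H) (\<lambda>X Y. B a (M X Y)) \<le> C * nrm F a * nrm (L2sym E G) M"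
    if "a \<in> pts F" "M \<in> pts (L2sym E G)" for a M
    using bd[OF that] C(1) seminormed.nrm_ge0[OF F that(1)] L2sym_nrm(1)[OF E that(2)]
    by (intro L2sym_nrm(3)[OF E mem[OF that]]) auto
  then have ex: "\<exists>C. \<forall>a\<in>pts F. \<forall>M\<in>pts (L2sym E G). nrm (L2sym E H) (\<lambda>X Y. B a (M X Y))
      \<le> C * nrm F a * nrm (L2sym E G) M"
    by blast
  show ?thesis unfolding bounded_bilinear_nspace_def
  proof (intro conjI ballI allI ex mem)
    fix a b M N c assume ab: "a \<in> pts F" and M: "M \<in> pts (L2sym E G)"
    show "(\<lambda>X Y. B (a + b) (M X Y)) = (\<lambda>X Y. B a (M X Y)) + (\<lambda>X Y. B b (M X Y))" if "b \<in> pts F"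
      using Bs ab that Mm[OF M] by (simp add: fun_eq_iff)
    show "(\<lambda>X Y. B a ((M + N) X Y)) = (\<lambda>X Y. B a (M X Y)) + (\<lambda>X Y. B a (N X Y))" if "N
        \<in> pts (L2sym E G)"
      using Bs ab Mm[OF M] Mm[OF that] by (simp add: fun_eq_iff)
    show "(\<lambda>X Y. B (c *\<^sub>R a) (M X Y)) = c *\<^sub>R (\<lambda>X Y. B a (M X Y))"
      using Bs ab Mm[OF M] by (simp add: fun_eq_iff scaleR_fun_def)
    show "(\<lambda>X Y. B a ((c *\<^sub>R M) X Y)) = c *\<^sub>R (\<lambda>X Y. B a (M X Y))"
      using Bs ab Mm[OF M] by (simp add: fun_eq_iff scaleR_fun_def)
  qed
qed

lemma bounded_linear_fst: "bounded_linear_nspace (nprod E F) E fst"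
  unfolding bounded_linear_nspace_def
  using nprod_fst_le[of E _ F] by (auto simp: nprod_def intro!: exI[of _ 1])

lemma bounded_linear_snd: "bounded_linear_nspace (nprod E F) F snd"
  unfolding bounded_linear_nspace_def
  using nprod_snd_le[of F _ E] by (auto simp: nprod_def intro!: exI[of _ 1])

lemma bounded_linear_inl: "seminormed E \<Longrightarrow> seminormed F \<Longrightarrow> bounded_linear_nspace E (nprod E F) (\<lambda>x.
    (x, 0))"
  unfolding bounded_linear_nspace_def
  by (auto simp: nprod_def seminormed.zero_mem seminormed.nrm_zero seminormed.nrm_ge0 intro!:
      exI[of _ 1])

lemma bounded_linear_inr: "seminormed E \<Longrightarrow> seminormed F \<Longrightarrow> bounded_linear_nspace F (nprod E F) (\<lambda>x.
    (0, x))"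
  unfolding bounded_linear_nspace_def
  by (auto simp: nprod_def seminormed.zero_mem seminormed.nrm_zero seminormed.nrm_ge0 intro!:
      exI[of _ 1])

section \<open>The inverse of the Helmholtz operator\<close>

lemma fourier_helmholtz:
  assumes s: "s > 5/2" and u: "u \<in> pts (sobolev s)"
  shows "fourier (helmholtz u) k = of_real (symbol k) * fourier u k"
proof -
  have 1: "C1 u" by (rule sobolev_C1[OF _ u]) (use s in simp)
  have 2: "C1 (Dx u)" by (rule sobolev_C1[OF _ sobolev_Dx(1)[OF _ u]]) (use s in simp_all)
  have "helmholtz u = u + (-1) *\<^sub>R Dx (Dx u)" by (simp add: helmholtz_def)
  then have "fourier (helmholtz u) k = fourier u k - (2 * of_real pi * of_int k * \<i>) * ((2 *
      of_real pi * of_int k * \<i>) * fourier u k)"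
    using fourier_add[OF C1_cts[OF 1] cts_scale[OF C1_cts_Dx[OF 2], of "-1"], of k]
      fourier_scale[of "-1" "Dx (Dx u)" k] fourier_Dx[OF 2, of k] fourier_Dx[OF 1, of k] by simp
  also have "\<dots> = of_real (symbol k) * fourier u k"
    by (simp add: symbol_def power2_eq_square algebra_simps)
  finally show ?thesis .
qed

text \<open>A multiplies Fourier coefficients by the positive symbol and is therefore injective on
  \<open>H^s\<close>. As the inverse is chosen within \<open>H^s\<close>, any solution offered must
  be shown to lie there.\<close>

lemma Ainv_eqI:
  assumes s: "s > 5/2" and W: "W \<in> pts (sobolev s)" and eq: "helmholtz W = g"
  shows "Ainv s g = W"
  unfolding Ainv_def
proof (rule inv_into_f_eq[where f = helmholtz, OF _ W eq], rule inj_onI)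
  fix x y assume x: "x \<in> pts (sobolev s)" and y: "y \<in> pts (sobolev s)" and h: "helmholtz x
      = helmholtz y"
  show "x = y"
  proof (rule fourier_unique)
    show "fourier x k = fourier y k" for k
      using fourier_helmholtz[OF s x, of k] fourier_helmholtz[OF s y, of k] h symbol_pos[of k] by simp
  qed (use sobolev_cts[OF x] sobolev_cts[OF y] in \<open>simp_all add: cts_def\<close>)
qed

text \<open>The conjugate of \<open>A\<^sup>-\<^sup>1\<close> by composition with \<open>x + w(x)\<close>, applied to \<open>q / (1 + w\<^sub>x)\<close>: the two
  factors of \<open>A\<^sup>-\<^sup>1\<close> are conjugate to \<open>(1 \<plusminus> \<partial>\<^sub>x)\<^sup>-\<^sup>1\<close> by multiplication with \<open>exp (\<plusminus> w)\<close>.\<close>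

definition conj_Ainv :: "(circle \<Rightarrow> real) \<Rightarrow> (circle \<Rightarrow> real) \<Rightarrow> circle \<Rightarrow> real" where
  "conj_Ainv w q = expo w * resolvent (- 1) ((expo ((-2) *\<^sub>R w) * (1
      + Dx w)) * resolvent 1 (expo w * q))"

lemma C1_expo:
  assumes "C1 w"
  shows "C1 (expo w)" "Dx (expo w) = expo w * Dx w"
proof -
  have "cts (expo w)" using C1_cts[OF assms] unfolding cts_def expo_def by (intro continuous_intros)
  from C1_compose[OF assms DERIV_exp this[unfolded expo_def]]
  show "C1 (expo w)" "Dx (expo w) = expo w * Dx w" by (simp_all add: expo_def)
qed

context sobolev_diffeo
begin

lemma expo_sobolev: "expo (c *\<^sub>R u) \<in> pts (sobolev s)"
  using s by (intro sobolev_expo seminormed.scale_mem[OF seminormed_sobolev] u) simp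

text \<open>Each resolvent regains one order, from s - 2 to s - 1 to s. The coefficient between them
  contains \<phi>_x and has order s - 1, exactly what the intermediate space tolerates.\<close>

lemma conj_Ainv_linear:
  "bounded_linear_nspace (sobolev (s - 2)) (sobolev s) (conj_Ainv u)"
proof -
  note S = seminormed_sobolev
  have e: "expo u \<in> pts (sobolev s)" using expo_sobolev[of 1] by simp
  have ej: "expo ((-2) *\<^sub>R u) * jacobian \<in> pts (sobolev (s - 1))"
    using s by (intro sobolev_mult_mem sobolev_mono(1)[OF _ expo_sobolev] jacobian_sobolev) auto
  have j: "1 + Dx u = jacobian" by (simp add: jacobian_def fun_eq_iff)
  have 1: "bounded_linear_nspace (sobolev (s - 2)) (sobolev (s - 2)) (\<lambda>q. expo u * q)"
    using s by (intro bilinear_right[OF bounded_bilinear_sobolev_mult S S e]) auto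
  have 2: "bounded_linear_nspace (sobolev (s - 2)) (sobolev (s - 1)) (resolvent 1)"
    using bounded_linear_resolvent[of 1 "s - 2"] by simp
  have 3: "bounded_linear_nspace (sobolev (s - 1)) (sobolev (s - 1)) (\<lambda>q. (expo ((-2) *\<^sub>R u) *
      jacobian) * q)"
    using s by (intro bilinear_right[OF bounded_bilinear_sobolev_mult S S ej]) auto
  have 4: "bounded_linear_nspace (sobolev (s - 1)) (sobolev s) (resolvent (- 1))"
    using bounded_linear_resolvent[of "- 1" "s - 1"] by simp
  have 5: "bounded_linear_nspace (sobolev s) (sobolev s) (\<lambda>q. expo u * q)"
    using s by (intro bilinear_right[OF bounded_bilinear_sobolev_mult S S e]) auto
  show ?thesis
    unfolding conj_Ainv_def[abs_def] j
    by (intro bounded_linear_nspace_compose[OF bounded_linear_nspace_compose[OF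
        bounded_linear_nspace_compose[OF
      bounded_linear_nspace_compose[OF 1 2 S S] 3 S S] 4 S S] 5 S S])
qed

text \<open>The candidate is checked against A rather than derived. Its membership in
  \<open>H^s\<close> is where preservation of \<open>H^s\<close> under composition with \<phi>^-1 is
  used; the equation itself reduces to two first-order identities at the source point.\<close>

lemma Ainv_comp:
  assumes q: "q \<in> pts (sobolev (s - 2))"
  shows "Ainv s ((q * inv_jacobian) \<circ> inv_diffeo) = conj_Ainv u q \<circ> inv_diffeo"
proof (rule Ainv_eqI[OF s])
  let ?W = "conj_Ainv u q"
  have Wm: "?W \<in> pts (sobolev s)" by (rule bounded_linear_nspace_mem[OF conj_Ainv_linear q])
  then show "?W \<circ> inv_diffeo \<in> pts (sobolev s)" by (rule sobolev_comp)
  define e where "e = expo u"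
  define em where "em = expo ((-1) *\<^sub>R u)"
  define e2 where "e2 = expo ((-2) *\<^sub>R u)"
  define Y where "Y = resolvent 1 (e * q)"
  define z where "z = resolvent (- 1) ((e2 * jacobian) * Y)"
  have j: "1 + Dx u = jacobian" by (simp add: jacobian_def fun_eq_iff)
  have W: "?W = e * z" by (simp add: conj_Ainv_def e_def z_def Y_def e2_def j)
  have e: "C1 e" "Dx e = e * Dx u" unfolding e_def by (rule C1_expo[OF C1_u])+
  have mu: "C1 ((-1) *\<^sub>R u)" "Dx ((-1) *\<^sub>R u) = (-1) *\<^sub>R Dx u" by (rule Dx_scale[OF C1_u])+
  have em: "C1 em" "Dx em = em * ((-1) *\<^sub>R Dx u)" unfolding em_def using C1_expo[OF mu(1)] mu(2)
      by simp_all
  have Y: "C1 Y" "Y + 1 *\<^sub>R Dx Y = e * q" unfolding Y_def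
    using resolvent[of 1 "e * q"] cts_mult[OF C1_cts[OF e(1)] sobolev_cts[OF q]] by auto
  have ce2: "cts e2" unfolding e2_def by (rule sobolev_cts[OF expo_sobolev])
  have z: "C1 z" "z + (-1) *\<^sub>R Dx z = (e2 * jacobian) * Y" unfolding z_def
    using resolvent[of "- 1" "(e2 * jacobian) * Y"] cts_mult[OF cts_mult[OF ce2 cts_jacobian]
        C1_cts[OF Y(1)]] by auto
  have ee: "e p * em p = 1" "e p * e2 p = em p" for p
    by (simp_all add: e_def em_def e2_def expo_def scaleR_fun_def flip: exp_add)
  have JJ: "jacobian p * inv_jacobian p = 1" for p
    using jacobian_pos[of p] by (simp add: inv_jacobian_def)
  have jp: "jacobian p = 1 + Dx u p" for p by (simp add: jacobian_def)
  have Yp: "Dx Y p = e p * q p - Y p" for p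
    using fun_cong[OF Y(2), of p] by simp
  have zp: "Dx z p = z p - e2 p * jacobian p * Y p" for p
    using fun_cong[OF z(2), of p] by (simp add: scaleR_fun_def)
  \<comment> \<open>The intermediate function of the factorisation: with d = (1/\<phi>_x) Dx, the
    identities are W - d W = V (\<open>DW\<close>) and V + d V = q/\<phi>_x
    (\<open>DV\<close>).\<close>
  define V where "V = em * Y"
  have CW: "C1 ?W" unfolding W by (rule C1_rules(3)[OF e(1) z(1)])
  have CV: "C1 V" unfolding V_def by (rule C1_rules(3)[OF em(1) Y(1)])
  have DW: "Dx ?W p * inv_jacobian p = ?W p - V p" for p
  proof -
    have "Dx ?W p = e p * Dx u p * z p + e p * (z p - e2 p * jacobian p * Y p)"
      unfolding W C1_rules(4)[OF e(1) z(1)] e(2) by (simp add: zp)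
    also have "\<dots> = jacobian p * (e p * z p) - jacobian p * ((e p * e2 p) * Y p)"
      by (simp add: jp algebra_simps)
    also have "\<dots> = jacobian p * (?W p - V p)"
      by (simp add: ee W V_def right_diff_distrib)
    finally have "Dx ?W p * inv_jacobian p = (jacobian p * inv_jacobian p) * (?W p - V p)"
        by (simp only: mult_ac)
    then show ?thesis by (simp add: JJ)
  qed
  have DV: "Dx V p * inv_jacobian p = q p * inv_jacobian p - V p" for p
  proof -
    have "Dx V p = em p * ((-1) * Dx u p) * Y p + em p * (e p * q p - Y p)"
      unfolding V_def C1_rules(4)[OF em(1) Y(1)] em(2) by (simp add: Yp scaleR_fun_def)
    also have "\<dots> = (e p * em p) * q p - jacobian p * V p"
      by (simp add: jp V_def algebra_simps)
    finally have dV: "Dx V p = q p - jacobian p * V p" by (simp add: ee)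
    have "Dx V p * inv_jacobian p = q p * inv_jacobian p - (jacobian p * inv_jacobian p) * V p"
      unfolding dV by (simp add: algebra_simps)
    then show ?thesis by (simp add: JJ)
  qed
  have D1: "Dx (?W \<circ> inv_diffeo) = (?W + (-1) *\<^sub>R V) \<circ> inv_diffeo"
    unfolding C1_comp(2)[OF CW] using DW by (simp add: fun_eq_iff scaleR_fun_def)
  have CmV: "C1 ((-1) *\<^sub>R V)" "Dx ((-1) *\<^sub>R V) = (-1) *\<^sub>R Dx V" by (rule Dx_scale[OF CV])+
  have D2: "Dx (Dx (?W \<circ> inv_diffeo)) = ((Dx ?W + (-1) *\<^sub>R Dx V) * inv_jacobian) \<circ> inv_diffeo"
    unfolding D1 C1_comp(2)[OF C1_rules(1)[OF CW CmV(1)]] C1_rules(2)[OF CW CmV(1)] CmV(2) ..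
  show "helmholtz (?W \<circ> inv_diffeo) = (q * inv_jacobian) \<circ> inv_diffeo"
    unfolding helmholtz_def D2
  proof
    fix p
    let ?p = "inv_diffeo p"
    have "(Dx ?W ?p + (-1) * Dx V ?p) * inv_jacobian ?p = ?W ?p - q ?p * inv_jacobian ?p"
      using DW[of ?p] DV[of ?p] by (simp add: algebra_simps)
    then show "((?W \<circ> inv_diffeo) - (((Dx ?W + (-1) *\<^sub>R Dx V) * inv_jacobian) \<circ> inv_diffeo)) p
        = ((q * inv_jacobian) \<circ> inv_diffeo) p"
      by (simp add: scaleR_fun_def)
  qed
qed

end

section \<open>The Christoffel map\<close>

text \<open>The combined argument of A^-1 in the first component, multiplied by \<phi>_x. After
  conjugation every term carries one factor 1/\<phi>_x, so this expression is the same at all base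
  points.\<close>

definition source1 :: "real \<Rightarrow> (circle \<Rightarrow> real) \<times> (circle \<Rightarrow> real) \<Rightarrow> (circle \<Rightarrow> real) \<times> (circle \<Rightarrow>
    real) \<Rightarrow> circle \<Rightarrow> real" where
  "source1 s = restrict2 (tangent_space s) (\<lambda>X Y. Dx (snd X * snd Y) + (- 3/2) *\<^sub>R Dx (fst X * fst Y)
     + (- 1/2) *\<^sub>R (Dx (fst X) * snd Y + Dx (fst Y) * snd X))"

definition source2 :: "real \<Rightarrow> (circle \<Rightarrow> real) \<times> (circle \<Rightarrow> real) \<Rightarrow> (circle \<Rightarrow> real) \<times> (circle \<Rightarrow>
    real) \<Rightarrow> circle \<Rightarrow> real" where
  "source2 s = restrict2 (tangent_space s) (\<lambda>X Y. Dx (fst X) * snd Y + Dx (fst Y) * snd X)"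

text \<open>The Christoffel map at the diffeomorphism \<open>x + w(x)\<close>: all dependence on the base point is
  through \<open>exp (\<plusminus> w)\<close>, \<open>w\<^sub>x\<close> and \<open>1 / (1 + w\<^sub>x)\<close>, and no composition is left.\<close>

definition spray :: "real \<Rightarrow> (circle \<Rightarrow> real)
    \<Rightarrow> (circle \<Rightarrow> real) \<times> (circle \<Rightarrow> real) \<Rightarrow> (circle \<Rightarrow> real) \<times> (circle \<Rightarrow> real) \<Rightarrow> (circle \<Rightarrow> real) \<times>
        (circle \<Rightarrow> real)" where
  "spray s w = (\<lambda>X Y. (conj_Ainv w (source1 s X Y), 0))
     + (\<lambda>X Y. (0, (- 1) *\<^sub>R (recip (1 + Dx w) * source2 s X Y)))"

lemma seminormed_tangent_space: "seminormed (tangent_space s)"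
  unfolding tangent_space_def by (intro seminormed_nprod seminormed_sobolev)

context
  fixes s :: real
  assumes s: "s > 5/2"
begin

private lemma S: "seminormed (sobolev r)"
  by (rule seminormed_sobolev)

private lemma E: "seminormed (tangent_space s)"
  by (rule seminormed_tangent_space)

lemma bounded_linear_fst_tangent: "bounded_linear_nspace (tangent_space s) (sobolev s) fst"
  unfolding tangent_space_def by (rule bounded_linear_fst)

lemma bounded_linear_snd_tangent: "bounded_linear_nspace (tangent_space s) (sobolev (s - 1)) snd"
  unfolding tangent_space_def by (rule bounded_linear_snd)

lemma bounded_linear_Dx_fst: "bounded_linear_nspace (tangent_space s) (sobolev (s - 1)) (\<lambda>X. Dx
    (fst X))"
  using s by (intro bounded_linear_nspace_compose[OF bounded_linear_fst_tangent bounded_linear_Dx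
      E S]) auto

text \<open>Order s - 1 serves the second component of the Christoffel map; order s - 2 serves the
  occurrence of the same expression inside \<open>source1\<close>.\<close>

lemma bilinear_source2:
  assumes "r = s - 1 \<or> r = s - 2"
  shows "bounded_bilinear_nspace (tangent_space s) (tangent_space s) (sobolev r)
    (\<lambda>X Y. Dx (fst X) * snd Y + Dx (fst Y) * snd X)"
proof -
  have "bounded_bilinear_nspace (sobolev (s - 1)) (sobolev (s - 1)) (sobolev r) (*)"
    using s assms by (intro bounded_bilinear_sobolev_mult) auto
  note B = bilinear_precompose_linear[OF this bounded_linear_Dx_fst bounded_linear_snd_tangent E E S S]
  show ?thesis by (rule bilinear_add[OF B bilinear_flip[OF B] E E S])
qed

lemma source1_L2sym: "source1 s \<in> pts (L2sym (tangent_space s) (sobolev (s - 2)))"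
  unfolding source1_def
proof (rule restrict2_L2sym[OF _ _ E])
  have D: "bounded_linear_nspace (sobolev (s - 1)) (sobolev (s - 2)) Dx"
    using bounded_linear_Dx[of "s - 1"] s by simp
  have m1: "bounded_bilinear_nspace (sobolev (s - 1)) (sobolev (s - 1)) (sobolev (s - 1)) (*)"
    and m2: "bounded_bilinear_nspace (sobolev s) (sobolev s) (sobolev (s - 1)) (*)"
    using s by (auto intro!: bounded_bilinear_sobolev_mult)
  have 1: "bounded_bilinear_nspace (tangent_space s) (tangent_space s) (sobolev (s - 2)) (\<lambda>X Y. Dx
      (snd X * snd Y))"
    by (rule bilinear_compose_linear[OF bilinear_precompose_linear[OF m1
        bounded_linear_snd_tangent bounded_linear_snd_tangent E E S S] D E E S])
  have 2: "bounded_bilinear_nspace (tangent_space s) (tangent_space s) (sobolev (s - 2)) (\<lambda>X Y. (-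
      3/2) *\<^sub>R Dx (fst X * fst Y))"
    by (rule bilinear_compose_linear[OF bilinear_compose_linear[OF bilinear_precompose_linear[OF
        m2 bounded_linear_fst_tangent
          bounded_linear_fst_tangent E E S S] D E E S] bounded_linear_scaleR[OF S] E E S])
  have 3: "bounded_bilinear_nspace (tangent_space s) (tangent_space s) (sobolev (s - 2))
      (\<lambda>X Y. (- 1/2) *\<^sub>R (Dx (fst X) * snd Y + Dx (fst Y) * snd X))"
    by (rule bilinear_compose_linear[OF bilinear_source2[OF disjI2[OF refl]]
        bounded_linear_scaleR[OF S] E E S])
  show "bounded_bilinear_nspace (tangent_space s) (tangent_space s) (sobolev (s - 2))
     (\<lambda>X Y. Dx (snd X * snd Y) + (- 3/2) *\<^sub>R Dx (fst X * fst Y) + (- 1/2) *\<^sub>R (Dx (fst X) * snd Y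
         + Dx (fst Y) * snd X))"
    by (rule bilinear_add[OF bilinear_add[OF 1 2 E E S] 3 E E S])
qed (simp add: mult.commute add.commute)

lemma source2_L2sym: "source2 s \<in> pts (L2sym (tangent_space s) (sobolev (s - 1)))"
  unfolding source2_def
  by (rule restrict2_L2sym[OF bilinear_source2 _ E]) (simp_all add: add.commute)

text \<open>The innermost layer of \<open>conj_Ainv\<close>. Each layer is bounded and bilinear in
  its coefficient and in the operator-valued result of the layer inside it, which is the form the
  Leibniz rule takes.\<close>

lemma bilinear_resolvent1:
  "bounded_bilinear_nspace (sobolev s) (L2sym (tangent_space s) (sobolev (s - 2))) (L2sym
      (tangent_space s) (sobolev (s - 1)))
    (\<lambda>a M X Y. resolvent 1 (a * M X Y))"
proof (rule bilinear_L2sym[OF _ E S S S])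
  have m: "bounded_bilinear_nspace (sobolev s) (sobolev (s - 2)) (sobolev (s - 2)) (*)"
    using s by (auto intro!: bounded_bilinear_sobolev_mult)
  have "bounded_linear_nspace (sobolev (s - 2)) (sobolev (s - 1)) (resolvent 1)"
    using bounded_linear_resolvent[of 1 "s - 2"] by simp
  then show "bounded_bilinear_nspace (sobolev s) (sobolev (s - 2)) (sobolev (s - 1)) (\<lambda>a q.
      resolvent 1 (a * q))"
    by (rule bilinear_compose_linear[OF m _ S S S])
qed

lemma bilinear_resolvent2:
  "bounded_bilinear_nspace (sobolev (s - 1)) (L2sym (tangent_space s) (sobolev (s - 1))) (L2sym
      (tangent_space s) (sobolev s))
    (\<lambda>a M X Y. resolvent (- 1) (a * M X Y))"
proof (rule bilinear_L2sym[OF _ E S S S])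
  have m: "bounded_bilinear_nspace (sobolev (s - 1)) (sobolev (s - 1)) (sobolev (s - 1)) (*)"
    using s by (auto intro!: bounded_bilinear_sobolev_mult)
  have "bounded_linear_nspace (sobolev (s - 1)) (sobolev s) (resolvent (- 1))"
    using bounded_linear_resolvent[of "- 1" "s - 1"] by simp
  then show "bounded_bilinear_nspace (sobolev (s - 1)) (sobolev (s - 1)) (sobolev s) (\<lambda>a q.
      resolvent (- 1) (a * q))"
    by (rule bilinear_compose_linear[OF m _ S S S])
qed

lemma bilinear_first:
  "bounded_bilinear_nspace (sobolev s) (L2sym (tangent_space s) (sobolev s)) (L2sym (tangent_space
      s) (tangent_space s))
    (\<lambda>a M X Y. (a * M X Y, 0))"
proof (rule bilinear_L2sym[OF _ E S S E])
  have m: "bounded_bilinear_nspace (sobolev s) (sobolev s) (sobolev s) (*)"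
    using s by (auto intro!: bounded_bilinear_sobolev_mult)
  have "bounded_linear_nspace (sobolev s) (tangent_space s) (\<lambda>x. (x, 0))"
    unfolding tangent_space_def by (rule bounded_linear_inl[OF S S])
  then show "bounded_bilinear_nspace (sobolev s) (sobolev s) (tangent_space s) (\<lambda>a q. (a * q, 0))"
    by (rule bilinear_compose_linear[OF m _ S S S])
qed

lemma bilinear_second:
  "bounded_bilinear_nspace (sobolev (s - 1)) (L2sym (tangent_space s) (sobolev (s - 1))) (L2sym
      (tangent_space s) (tangent_space s))
    (\<lambda>a M X Y. (0, (- 1) *\<^sub>R (a * M X Y)))"
proof (rule bilinear_L2sym[OF _ E S S E])
  have m: "bounded_bilinear_nspace (sobolev (s - 1)) (sobolev (s - 1)) (sobolev (s - 1)) (*)"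
    using s by (auto intro!: bounded_bilinear_sobolev_mult)
  have "bounded_linear_nspace (sobolev (s - 1)) (tangent_space s) (\<lambda>x. (0, x))"
    unfolding tangent_space_def by (rule bounded_linear_inr[OF S S])
  then show "bounded_bilinear_nspace (sobolev (s - 1)) (sobolev (s - 1)) (tangent_space s) (\<lambda>a q.
      (0, (- 1) *\<^sub>R (a * q)))"
    by (rule bilinear_compose_linear[OF bilinear_compose_linear[OF m bounded_linear_scaleR[OF S] S
        S S] _ S S S])
qed

text \<open>The layers are assembled from the inside out. Leaving the linear map \<open>L\<close> to
  the displacement arbitrary makes the result applicable in charts without a separate chain
  rule.\<close>

lemma smooth_spray:
  assumes L: "bounded_linear_nspace M (sobolev s) L" and M: "seminormed M" and U: "U \<subseteq> pts M"
    and pos: "\<And>x p. x \<in> U \<Longrightarrow> 0 < 1 + Dx (L x) p"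
  shows "smooth_nspace M (L2sym (tangent_space s) (tangent_space s)) U (\<lambda>x. spray s (L x))"
proof -
  note SL = seminormed_L2sym[OF E S] and SE = seminormed_L2sym[OF E E]
  have s1: "s > 1/2" "s - 1 > 1/2" "s - 1 > 3/2" "s > 3/2" using s by auto
  have L2: "bounded_linear_nspace M (sobolev s) (\<lambda>x. (-2) *\<^sub>R L x)"
    by (rule bounded_linear_nspace_compose[OF L bounded_linear_scaleR[OF S] M S])
  have LD: "bounded_linear_nspace M (sobolev (s - 1)) (\<lambda>x. Dx (L x))"
    by (rule bounded_linear_nspace_compose[OF L bounded_linear_Dx[OF s1(4)] M S])
  have e1: "smooth_nspace M (sobolev s) U (\<lambda>x. expo (L x))" by (rule smooth_expo[OF s1(1) L M U])
  have e2: "smooth_nspace M (sobolev s) U (\<lambda>x. expo ((-2) *\<^sub>R L x))"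
      by (rule smooth_expo[OF s1(1) L2 M U])
  have j: "smooth_nspace M (sobolev (s - 1)) U (\<lambda>x. 1 + Dx (L x))"
    by (rule smooth_affine[OF s1(2) LD M U sobolev_one])
  have r: "smooth_nspace M (sobolev (s - 1)) U (\<lambda>x. recip (1 + Dx (L x)))"
  proof (rule smooth_recip[OF s1(3) LD M U sobolev_one])
    show "(1 + Dx (L x)) p \<noteq> 0" if "x \<in> U" for x p using pos[OF that, of p] by simp
  qed
  have m: "bounded_bilinear_nspace (sobolev s) (sobolev (s - 1)) (sobolev (s - 1)) (*)"
    using s1 by (auto intro!: bounded_bilinear_sobolev_mult)
  have b: "smooth_nspace M (sobolev (s - 1)) U (\<lambda>x. expo ((-2) *\<^sub>R L x) * (1 + Dx (L x)))"
    by (rule smooth_nspace_bilinear[OF e2 j m M S S S])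
  \<comment> \<open>\<open>source1 s\<close> is a constant element here, so the innermost layer is a
    bounded linear image of \<open>expo (L x)\<close>.\<close>
  have "smooth_nspace M (L2sym (tangent_space s) (sobolev (s - 1))) U (\<lambda>x X Y. resolvent 1 (expo
      (L x) * source1 s X Y))"
    by (rule smooth_nspace_linear[OF e1 bilinear_left[OF bilinear_resolvent1 S SL source1_L2sym] M
        S SL])
  from smooth_nspace_bilinear[OF e1 smooth_nspace_bilinear[OF b this bilinear_resolvent2 M S SL
      SL] bilinear_first M S SL SE]
  have 1: "smooth_nspace M (L2sym (tangent_space s) (tangent_space s)) U (\<lambda>x X Y. (conj_Ainv (L x)
      (source1 s X Y), 0))"
    unfolding conj_Ainv_def .
  have 2: "smooth_nspace M (L2sym (tangent_space s) (tangent_space s)) U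
      (\<lambda>x X Y. (0, (- 1) *\<^sub>R (recip (1 + Dx (L x)) * source2 s X Y)))"
    by (rule smooth_nspace_linear[OF r bilinear_left[OF bilinear_second S SL source2_L2sym] M S SE])
  show ?thesis unfolding spray_def by (rule smooth_nspace_add[OF 1 2 M SE])
qed

end

context sobolev_diffeo
begin

lemma recip_eq: "recip (1 + Dx u) = inv_jacobian"
  by (simp add: recip_def inv_jacobian_def jacobian_def fun_eq_iff)

text \<open>Besides the carrier condition, this supplies the vanishing outside the tangent space
  that matches the default value in \<open>christoffel\<close>.\<close>

lemma spray_L2sym: "spray s u \<in> pts (L2sym (tangent_space s) (tangent_space s))"
proof -
  note S = seminormed_sobolev and E = seminormed_tangent_space
  have 1: "expo u \<in> pts (sobolev s)" using expo_sobolev[of 1] by simp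
  have j: "1 + Dx u = jacobian" by (simp add: jacobian_def fun_eq_iff)
  have 2: "expo ((-2) *\<^sub>R u) * (1 + Dx u) \<in> pts (sobolev (s - 1))"
    unfolding j using s by (intro sobolev_mult_mem sobolev_mono(1)[OF _ expo_sobolev]
        jacobian_sobolev) auto
  have mem: "B a M \<in> pts G" if "bounded_bilinear_nspace E F G B" "a \<in> pts E" "M \<in> pts F"
    for E F G B a M
    using that by (simp add: bounded_bilinear_nspace_def)
  show ?thesis
    unfolding spray_def conj_Ainv_def recip_eq
    by (intro seminormed.add_mem[OF seminormed_L2sym[OF E E]]
        mem[OF bilinear_first[OF s] 1] mem[OF bilinear_resolvent2[OF s] 2] mem[OF
            bilinear_resolvent1[OF s] 1]
        mem[OF bilinear_second[OF s] inv_jacobian_sobolev] source1_L2sym[OF s] source2_L2sym[OF s])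
qed

text \<open>By the conjugation rule every argument of A^-1, and the second component as well, has
  the form (q/\<phi>_x) o \<phi>^-1. \<open>Ainv_comp\<close> moves the composition outside A^-1,
  where the final composition with \<phi> cancels it.\<close>

lemma christoffel_eq_spray: "christoffel s (diffeo, f) = spray s u"
proof (intro ext)
  fix X Y
  show "christoffel s (diffeo, f) X Y = spray s u X Y"
  proof (cases "X \<in> pts (tangent_space s) \<and> Y \<in> pts (tangent_space s)")
    case False
    then have "spray s u X Y = 0" using spray_L2sym unfolding L2sym_pts_iff by blast
    then show ?thesis using False by (auto simp: christoffel_def)
  next
    case True
    obtain a \<rho> where X: "X = (a, \<rho>)" by fastforce
    obtain b \<tau> where Y: "Y = (b, \<tau>)" by fastforce
    have m: "a \<in> pts (sobolev s)" "b \<in> pts (sobolev s)" "\<rho> \<in> pts (sobolev (s - 1))" "\<tau>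
        \<in> pts (sobolev (s - 1))"
      using True by (auto simp: X Y tangent_space_def nprod_def)
    have s1: "s > 3/2" "s - 1 > 3/2" "s - 1 > 1/2" "s > 1/2" "s - 2 > 1/2" using s by auto
    have C: "C1 a" "C1 b" "C1 \<rho>" "C1 \<tau>" 
      by (rule sobolev_C1[OF s1(1) m(1)] sobolev_C1[OF s1(1) m(2)] sobolev_C1[OF s1(2) m(3)]
          sobolev_C1[OF s1(2) m(4)])+
    define qa where "qa = Dx (a * b)"
    define qb where "qb = Dx a * \<tau> + Dx b * \<rho>"
    define qc where "qc = Dx (\<rho> * \<tau>)"
    have D: "Dx w \<in> pts (sobolev (s - 2))" if "w \<in> pts (sobolev (s - 1))" for w
      using sobolev_Dx(1)[OF s1(2) that] by simp
    have q: "qa \<in> pts (sobolev (s - 2))" "qc \<in> pts (sobolev (s - 2))"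
      unfolding qa_def qc_def
      using m(3,4) sobolev_mono(1)[OF _ m(1), of "s - 1"] sobolev_mono(1)[OF _ m(2), of "s - 1"]
      by (auto intro!: D sobolev_mult_mem s1)
    have "qb \<in> pts (sobolev (s - 1))"
      unfolding qb_def using m s1 by (intro seminormed.add_mem[OF seminormed_sobolev]
          sobolev_mult_mem sobolev_Dx)
    then have qb: "qb \<in> pts (sobolev (s - 2))" by (rule sobolev_mono(1)[rotated]) simp
    have prod: "(x \<circ> inv_diffeo) * (y \<circ> inv_diffeo) = (x * y) \<circ> inv_diffeo" for x y :: "circle \<Rightarrow> real"
      by (simp add: fun_eq_iff)
    have ea: "Dx ((a \<circ> inv_diffeo) * (b \<circ> inv_diffeo)) = (qa * inv_jacobian) \<circ> inv_diffeo"
      unfolding prod qa_def by (rule C1_comp(2)[OF C1_rules(3)[OF C(1,2)]])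
    have ec: "Dx ((\<rho> \<circ> inv_diffeo) * (\<tau> \<circ> inv_diffeo)) = (qc * inv_jacobian) \<circ> inv_diffeo"
      unfolding prod qc_def by (rule C1_comp(2)[OF C1_rules(3)[OF C(3,4)]])
    have eb: "Dx (a \<circ> inv_diffeo) * (\<tau> \<circ> inv_diffeo) + Dx (b \<circ> inv_diffeo) * (\<rho> \<circ> inv_diffeo)
        = (qb * inv_jacobian) \<circ> inv_diffeo"
      unfolding C1_comp(2)[OF C(1)] C1_comp(2)[OF C(2)] qb_def by (simp add: fun_eq_iff algebra_simps)
    let ?T = "conj_Ainv u"
    note T = conj_Ainv_linear
    have S: "seminormed (sobolev (s - 2))" by (rule seminormed_sobolev)
    \<comment> \<open>The definition applies A^-1 to three separate terms, while
      \<open>spray\<close> applies the conjugated inverse to their combination. Linearity is taken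
      from \<open>conj_Ainv\<close>, where boundedness and linearity are already known.\<close>
    have lin: "?T (qc + (- 3/2) *\<^sub>R qa + (- 1/2) *\<^sub>R qb) = ?T qc + (- 3/2) *\<^sub>R ?T qa
        + (- 1/2) *\<^sub>R ?T qb"
    proof -
      have add: "?T (x + y) = ?T x + ?T y" if "x \<in> pts (sobolev (s - 2))" "y
          \<in> pts (sobolev (s - 2))" for x y
        using T that unfolding bounded_linear_nspace_def by blast
      have sc: "?T (c *\<^sub>R x) = c *\<^sub>R ?T x" if "x \<in> pts (sobolev (s - 2))" for x c
        using T that unfolding bounded_linear_nspace_def by blast
      note mem = seminormed.add_mem[OF S] seminormed.scale_mem[OF S]
      show ?thesis
        by (simp only: add[OF mem(1)[OF q(2) mem(2)[OF q(1)]] mem(2)[OF qb]] add[OF q(2) mem(2)[OF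
            q(1)]] sc[OF q(1)] sc[OF qb])
    qed
    have s1X: "source1 s X Y = qc + (- 3/2) *\<^sub>R qa + (- 1/2) *\<^sub>R qb"
      using True by (simp add: source1_def restrict2_def X Y qa_def qb_def qc_def)
    have s2X: "source2 s X Y = qb"
      using True by (simp add: source2_def restrict2_def X Y qb_def)
    have "christoffel s (diffeo, f) X Y = comp2 (Gamma_id s (a \<circ> inv_diffeo, \<rho> \<circ> inv_diffeo) (b \<circ>
        inv_diffeo, \<tau> \<circ> inv_diffeo)) diffeo"
      using True by (simp add: christoffel_def comp2_def X Y inv_diffeo_eq)
    also have "\<dots> = ((- ((3/2) *\<^sub>R (?T qa \<circ> inv_diffeo)) - (1/2) *\<^sub>R (?T qb \<circ> inv_diffeo)
        + (?T qc \<circ> inv_diffeo)) \<circ> diffeo,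
        (- ((qb * inv_jacobian) \<circ> inv_diffeo)) \<circ> diffeo)"
      by (simp only: Gamma_id_def Gamma0_id_def comp2_def case_prod_conv fst_conv snd_conv ea eb ec
          Ainv_comp[OF q(1)] Ainv_comp[OF qb] Ainv_comp[OF q(2)])
    also have "\<dots> = (?T qc + (- 3/2) *\<^sub>R ?T qa + (- 1/2) *\<^sub>R ?T qb, (- 1) *\<^sub>R (inv_jacobian * qb))"
      by (simp add: fun_eq_iff scaleR_fun_def)
    also have "\<dots> = spray s u X Y"
      unfolding spray_def plus_fun_apply s1X s2X recip_eq lin by simp
    finally show ?thesis .
  qed
qed

end

section \<open>Passage to the charts\<close>

definition displacement :: "real \<times> (circle \<Rightarrow> real) \<times> (circle \<Rightarrow> real) \<Rightarrow> circle \<Rightarrow> real" where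
  "displacement x = (\<lambda>p. fst x) + fst (snd x)"

lemma seminormed_real_nspace: "seminormed real_nspace"
  by unfold_locales (auto simp: real_nspace_def abs_mult)

lemma seminormed_based_sobolev: "seminormed (based_sobolev s)"
proof -
  interpret S: seminormed "sobolev s" by (rule seminormed_sobolev)
  have "(c *\<^sub>R h) p = c * h p" for c p and h :: "circle \<Rightarrow> real" by (simp add: scaleR_fun_def)
  then show ?thesis
    by unfold_locales (auto simp: based_sobolev_def S.zero_mem S.add_mem S.scale_mem S.nrm_ge0
        S.nrm_add S.nrm_scale
        intro: S.scale_mem)
qed

lemma seminormed_model_space: "seminormed (model_space s)"
  unfolding model_space_def
  by (intro seminormed_nprod seminormed_real_nspace seminormed_based_sobolev seminormed_sobolev)

text \<open>The displacement c + h is linear in the chart coordinates, so a chart contributes only a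
  bounded linear map to the smoothness argument.\<close>

lemma bounded_linear_displacement: "bounded_linear_nspace (model_space s) (sobolev s) displacement"
proof -
  have c: "bounded_linear_nspace real_nspace (sobolev s) (\<lambda>c p. c)"
    unfolding bounded_linear_nspace_def using sobolev_const
    by (auto simp: real_nspace_def fun_eq_iff scaleR_fun_def intro!: exI[of _ 1])
  have i: "bounded_linear_nspace (based_sobolev s) (sobolev s) (\<lambda>h. h)"
    unfolding bounded_linear_nspace_def by (auto simp: based_sobolev_def intro!: exI[of _ 1])
  have S: "seminormed (nprod (based_sobolev s) (sobolev (s - 1)))"
    by (intro seminormed_nprod seminormed_based_sobolev seminormed_sobolev)
  note M = seminormed_model_space[of s, unfolded model_space_def]
  have 1: "bounded_linear_nspace (nprod real_nspace (nprod (based_sobolev s) (sobolev (s - 1))))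
      (sobolev s) (\<lambda>x p. fst x)"
    by (rule bounded_linear_nspace_compose[OF bounded_linear_fst c M seminormed_real_nspace])
  have 2: "bounded_linear_nspace (nprod real_nspace (nprod (based_sobolev s) (sobolev (s - 1))))
      (sobolev s) (\<lambda>x. fst (snd x))"
    by (rule bounded_linear_nspace_compose[OF bounded_linear_nspace_compose[OF bounded_linear_snd
        bounded_linear_fst M S] i M seminormed_based_sobolev])
  show ?thesis
    unfolding model_space_def displacement_def[abs_def] by (rule bounded_linear_nspace_add[OF 1 2
        M seminormed_sobolev])
qed

lemma sobolev_diffeo_displacement:
  assumes s: "s > 5/2" and x: "x \<in> chart_range s a"
  shows "sobolev_diffeo s (displacement x)"
proof
  obtain c h f where [simp]: "x = (c, h, f)" by (cases x)
  have m: "(c, h, f) \<in> pts (model_space s)" and pos: "\<And>p. Dx h p > - 1" using x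
      by (auto simp: chart_range_def)
  have h: "h \<in> pts (sobolev s)" using m by (simp add: model_space_def nprod_def based_sobolev_def)
  have "s > 3/2" using s by simp
  then have C: "C1 h" using h by (rule sobolev_C1)
  show "5/2 < s" by (rule s)
  show "displacement x \<in> pts (sobolev s)"
    by (rule bounded_linear_nspace_mem[OF bounded_linear_displacement]) (simp add: m)
  have "Dx (displacement x) = Dx h"
    using C1_rules(2)[OF C1_const(1) C, of c] by (simp add: displacement_def C1_const(2))
  then show "0 < 1 + Dx (displacement x) p" for p using pos[of p] by simp
qed

theorem proposition4p1:
  fixes s :: real
  assumes "s > 5/2"
  shows "smooth_on_HsG s (L2sym (tangent_space s) (tangent_space s)) (christoffel s)"
  unfolding smooth_on_HsG_def
proof (intro conjI allI)
  have s: "s > 3/2" using assms by simp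
  show "christoffel s \<in> HsG s \<rightarrow> pts (L2sym (tangent_space s) (tangent_space s))"
  proof
    fix \<Phi> assume "\<Phi> \<in> HsG s"
    then obtain \<phi> f where \<Phi>: "\<Phi> = (\<phi>, f)" and \<phi>: "\<phi> \<in> HsDiff s" by (auto simp: HsG_def)
    from \<phi> obtain F w where F: "\<And>x. \<phi> (proj x) = proj (F x)" "\<And>x. 0 < deriv F x"
      "\<And>x. F x = x + w (proj x)" and w: "w \<in> pts (sobolev s)"
      unfolding HsDiff_def by blast
    \<comment> \<open>The lift is the identity plus \<open>w\<close>, so the condition on
      \<open>deriv F\<close> becomes positivity of 1 + \<open>Dx w\<close>, first on the line and
      then on the circle.\<close>
    have "(F has_real_derivative 1 + Dx w (proj x)) (at x)" for x
      unfolding F(3)[abs_def] by (auto intro!: derivative_eq_intros C1_deriv[OF sobolev_C1[OF s w]])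
    then have pos: "0 < 1 + Dx w (proj x)" for x using F(2)[of x] DERIV_imp_deriv by metis
    interpret sobolev_diffeo s w
    proof
      show "0 < 1 + Dx w p" for p using pos[of "rep_circle p"] by simp
    qed (use assms w in auto)
    have "\<phi> = diffeo"
    proof
      fix p
      show "\<phi> p = diffeo p" using F(1)[of "rep_circle p"] F(3)[of "rep_circle p"]
          by (simp add: diffeo_def)
    qed
    then show "christoffel s \<Phi> \<in> pts (L2sym (tangent_space s) (tangent_space s))"
      unfolding \<Phi> using christoffel_eq_spray spray_L2sym by simp
  qed
  show "smooth_nspace (model_space s) (L2sym (tangent_space s) (tangent_space s)) (chart_range s
      a) (christoffel s \<circ> chart_inv)" for a
  proof (rule smooth_nspace_cong)
    show "smooth_nspace (model_space s) (L2sym (tangent_space s) (tangent_space s)) (chart_range s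
        a) (\<lambda>x. spray s (displacement x))"
    proof (rule smooth_spray[OF assms bounded_linear_displacement seminormed_model_space])
      show "chart_range s a \<subseteq> pts (model_space s)" by (auto simp: chart_range_def)
      show "0 < 1 + Dx (displacement x) p" if "x \<in> chart_range s a" for x p
        by (rule sobolev_diffeo.u_pos[OF sobolev_diffeo_displacement[OF assms that]])
    qed
    \<comment> \<open>The element with coordinates (c, h, f) has displacement c + h, so on the chart
      the Christoffel map is \<open>spray\<close> evaluated at a linear function of the
      coordinates.\<close>
    fix x assume "x \<in> chart_range s a"
    then interpret sobolev_diffeo s "displacement x" by (rule sobolev_diffeo_displacement[OF assms])
    obtain c h f where x: "x = (c, h, f)" by (cases x)
    have "displacement x p = c + h p" for p by (simp add: x displacement_def)
    then have "diffeo p = proj (c + rep_circle p + h p)" for p by (simp add: diffeo_def add_ac)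
    then have "chart_inv x = (diffeo, f)"
      by (simp add: chart_inv_def x fun_eq_iff)
    then show "spray s (displacement x) = (christoffel s \<circ> chart_inv) x"
      using christoffel_eq_spray[of f] by simp
  qed
qed

end
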